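(* Let $L$ be an operator on $L^2(\mathbb R^n)$ satisfying conditions (A1) and (A2) (recalled in the context) for some $1\le p_0<q_0\le\infty$, $\epsilon>0$ and $\kappa>0$. Let $p_0<p<q<q_0$ and $\alpha=n\left(\frac1p-\frac1q\right)$. Suppose $\omega\in A_{1+\frac1{p_0}-\frac1p}\cap \mathrm{RH}_{q(\frac{q_0}{q})'}$. Then, for all $f\in L^\infty_c(\mathbb R^n)$, $$\|L^{-\alpha/\kappa}f\|_{L^q(\omega^q)}\lesssim\left([\omega]_{A_{1+\frac1{p_0}-\frac1p}}[\omega]_{\mathrm{RH}_{q(\frac{q_0}{q})'}}\right)^{1+\max\left\{\frac{p_0p}{p-p_0}\cdot\frac1q,\ \frac{q_0q}{q_0-q}\cdot\frac1{p'}\right\}}\|f\|_{L^p(\omega^p)} .$$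
   Context: Cubes $Q\subset\mathbb R^n$ have sides parallel to the axes and sidelength $\ell(Q)$; $\lambda Q$ is the concentric dilate. $\fint_E f=\frac1{|E|}\int_E f$. For an exponent equal to $\infty$, $L^\infty$ averages are essential suprema; $p'$ is the conjugate exponent. When $q_0=\infty$, $\frac{q_0q}{q_0-q}$ and $q(\frac{q_0}q)'$ are read as $q$. $L_c^\infty(\mathbb R^n)$ is the set of bounded compactly supported functions. Conditions on $L$. (A1): $L$ is a closed densely defined operator of type $\theta$ in $L^2(\mathbb R^n)$ with $0\le\theta<\pi/2$, i.e. its spectrum lies in $\{\lambda\in\mathbb C:|\arg\lambda|\le\theta\}$ and for each $\mu>\theta$ there is $C_\mu$ with $\|(L-\xi I)^{-1}\|\le C_\mu/|\xi|$ for all $\xi$ with $|\arg\xi|\ge\mu$; hence there is a holomorphic semigroup $e^{-zL}$, $|\arg z|<\pi/2-\theta$. Moreover $L$ has a bounded $H_\infty$-functional calculus on $L^2(\mathbb R^n)$. (A2) for $p_0,q_0,\epsilon,\kappa$: for all $p_0\le p\le q\le q_0$, $t>0$ and $k\in\{0,1,2,\dots\}$, $$\|(tL)^ke^{-tL}\|_{L^p\to L^q}\le C_{k,p,q}\,t^{-\frac n\kappa(\frac1p-\frac1q)},$$ and $$\Big(\fint_Q|(tL)^ke^{-tL}f|^q\Big)^{1/q}\le C_{k,p,q}\max\Big\{\Big(\tfrac{3^j\ell(Q)}{t^{1/\kappa}}\Big)^n,\Big(\tfrac{3^j\ell(Q)}{t^{1/\kappa}}\Big)^{n/p}\Big\}\Big(1+\tfrac{t^{1/\kappa}}{\ell(Q)}\Big)^{n/q}\Big(1+\tfrac{3^j\ell(Q)}{t^{1/\kappa}}\Big)^{-n-\epsilon}\Big(\fint_{S_j(Q)}|f|^p\Big)^{1/p}$$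 for all cubes $Q$, all $j\ge2$ and all $f\in L^p(S_j(Q))$, where $S_j(Q)=3^jQ\setminus3^{j-1}Q$ for $j\ge1$. Fractional power: for $0<\alpha<n$, $L^{-\alpha/\kappa}=\frac1{\Gamma(\alpha/\kappa)}\int_0^\infty s^{\alpha/\kappa}e^{-sL}\frac{ds}{s}$. Weights: a weight is a non-negative locally integrable function (positive a.e.); $\langle w\rangle_Q=\fint_Qw$, $\langle w\rangle_{r,Q}=(\fint_Qw^r)^{1/r}$; $\|f\|_{L^p(w)}=(\int|f|^pw)^{1/p}$. For $1<t<\infty$, $[w]_{A_t}=\sup_Q\langle w\rangle_Q\langle w^{1-t'}\rangle_Q^{t-1}$; $[w]_{\mathrm{RH}_r}=\sup_Q\langle w\rangle_{r,Q}/\langle w\rangle_Q$; suprema over all cubes, and membership in a class means finiteness of the constant. $A\lesssim B$ means $A\le CB$ with $C$ depending only on $n,p,q,p_0,q_0$ and $L$ (with its data in (A1), (A2)), not on $f$ or $\omega$. *)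

theory Defs
  imports "HOL-Probability.Probability"
begin

section \<open>Lebesgue norms\<close>

text \<open>Only used for \<^term>\<open>a > 0\<close>.\<close>
definition epowr :: "ennreal \<Rightarrow> real \<Rightarrow> ennreal"  (infixr "epowr" 80) where
  "x epowr a = (if x = \<infinity> then \<infinity> else ennreal (enn2real x powr a))"

definition lp_norm :: "ennreal \<Rightarrow> 'a measure \<Rightarrow> ('a \<Rightarrow> complex) \<Rightarrow> ennreal" where
  "lp_norm p M f =
     (if p = \<infinity> then esssup M (\<lambda>x. ennreal (norm (f x)))
      else (\<integral>\<^sup>+x. ennreal (norm (f x) powr enn2real p) \<partial>M) epowr (1 / enn2real p))"

text \<open>The real number \<open>1/p\<close>, which is \<open>0\<close> for \<open>p = \<infinity>\<close>.\<close>
definition recip :: "ennreal \<Rightarrow> real" where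
  "recip p = enn2real (inverse p)"

definition conj_exp :: "real \<Rightarrow> real" where
  "conj_exp p = p / (p - 1)"

definition cube :: "real^'n \<Rightarrow> real \<Rightarrow> (real^'n) set" where
  "cube c l = cbox (c - (l/2) *\<^sub>R One) (c + (l/2) *\<^sub>R One)"

definition annulus :: "real^'n \<Rightarrow> real \<Rightarrow> nat \<Rightarrow> (real^'n) set" where
  "annulus c l j = cube c (3 ^ j * l) - cube c (3 ^ (j - 1) * l)"

text \<open>\<open>avg_norm p E f\<close> is the normalised norm, the \<open>p\<close>-th root of the mean of \<open>|f|\<^sup>p\<close> over \<open>E\<close>
  (the essential supremum over \<open>E\<close> for \<open>p = \<infinity>\<close>).\<close>
definition avg_norm :: "ennreal \<Rightarrow> (real^'n) set \<Rightarrow> (real^'n \<Rightarrow> complex) \<Rightarrow> ennreal" where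
  "avg_norm p E f = lp_norm p (uniform_measure lebesgue E) f"

section \<open>The complex Hilbert space of square integrable functions\<close>

definition square_int :: "(real^'n \<Rightarrow> complex) \<Rightarrow> bool" where
  "square_int f \<longleftrightarrow> f \<in> borel_measurable lebesgue \<and> integrable lebesgue (\<lambda>x. (norm (f x))\<^sup>2)"

lemma square_int_0: "square_int (\<lambda>x. 0)"
  by (simp add: square_int_def)

lemma square_int_inner:
  assumes "square_int f" "square_int g"
  shows "integrable lebesgue (\<lambda>x. inner (f x) (g x))"
proof (rule Bochner_Integration.integrable_bound)
  show "integrable lebesgue (\<lambda>x. (norm (f x))\<^sup>2 + (norm (g x))\<^sup>2)"
    using assms by (auto simp: square_int_def)
  show "(\<lambda>x. inner (f x) (g x)) \<in> borel_measurable lebesgue"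
    using assms by (auto simp: square_int_def intro!: borel_measurable_inner)
  show "AE x in lebesgue. norm (inner (f x) (g x)) \<le> norm ((norm (f x))\<^sup>2 + (norm (g x))\<^sup>2)"
  proof (rule AE_I2)
    fix x
    have "\<bar>inner (f x) (g x)\<bar> \<le> norm (f x) * norm (g x)" by (rule Cauchy_Schwarz_ineq2)
    moreover have "0 \<le> norm (f x) * norm (g x)" by simp
    moreover have "2 * (norm (f x) * norm (g x)) \<le> (norm (f x))\<^sup>2 + (norm (g x))\<^sup>2"
      using sum_squares_bound[of "norm (f x)" "norm (g x)"] by (simp add: mult.assoc)
    ultimately show "norm (inner (f x) (g x)) \<le> norm ((norm (f x))\<^sup>2 + (norm (g x))\<^sup>2)"
      by simp
  qed
qed

lemma square_int_add:
  assumes "square_int f" "square_int g"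
  shows "square_int (\<lambda>x. f x + g x)"
proof -
  have "integrable lebesgue (\<lambda>x. (norm (f x))\<^sup>2 + (norm (g x))\<^sup>2 + 2 * inner (f x) (g x))"
    using assms square_int_inner[OF assms] by (auto simp: square_int_def)
  moreover have "(norm (f x))\<^sup>2 + (norm (g x))\<^sup>2 + 2 * inner (f x) (g x) = (norm (f x + g x))\<^sup>2" for x
    by (simp add: power2_norm_eq_inner inner_add inner_commute)
  ultimately show ?thesis
    using assms by (auto simp: square_int_def)
qed

lemma square_int_cmult:
  assumes "square_int f"
  shows "square_int (\<lambda>x. c * f x)"
  using assms by (auto simp: square_int_def norm_mult power_mult_distrib)

lemma square_int_uminus: "square_int f \<Longrightarrow> square_int (\<lambda>x. - f x)"
  using square_int_cmult[of f "-1"] by simp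

lemma square_int_scaleR: "square_int f \<Longrightarrow> square_int (\<lambda>x. r *\<^sub>R f x)"
  using square_int_cmult[of f "of_real r"] by (simp add: scaleR_conv_of_real)

lemma square_int_diff: "square_int f \<Longrightarrow> square_int g \<Longrightarrow> square_int (\<lambda>x. f x - g x)"
  using square_int_add[of f "\<lambda>x. - g x"] square_int_uminus[of g] by simp

quotient_type 'n L2 = "real^'n \<Rightarrow> complex" / partial:
  "\<lambda>f g. square_int f \<and> square_int g \<and> (AE x in lebesgue. f x = g x)"
proof (rule part_equivpI)
  show "\<exists>f::real^'n \<Rightarrow> complex. square_int f \<and> square_int f \<and> (AE x in lebesgue. f x = f x)"
    using square_int_0 by auto
  show "symp (\<lambda>f g::real^'n \<Rightarrow> complex. square_int f \<and> square_int g \<and> (AE x in lebesgue. f x = g x))"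
    by (rule sympI) (auto elim: AE_mp)
  show "transp (\<lambda>f g::real^'n \<Rightarrow> complex. square_int f \<and> square_int g \<and> (AE x in lebesgue. f x = g x))"
    by (rule transpI) (auto elim: AE_mp)
qed

instantiation L2 :: (finite) real_vector
begin

lift_definition zero_L2 :: "'a L2" is "\<lambda>x. 0"
  by (simp add: square_int_0)

lift_definition plus_L2 :: "'a L2 \<Rightarrow> 'a L2 \<Rightarrow> 'a L2" is "\<lambda>f g x. f x + g x"
  by (auto intro: square_int_add)

lift_definition minus_L2 :: "'a L2 \<Rightarrow> 'a L2 \<Rightarrow> 'a L2" is "\<lambda>f g x. f x - g x"
  by (auto intro: square_int_diff)

lift_definition uminus_L2 :: "'a L2 \<Rightarrow> 'a L2" is "\<lambda>f x. - f x"
  by (auto intro: square_int_uminus)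

lift_definition scaleR_L2 :: "real \<Rightarrow> 'a L2 \<Rightarrow> 'a L2" is "\<lambda>r f x. r *\<^sub>R f x"
  by (auto intro: square_int_scaleR)

instance
proof
  fix x y z :: "'a L2" and a b :: real
  show "x + y + z = x + (y + z)"
    by transfer (auto simp: add.assoc intro!: square_int_add)
  show "x + y = y + x"
    by transfer (auto simp: add.commute intro!: square_int_add)
  show "0 + x = x"
    by transfer (auto intro!: square_int_add square_int_0)
  show "- x + x = 0"
    by transfer (auto intro!: square_int_0)
  show "x - y = x + - y"
    by transfer (auto intro!: square_int_diff)
  show "a *\<^sub>R (x + y) = a *\<^sub>R x + a *\<^sub>R y"
    by transfer (auto simp: algebra_simps intro!: square_int_add square_int_scaleR)
  show "(a + b) *\<^sub>R x = a *\<^sub>R x + b *\<^sub>R x"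
    by transfer (auto simp: scaleR_add_left intro!: square_int_add square_int_scaleR)
  show "a *\<^sub>R b *\<^sub>R x = (a * b) *\<^sub>R x"
    by transfer (auto intro!: square_int_scaleR simp: mult.assoc)
  show "1 *\<^sub>R x = x"
    by transfer auto
qed

end

instantiation L2 :: (finite) real_inner
begin

text \<open>The real inner product, i.e. the real part of the Hermitian one; it induces the usual norm.\<close>
lift_definition inner_L2 :: "'a L2 \<Rightarrow> 'a L2 \<Rightarrow> real" is "\<lambda>f g. \<integral>x. inner (f x) (g x) \<partial>lebesgue"
proof -
  fix f1 f2 g1 g2 :: "real^'a \<Rightarrow> complex"
  assume f: "square_int f1 \<and> square_int f2 \<and> (AE x in lebesgue. f1 x = f2 x)"
    and g: "square_int g1 \<and> square_int g2 \<and> (AE x in lebesgue. g1 x = g2 x)"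
  show "(\<integral>x. inner (f1 x) (g1 x) \<partial>lebesgue) = (\<integral>x. inner (f2 x) (g2 x) \<partial>lebesgue)"
    using f g square_int_inner[of f1 g1] square_int_inner[of f2 g2]
    by (intro integral_cong_AE) (auto dest: borel_measurable_integrable elim: AE_mp)
qed

definition norm_L2 :: "'a L2 \<Rightarrow> real" where "norm_L2 x = sqrt (inner x x)"
definition sgn_L2 :: "'a L2 \<Rightarrow> 'a L2" where "sgn_L2 x = x /\<^sub>R norm x"
definition dist_L2 :: "'a L2 \<Rightarrow> 'a L2 \<Rightarrow> real" where "dist_L2 x y = norm (x - y)"
definition uniformity_L2 :: "('a L2 \<times> 'a L2) filter" where
  "uniformity_L2 = (INF e\<in>{0<..}. principal {(x, y). dist x y < e})"
definition open_L2 :: "'a L2 set \<Rightarrow> bool" where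
  "open_L2 U \<longleftrightarrow> (\<forall>x\<in>U. eventually (\<lambda>(x', y). x' = x \<longrightarrow> y \<in> U) uniformity)"

instance
proof
  fix x y z :: "'a L2" and r :: real
  show "inner x y = inner y x"
    by transfer (simp add: inner_commute)
  show "inner (x + y) z = inner x z + inner y z"
    by transfer (auto simp: inner_add_left square_int_inner)
  show "inner (r *\<^sub>R x) y = r * inner x y"
    by transfer auto
  show "0 \<le> inner x x"
    by transfer (auto intro!: integral_nonneg_AE)
  show "inner x x = 0 \<longleftrightarrow> x = 0"
  proof transfer
    fix f :: "real^'a \<Rightarrow> complex"
    assume "square_int f \<and> square_int f \<and> (AE x in lebesgue. f x = f x)"
    then have f: "square_int f" by simp
    have "(\<integral>x. inner (f x) (f x) \<partial>lebesgue) = 0 \<longleftrightarrow> (AE x in lebesgue. inner (f x) (f x) = 0)"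
      using square_int_inner[OF f f] by (intro integral_nonneg_eq_0_iff_AE) auto
    then show "(\<integral>x. inner (f x) (f x) \<partial>lebesgue) = 0 \<longleftrightarrow>
        square_int f \<and> square_int (\<lambda>x::real^'a. 0::complex) \<and> (AE x in lebesgue. f x = 0)"
      using f by (simp add: square_int_0)
  qed
qed (simp_all only: norm_L2_def sgn_L2_def dist_L2_def uniformity_L2_def open_L2_def)

end

lift_definition scaleC :: "complex \<Rightarrow> 'n::finite L2 \<Rightarrow> 'n L2"  (infixr "*\<^sub>C" 75) is "\<lambda>c f x. c * f x"
  by (auto intro: square_int_cmult)

text \<open>\<^const>\<open>rep_L2\<close> picks a representative, so it is determined up to null sets only. All notions
  below that look at \<open>rep_L2 F\<close> are invariant under changes on null sets.\<close>

section \<open>Unbounded operators on the Hilbert space\<close>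

text \<open>An unbounded operator is identified with its graph.\<close>
type_synonym 'n graph = "('n L2 \<times> 'n L2) set"

definition closed_densely_defined :: "'n::finite graph \<Rightarrow> bool" where
  "closed_densely_defined L \<longleftrightarrow>
     (0, 0) \<in> L \<and>
     (\<forall>u v u' v'. (u, v) \<in> L \<longrightarrow> (u', v') \<in> L \<longrightarrow> (u + u', v + v') \<in> L) \<and>
     (\<forall>c u v. (u, v) \<in> L \<longrightarrow> (c *\<^sub>C u, c *\<^sub>C v) \<in> L) \<and>
     single_valued L \<and> closed L \<and> closure (Domain L) = UNIV"

text \<open>\<open>R\<close> is the bounded two-sided inverse of \<open>\<zeta>I - L\<close>.\<close>
definition is_resolvent :: "'n::finite graph \<Rightarrow> complex \<Rightarrow> ('n L2 \<Rightarrow> 'n L2) \<Rightarrow> bool" where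
  "is_resolvent L \<zeta> R \<longleftrightarrow> bounded_linear R \<and>
     (\<forall>f. (R f, \<zeta> *\<^sub>C R f - f) \<in> L) \<and>
     (\<forall>u v. (u, v) \<in> L \<longrightarrow> R (\<zeta> *\<^sub>C u - v) = u)"

definition resolvent :: "'n::finite graph \<Rightarrow> complex \<Rightarrow> 'n L2 \<Rightarrow> 'n L2" where
  "resolvent L \<zeta> = (THE R. is_resolvent L \<zeta> R)"

definition spectrum :: "'n::finite graph \<Rightarrow> complex set" where
  "spectrum L = {\<zeta>. \<nexists>R. is_resolvent L \<zeta> R}"

definition of_type :: "'n::finite graph \<Rightarrow> real \<Rightarrow> bool" where
  "of_type L \<theta> \<longleftrightarrow>
     spectrum L \<subseteq> {\<zeta>. \<bar>Arg \<zeta>\<bar> \<le> \<theta>} \<and>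
     (\<forall>\<mu>>\<theta>. \<exists>C. \<forall>\<zeta>. \<mu> \<le> \<bar>Arg \<zeta>\<bar> \<longrightarrow> onorm (resolvent L \<zeta>) \<le> C / norm \<zeta>)"

subsection \<open>Functional calculus\<close>

definition open_sector :: "real \<Rightarrow> complex set" where
  "open_sector \<mu> = {z. z \<noteq> 0 \<and> \<bar>Arg z\<bar> < \<mu>}"

text \<open>\<open>(2\<pi>i)\<^sup>-\<^sup>1 \<integral>\<^sub>\<Gamma> \<psi>(\<zeta>) (\<zeta>I - L)\<^sup>-\<^sup>1 f d\<zeta>\<close>, where \<open>\<Gamma>\<close> comes in from infinity along the ray
  \<open>arg \<zeta> = \<nu>\<close> and goes out along \<open>arg \<zeta> = -\<nu>\<close>. For \<open>L\<close> of type \<open>\<theta> < \<nu> < \<mu>\<close> and \<open>\<psi>\<close> holomorphic on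
  \<^term>\<open>open_sector \<mu>\<close>, decaying like a positive power of \<open>|\<zeta>|\<close> at \<open>0\<close> and a negative one at infinity,
  the integral converges absolutely and does not depend on \<open>\<nu>\<close>.\<close>
definition dunford :: "'n::finite graph \<Rightarrow> real \<Rightarrow> (complex \<Rightarrow> complex) \<Rightarrow> 'n L2 \<Rightarrow> 'n L2" where
  "dunford L \<nu> \<psi> f = (1 / (2 * of_real pi * \<i>)) *\<^sub>C
     (integral {0<..} (\<lambda>r. (\<psi> (rcis r (- \<nu>)) * cis (- \<nu>)) *\<^sub>C resolvent L (rcis r (- \<nu>)) f)
      - integral {0<..} (\<lambda>r. (\<psi> (rcis r \<nu>) * cis \<nu>) *\<^sub>C resolvent L (rcis r \<nu>) f))"

definition regularizer :: "complex \<Rightarrow> complex" where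
  "regularizer z = z / (1 + z)\<^sup>2"

text \<open>\<open>b(L) = \<psi>(L)\<^sup>-\<^sup>1 (b\<psi>)(L)\<close> with \<open>\<psi>(z) = z (1 + z)\<^sup>-\<^sup>2\<close>, as a relation; it is the graph of an operator iff
  \<open>\<psi>(L)\<close>, equivalently \<open>L\<close>, is injective.\<close>
definition H_calculus :: "'n::finite graph \<Rightarrow> real \<Rightarrow> (complex \<Rightarrow> complex) \<Rightarrow> 'n graph" where
  "H_calculus L \<nu> b =
     {(f, g). dunford L \<nu> regularizer g = dunford L \<nu> (\<lambda>z. b z * regularizer z) f}"

text \<open>For \<open>L\<close> of type \<open>\<theta>\<close>: on some sector \<^term>\<open>open_sector \<mu>\<close>, \<open>\<theta> < \<mu> < \<pi>\<close>, every bounded holomorphic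
  \<open>b\<close> gives an everywhere defined bounded operator \<open>b(L)\<close> with \<open>\<parallel>b(L)\<parallel> \<le> C \<parallel>b\<parallel>\<^sub>\<infinity>\<close>.\<close>
definition bounded_H_calculus :: "'n::finite graph \<Rightarrow> real \<Rightarrow> bool" where
  "bounded_H_calculus L \<theta> \<longleftrightarrow>
     (\<exists>\<mu> C. \<theta> < \<mu> \<and> \<mu> < pi \<and>
       (\<forall>b. b holomorphic_on open_sector \<mu> \<longrightarrow> bounded (b ` open_sector \<mu>) \<longrightarrow>
         (\<exists>T. bounded_linear T \<and> H_calculus L ((\<theta> + \<mu>) / 2) b = {(f, g). g = T f} \<and>
              onorm T \<le> C * (SUP z\<in>open_sector \<mu>. norm (b z)))))"

definition condA1 :: "'n::finite graph \<Rightarrow> bool" where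
  "condA1 L \<longleftrightarrow> closed_densely_defined L \<and>
     (\<exists>\<theta>. 0 \<le> \<theta> \<and> \<theta> < pi / 2 \<and> of_type L \<theta> \<and> bounded_H_calculus L \<theta>)"

subsection \<open>The semigroup\<close>

text \<open>\<open>T\<close>, considered on \<open>[0, \<infinity>)\<close>, is the strongly continuous semigroup with generator \<open>-L\<close>.\<close>
definition is_semigroup_of :: "'n::finite graph \<Rightarrow> (real \<Rightarrow> 'n L2 \<Rightarrow> 'n L2) \<Rightarrow> bool" where
  "is_semigroup_of L T \<longleftrightarrow>
     (\<forall>t\<ge>0. bounded_linear (T t)) \<and> T 0 = id \<and>
     (\<forall>s\<ge>0. \<forall>t\<ge>0. T (s + t) = T s \<circ> T t) \<and>
     (\<forall>f. continuous_on {0..} (\<lambda>t. T t f)) \<and>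
     L = {(f, g). ((\<lambda>t. (f - T t f) /\<^sub>R t) \<longlongrightarrow> g) (at_right 0)}"

text \<open>\<open>e\<^sup>-\<^sup>t\<^sup>L f\<close> for \<open>t \<ge> 0\<close>.\<close>
definition exp_neg :: "'n::finite graph \<Rightarrow> real \<Rightarrow> 'n L2 \<Rightarrow> 'n L2" where
  "exp_neg L t f = (THE g. \<exists>T. is_semigroup_of L T \<and> g = T t f)"

text \<open>\<open>(tL)\<^sup>k e\<^sup>-\<^sup>t\<^sup>L f\<close>.\<close>
definition pow_exp_neg :: "'n::finite graph \<Rightarrow> nat \<Rightarrow> real \<Rightarrow> 'n L2 \<Rightarrow> 'n L2" where
  "pow_exp_neg L k t f = t ^ k *\<^sub>R (THE g. (exp_neg L t f, g) \<in> L ^^ k)"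

text \<open>The estimates are imposed on \<open>L\<^sup>2 \<inter> L\<^sup>p\<close>, where the semigroup is given; on \<open>L\<^sup>p\<close> it is
  understood as the extension from there.\<close>
definition condA2 :: "'n::finite graph \<Rightarrow> real \<Rightarrow> ennreal \<Rightarrow> real \<Rightarrow> real \<Rightarrow> bool" where
  "condA2 L p0 q0 \<epsilon> \<kappa> \<longleftrightarrow>
     (\<forall>k p q. ennreal p0 \<le> p \<longrightarrow> p \<le> q \<longrightarrow> q \<le> q0 \<longrightarrow>
       (\<exists>C::real.
         (\<forall>t>0. \<forall>f. lp_norm p lebesgue (rep_L2 f) < \<infinity> \<longrightarrow>
            lp_norm q lebesgue (rep_L2 (pow_exp_neg L k t f))
              \<le> ennreal (C * t powr (- (real CARD('n) / \<kappa>) * (recip p - recip q)))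
                  * lp_norm p lebesgue (rep_L2 f)) \<and>
         (\<forall>t>0. \<forall>c. \<forall>l>0. \<forall>j\<ge>2. \<forall>f.
            lp_norm p lebesgue (rep_L2 f) < \<infinity> \<longrightarrow>
            (AE x in lebesgue. x \<notin> annulus c l j \<longrightarrow> rep_L2 f x = 0) \<longrightarrow>
            avg_norm q (cube c l) (rep_L2 (pow_exp_neg L k t f))
              \<le> ennreal (C
                  * max ((3 ^ j * l / t powr (1/\<kappa>)) powr real CARD('n))
                        ((3 ^ j * l / t powr (1/\<kappa>)) powr (real CARD('n) * recip p))
                  * (1 + t powr (1/\<kappa>) / l) powr (real CARD('n) * recip q)
                  * (1 + 3 ^ j * l / t powr (1/\<kappa>)) powr (- real CARD('n) - \<epsilon>))
                * avg_norm p (annulus c l j) (rep_L2 f))))"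

subsection \<open>Fractional powers\<close>

text \<open>\<open>L\<^sub>c\<^sup>\<infinity>\<close>.\<close>
definition bounded_comp_supp :: "(real^'n \<Rightarrow> complex) \<Rightarrow> bool" where
  "bounded_comp_supp f \<longleftrightarrow>
     f \<in> borel_measurable lebesgue \<and> bounded (range f) \<and> compact (closure {x. f x \<noteq> 0})"

text \<open>\<open>g\<close> is (a version of) \<open>L\<^sup>-\<^sup>a f = \<Gamma>(a)\<^sup>-\<^sup>1 \<integral>\<^sub>0\<^sup>\<infinity> s\<^sup>a e\<^sup>-\<^sup>s\<^sup>L f ds/s\<close>. The integrals over \<open>[\<delta>, R]\<close> are taken in
  \<open>L\<^sup>2\<close>. As \<open>\<delta> \<rightarrow> 0\<close> and \<open>R \<rightarrow> \<infinity>\<close> they need not converge in \<open>L\<^sup>2\<close> (even for nice \<open>f\<close> and \<open>L = -\<Delta>\<close> the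
  limit need not be in \<open>L\<^sup>2\<close>), so the improper integral is taken in \<open>L\<^sup>1\<^sub>l\<^sub>o\<^sub>c\<close>; this determines \<open>g\<close> up to
  null sets.\<close>
definition is_neg_power :: "'n::finite graph \<Rightarrow> real \<Rightarrow> 'n L2 \<Rightarrow> (real^'n \<Rightarrow> complex) \<Rightarrow> bool" where
  "is_neg_power L a f g \<longleftrightarrow>
     g \<in> borel_measurable lebesgue \<and>
     (\<forall>K. compact K \<longrightarrow>
       ((\<lambda>(\<delta>, R). \<integral>\<^sup>+x\<in>K. ennreal (norm
            (rep_L2 ((1 / Gamma a) *\<^sub>R integral {\<delta>..R} (\<lambda>s. s powr (a - 1) *\<^sub>R exp_neg L s f)) x - g x))
          \<partial>lebesgue) \<longlongrightarrow> 0) (at_right 0 \<times>\<^sub>F at_top))"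

section \<open>Weights\<close>

definition weight :: "(real^'n \<Rightarrow> real) \<Rightarrow> bool" where
  "weight w \<longleftrightarrow> w \<in> borel_measurable lebesgue \<and> (\<forall>x. 0 \<le> w x) \<and> (AE x in lebesgue. 0 < w x) \<and>
     (\<forall>K. compact K \<longrightarrow> set_integrable lebesgue K w)"

definition mean :: "(real^'n \<Rightarrow> real) \<Rightarrow> (real^'n) set \<Rightarrow> ennreal" where
  "mean w Q = (\<integral>\<^sup>+x. ennreal (w x) \<partial>uniform_measure lebesgue Q)"

definition A_const :: "real \<Rightarrow> (real^'n \<Rightarrow> real) \<Rightarrow> ennreal" where
  "A_const t w = (SUP (c, l)\<in>UNIV \<times> {0<..}.
     mean w (cube c l) * mean (\<lambda>x. w x powr (1 - conj_exp t)) (cube c l) epowr (t - 1))"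

definition RH_const :: "real \<Rightarrow> (real^'n \<Rightarrow> real) \<Rightarrow> ennreal" where
  "RH_const r w = (SUP (c, l)\<in>UNIV \<times> {0<..}.
     mean (\<lambda>x. w x powr r) (cube c l) epowr (1 / r) / mean w (cube c l))"

definition weighted_norm :: "real \<Rightarrow> (real^'n \<Rightarrow> real) \<Rightarrow> (real^'n \<Rightarrow> complex) \<Rightarrow> ennreal" where
  "weighted_norm p w f = lp_norm (ennreal p) (density lebesgue (\<lambda>x. ennreal (w x))) f"

text \<open>\<open>q (q0/q)'\<close> and \<open>q0 q / (q0 - q)\<close>, both read as \<open>q\<close> for \<open>q0 = \<infinity>\<close>.\<close>
definition RH_exponent :: "real \<Rightarrow> ennreal \<Rightarrow> real" where
  "RH_exponent q q0 = (if q0 = \<infinity> then q else q * conj_exp (enn2real q0 / q))"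

definition dual_exponent :: "real \<Rightarrow> ennreal \<Rightarrow> real" where
  "dual_exponent q q0 = (if q0 = \<infinity> then q else enn2real q0 * q / (enn2real q0 - q))"

end

theory Submission
  imports Defs
begin

text \<open>
  With \<open>v = \<omega>\<^bsup>-r\<^sub>1\<^esup>\<close>, \<open>u = \<omega>\<^bsup>r\<^sub>2\<^esup>\<close>, \<open>1/r\<^sub>1 = 1/p\<^sub>0 - 1/p\<close> and \<open>1/r\<^sub>2 = 1/q - 1/q\<^sub>0\<close>, the
  hypothesis on \<open>\<omega>\<close> bounds \<open>\<langle>v\<rangle>\<^sub>Q\<^bsup>1/r\<^sub>1\<^esup> \<langle>u\<rangle>\<^sub>Q\<^bsup>1/r\<^sub>2\<^esup>\<close> by the product \<open>K\<close> of the two constants.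
  The bounds for \<open>e\<^sup>-\<^sup>t\<^sup>L\<close>, applied at scale \<open>\<ell>(Q) \<approx> t\<^bsup>1/\<kappa>\<^esup>\<close>, dominate the pairing of the
  fractional integral with \<open>h\<close> by \<open>\<Sum> |Q|\<^bsup>1+\<alpha>/n\<^esup> \<langle>|f|\<rangle>\<^bsub>p\<^sub>0,Q\<^esub> \<langle>|h|\<rangle>\<^bsub>q\<^sub>0',Q\<^esub>\<close> over all cells of
  finitely many shifted triadic grids. Because \<open>\<alpha> > 0\<close> no sparse selection is required.

  In one grid the form is summed by parts: replacing the two averages by their running maxima \<open>A\<close>,
  \<open>B\<close> over the larger cells turns it into sums of jumps of \<open>A B\<close>, weighted by the coefficients
  summed below a cell. The latter sums are geometric once the cells are sorted by the size of
  \<open>\<langle>v\<rangle>\<^sub>Q\<^bsup>1/r\<^sub>1\<^esup> \<langle>u\<rangle>\<^sub>Q\<^bsup>1/r\<^sub>2\<^esup>\<close>. Jumps of \<open>B\<^bsup>q'\<^esup>\<close> sum to the integral of the maximal function, while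
  \<open>\<Sum> A\<^sup>q v(Q)\<^bsup>q/p\<^esup>\<close> over all cells costs only \<open>K\<^bsup>r\<^sub>1\<^esup>\<close>, since \<open>v\<close> loses a proportion \<open>c K\<^bsup>-r\<^sub>1\<^esup>\<close>
  in each generation. This produces \<open>K\<^bsup>1+r\<^sub>1/q\<^esup>\<close> and, symmetrically, \<open>K\<^bsup>1+r\<^sub>2/p'\<^esup>\<close>.
\<close>

section \<open>Laminar families of sets\<close>

text \<open>The norm of the fractional integral g is recovered from integrals of |g| h over bounded
  compactly supported h >= 0, so Hilbert space valued integrals are met only through continuous
  seminorms. They converge merely in local L^1: on a fixed cube the orbit of f is bounded for small
  s and O(s^(-\<gamma>)) for large s, with \<gamma> > \<alpha>/\<kappa> because p0 < p. Fatou's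
  lemma then carries a bound uniform in the truncation to the limit. The exponents satisfy 1/p +
  1/q' = 1 + \<eta> with \<alpha> = n \<eta>: the factor s^(\<alpha>/\<kappa>) at scale \<ell>(Q) is
  |Q|^\<eta>, and passing from Lebesgue averages to averages relative to v and u costs the
  two-weight product of Q, which is at most K. The power of K is the obstacle. Geometric decay below
  a cell R is obtained by inserting a small power -\<delta> of that product; undoing this costs a
  ratio of its values at cells inside R and at R, to the power \<delta>. Over all cells this could
  be K^\<delta>, but within a dyadic class \<nu>/2 < value <= \<nu> it is at most 2^\<delta>, and
  the class values \<nu> = K, K/2, K/4, ... add up to 2K.\<close>

lemma bernoulli_powr:
  fixes y s :: real
  assumes "0 \<le> y" "1 \<le> s"
  shows "1 - y powr s \<le> s * (1 - y)"
proof (cases "y = 0")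
  case False
  have "(y powr s) powr (1/s) * 1 powr (1 - 1/s) \<le> (1/s) * y powr s + (1 - 1/s) * 1"
    by (rule Youngs_inequality_0) (use assms False in auto)
  then have "y \<le> (1/s) * y powr s + (1 - 1/s)"
    using assms by (simp add: powr_powr)
  then have "s * y \<le> s * ((1/s) * y powr s + (1 - 1/s))"
    using assms by (intro mult_left_mono) auto
  also have "\<dots> = y powr s + s - 1" using assms by (simp add: algebra_simps)
  finally show ?thesis by (simp add: algebra_simps)
qed (use assms in auto)

lemma conjugate_gt_1:
  fixes p p' :: real
  assumes "1 < p" "1 / p + 1 / p' = 1"
  shows "1 < p'"
proof -
  have "0 < 1 / p" "1 / p < 1" using assms by auto
  then have *: "0 < 1 / p'" "1 / p' < 1" using assms(2) by linarith+
  then have "0 < p'" by simp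
  with * show ?thesis by simp
qed

lemma conjugate_less:
  fixes p p' q q' :: real
  assumes "1 < p" "p < q" "1 / p + 1 / p' = 1" "1 / q + 1 / q' = 1"
  shows "q' < p'"
proof -
  have pos: "1 < p'" "1 < q'" using conjugate_gt_1 assms by (blast, smt (verit) conjugate_gt_1 assms)
  have "1 / q < 1 / p" using assms by (intro divide_strict_left_mono) auto
  then have "1 / p' < 1 / q'" using assms by linarith
  then show ?thesis using pos by (simp add: field_simps)
qed

text \<open>Trades part of an increment of x^s for the value M^r. With t = m/M one has t^s =
  (t^(s-r))^(s/(s-r)), and Bernoulli's inequality supplies the constant s/(s-r).\<close>

lemma powr_diff_le:
  fixes m M r s :: real
  assumes "0 \<le> m" "m \<le> M" "0 \<le> r" "r < s"
  shows "M powr s - m powr s \<le> (s / (s - r)) * (M powr r * (M powr (s - r) - m powr (s - r)))"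
proof (cases "M = 0")
  case False
  then have M: "M > 0" using assms by auto
  define t where "t = m / M"
  have t: "0 \<le> t" "m = t * M" using assms M by (auto simp: t_def)
  have "1 - (t powr (s - r)) powr (s / (s - r)) \<le> (s / (s - r)) * (1 - t powr (s - r))"
    by (rule bernoulli_powr) (use assms in \<open>auto simp: divide_simps\<close>)
  then have *: "1 - t powr s \<le> (s / (s - r)) * (1 - t powr (s - r))"
    using assms by (simp add: powr_powr)
  have "M powr s - m powr s = M powr s * (1 - t powr s)"
    using t M by (simp add: powr_mult algebra_simps)
  also have "\<dots> \<le> M powr s * ((s / (s - r)) * (1 - t powr (s - r)))"
    using * by (intro mult_left_mono) auto
  also have "\<dots> = (s / (s - r)) * (M powr (r + (s - r)) * (1 - t powr (s - r)))"
    by simp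
  also have "\<dots> = (s / (s - r)) * (M powr r * (M powr (s - r) - m powr (s - r)))"
    unfolding powr_add using t M by (simp add: powr_mult algebra_simps)
  finally show ?thesis .
qed (use assms in auto)

text \<open>Superadditivity of x^s for s >= 1: both M - m and m lie below M, and x^s <= x M^(s-1)
  there.\<close>

lemma powr_diff_ge:
  fixes m M s :: real
  assumes "0 \<le> m" "m \<le> M" "1 \<le> s"
  shows "(M - m) powr s \<le> M powr s - m powr s"
proof (cases "M = 0")
  case False
  then have M: "M > 0" using assms by auto
  have le: "x powr s \<le> x * M powr (s - 1)" if "0 \<le> x" "x \<le> M" for x
  proof (cases "x = 0")
    case False
    have "x powr s = x powr (1 + (s - 1))" by simp
    also have "\<dots> = x * x powr (s - 1)" unfolding powr_add using False that by simp
    also have "\<dots> \<le> x * M powr (s - 1)"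
      using that assms by (intro mult_left_mono powr_mono2) auto
    finally show ?thesis .
  qed auto
  have "(M - m) powr s + m powr s \<le> (M - m) * M powr (s - 1) + m * M powr (s - 1)"
    using assms by (intro add_mono le) auto
  also have "\<dots> = M powr s" using M by (simp add: powr_diff field_simps)
  finally show ?thesis by simp
qed (use assms in auto)

text \<open>Telescoping along a chain: the summand is the jump of \<open>H\<close> when \<open>R\<close> is added to the members
  above it.\<close>
lemma chain_telescope:
  fixes H :: "'a set set \<Rightarrow> real"
  assumes "finite U" "\<And>P R. P \<in> U \<Longrightarrow> R \<in> U \<Longrightarrow> P \<subseteq> R \<or> R \<subseteq> P"
  shows "(\<Sum>R\<in>U. H {P\<in>U. R \<subseteq> P} - H {P\<in>U. R \<subset> P}) = H U - H {}"
  using assms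
proof (induction U rule: finite_psubset_induct)
  case (psubset U)
  show ?case
  proof (cases "U = {}")
    case False
    from finite_has_minimal[OF psubset.hyps(1) this] obtain Q
      where "Q \<in> U" "\<forall>P\<in>U. P \<subseteq> Q \<longrightarrow> Q = P" by (elim bexE)
    then have Q: "Q \<in> U" "\<And>P. P \<in> U \<Longrightarrow> P \<subseteq> Q \<Longrightarrow> P = Q" by auto
    have min: "Q \<subseteq> P" if "P \<in> U" for P using psubset.prems[OF that Q(1)] Q(2)[OF that] by auto
    let ?V = "U - {Q}"
    have IH: "(\<Sum>R\<in>?V. H {P\<in>?V. R \<subseteq> P} - H {P\<in>?V. R \<subset> P}) = H ?V - H {}"
      using Q(1) psubset.prems by (intro psubset.IH) auto
    \<comment> \<open>A minimal member of a chain is its least one. No other member lies inside Q,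
      so dropping Q leaves all their ancestor sets unchanged and only the summand of Q is
      new.\<close>
    have eq: "{P\<in>U. R \<subseteq> P} = {P\<in>?V. R \<subseteq> P}" "{P\<in>U. R \<subset> P} = {P\<in>?V. R \<subset> P}" if "R \<in> ?V" for R
    proof -
      have "\<not> R \<subseteq> Q" using that Q(2)[of R] by blast
      then show "{P\<in>U. R \<subseteq> P} = {P\<in>?V. R \<subseteq> P}" "{P\<in>U. R \<subset> P} = {P\<in>?V. R \<subset> P}" by blast+
    qed
    have "{P\<in>U. Q \<subseteq> P} = U" "{P\<in>U. Q \<subset> P} = ?V" using min by blast+
    then have "(\<Sum>R\<in>U. H {P\<in>U. R \<subseteq> P} - H {P\<in>U. R \<subset> P})
      = (H U - H ?V) + (\<Sum>R\<in>?V. H {P\<in>U. R \<subseteq> P} - H {P\<in>U. R \<subset> P})"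
      by (simp only: sum.remove[OF psubset.hyps(1) Q(1)])
    also have "(\<Sum>R\<in>?V. H {P\<in>U. R \<subseteq> P} - H {P\<in>U. R \<subset> P}) = H ?V - H {}"
      unfolding IH[symmetric] by (rule sum.cong[OF refl]) (simp only: eq)
    finally show ?thesis by simp
  qed auto
qed

section \<open>Jumps and running maxima along chains of ancestors\<close>

definition laminar :: "'a set set \<Rightarrow> bool" where
  "laminar \<Q> \<longleftrightarrow> finite \<Q> \<and> (\<forall>P\<in>\<Q>. \<forall>R\<in>\<Q>. P \<subseteq> R \<or> R \<subseteq> P \<or> P \<inter> R = {})"

text \<open>Plays the role of a martingale increment: \<open>H\<close> is a process observed along
  the chain of ancestors, and R is the newest member of that chain.\<close>

definition jump :: "'a set set \<Rightarrow> ('a set set \<Rightarrow> real) \<Rightarrow> 'a set \<Rightarrow> real" where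
  "jump \<Q> H R = H {P\<in>\<Q>. R \<subseteq> P} - H {P\<in>\<Q>. R \<subset> P}"

text \<open>The inserted 0 gives the empty chain the value 0, so that telescoping sums of jumps have
  no boundary term.\<close>

definition Max0 :: "('a set \<Rightarrow> real) \<Rightarrow> 'a set set \<Rightarrow> real" where
  "Max0 A C = Max (insert 0 (A ` C))"

text \<open>Members of \<open>U\<close> meet pairwise, so laminarity makes \<open>U\<close> a chain.
  As \<open>U\<close> is closed upwards, ancestors in \<Q> and in \<open>U\<close> coincide and
  \<open>chain_telescope\<close> applies.\<close>

lemma sum_jump:
  assumes "laminar \<Q>" "\<And>P R. P \<in> U \<Longrightarrow> R \<in> U \<Longrightarrow> P \<inter> R \<noteq> {}" "U \<subseteq> \<Q>"
    and up: "\<And>P R. P \<in> U \<Longrightarrow> R \<in> \<Q> \<Longrightarrow> P \<subseteq> R \<Longrightarrow> R \<in> U"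
  shows "(\<Sum>R\<in>U. jump \<Q> H R) = H U - H {}"
proof -
  have fin: "finite U" using assms(1,3) finite_subset by (auto simp: laminar_def)
  have "{P\<in>\<Q>. R \<subseteq> P} = {P\<in>U. R \<subseteq> P}" "{P\<in>\<Q>. R \<subset> P} = {P\<in>U. R \<subset> P}" if "R \<in> U" for R
    using that up assms(3) by auto
  then have "(\<Sum>R\<in>U. jump \<Q> H R) = (\<Sum>R\<in>U. H {P\<in>U. R \<subseteq> P} - H {P\<in>U. R \<subset> P})"
    by (intro sum.cong) (auto simp: jump_def)
  also have "\<dots> = H U - H {}"
  proof (rule chain_telescope[OF fin])
    fix P R assume "P \<in> U" "R \<in> U"
    then show "P \<subseteq> R \<or> R \<subseteq> P"
      using assms(1) assms(2)[of P R] assms(3) unfolding laminar_def by blast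
  qed
  finally show ?thesis .
qed

lemma sum_jump_point:
  assumes "laminar \<Q>"
  shows "(\<Sum>R\<in>{R\<in>\<Q>. x \<in> R}. jump \<Q> H R) = H {R\<in>\<Q>. x \<in> R} - H {}"
  by (rule sum_jump[OF assms]) auto

lemma sum_jump_above:
  assumes "laminar \<Q>" "Q \<noteq> {}"
  shows "(\<Sum>R\<in>{R\<in>\<Q>. Q \<subseteq> R}. jump \<Q> H R) = H {R\<in>\<Q>. Q \<subseteq> R} - H {}"
  by (rule sum_jump[OF assms(1)]) (use assms(2) in auto)

lemma Max0_nonneg: "finite C \<Longrightarrow> 0 \<le> Max0 A C"
  by (simp add: Max0_def)

lemma Max0_empty [simp]: "Max0 A {} = 0"
  by (simp add: Max0_def)

lemma Max0_mono: "finite C \<Longrightarrow> D \<subseteq> C \<Longrightarrow> Max0 A D \<le> Max0 A C"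
  unfolding Max0_def by (intro Max_mono) auto

lemma Max0_ge: "finite C \<Longrightarrow> P \<in> C \<Longrightarrow> A P \<le> Max0 A C"
  unfolding Max0_def by (intro Max_ge) auto

lemma Max0_insert: "finite C \<Longrightarrow> Max0 A (insert P C) = max (A P) (Max0 A C)"
  unfolding Max0_def image_insert by (subst insert_commute) simp

lemma above_eq_insert: "R \<in> \<Q> \<Longrightarrow> {P\<in>\<Q>. R \<subseteq> P} = insert R {P\<in>\<Q>. R \<subset> P}"
  by auto

context
  fixes \<Q> :: "'a set set" and A :: "'a set \<Rightarrow> real"
  assumes lam: "laminar \<Q>"
begin

lemma finite_laminar: "finite \<Q>"
  using lam by (simp add: laminar_def)

lemma Max0_above_nonneg [simp]: "0 \<le> Max0 A {P\<in>\<Q>. f P}"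
  by (rule Max0_nonneg) (use finite_laminar in auto)

lemma Max0_strictly_above_le: "Max0 A {P\<in>\<Q>. R \<subset> P} \<le> Max0 A {P\<in>\<Q>. R \<subseteq> P}"
  by (rule Max0_mono) (use finite_laminar in auto)

lemma jump_Max0_powr_nonneg: "0 \<le> s \<Longrightarrow> 0 \<le> jump \<Q> (\<lambda>C. Max0 A C powr s) R"
  unfolding jump_def using Max0_strictly_above_le[of R] by (simp add: powr_mono2)

lemma jump_Max0_nonneg: "0 \<le> jump \<Q> (Max0 A) R"
  unfolding jump_def using Max0_strictly_above_le[of R] by simp

lemma jump_Max0_powr_le:
  assumes "0 \<le> r" "r < s"
  shows "jump \<Q> (\<lambda>C. Max0 A C powr s) R
    \<le> s / (s - r) * (Max0 A {P\<in>\<Q>. R \<subseteq> P} powr r * jump \<Q> (\<lambda>C. Max0 A C powr (s - r)) R)"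
  unfolding jump_def by (intro powr_diff_le Max0_strictly_above_le assms) auto

text \<open>A jump occurs only where the running maximum is attained.\<close>
lemma jump_Max0_powr_le':
  assumes "0 \<le> r" "r < s" "R \<in> \<Q>"
  shows "jump \<Q> (\<lambda>C. Max0 A C powr s) R
    \<le> s / (s - r) * (A R powr r * jump \<Q> (\<lambda>C. Max0 A C powr (s - r)) R)"
proof (cases "A R \<le> Max0 A {P\<in>\<Q>. R \<subset> P}")
  case True
  then have "Max0 A {P\<in>\<Q>. R \<subseteq> P} = Max0 A {P\<in>\<Q>. R \<subset> P}"
    using finite_laminar by (simp add: above_eq_insert[OF assms(3)] Max0_insert max_def)
  then show ?thesis by (simp add: jump_def)
next
  case False
  then have "Max0 A {P\<in>\<Q>. R \<subseteq> P} = A R"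
    using finite_laminar by (simp add: above_eq_insert[OF assms(3)] Max0_insert max_def)
  then show ?thesis using jump_Max0_powr_le[OF assms(1,2), of R] by simp
qed

lemma jump_powr_le_jump_Max0_powr:
  assumes "1 \<le> s"
  shows "jump \<Q> (Max0 A) R powr s \<le> jump \<Q> (\<lambda>C. Max0 A C powr s) R"
  unfolding jump_def by (intro powr_diff_ge Max0_strictly_above_le assms) auto

text \<open>A Chebyshev bound: the power of the maximum at Q is the sum of the jumps above Q, and v
  only grows upwards. It limits what a single cell contributes to the total.\<close>

lemma Max0_powr_measure_le:
  fixes v :: "'a set \<Rightarrow> real"
  assumes "\<And>P R. P \<in> \<Q> \<Longrightarrow> R \<in> \<Q> \<Longrightarrow> R \<subseteq> P \<Longrightarrow> v R \<le> v P" "\<And>R. R \<in> \<Q> \<Longrightarrow> 0 \<le> v R"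
    "Q \<in> \<Q>" "Q \<noteq> {}" "0 < s"
  shows "Max0 A {P\<in>\<Q>. Q \<subseteq> P} powr s * v Q \<le> (\<Sum>R\<in>\<Q>. jump \<Q> (\<lambda>C. Max0 A C powr s) R * v R)"
proof -
  let ?J = "jump \<Q> (\<lambda>C. Max0 A C powr s)"
  have "Max0 A {P\<in>\<Q>. Q \<subseteq> P} powr s * v Q = (\<Sum>R\<in>{R\<in>\<Q>. Q \<subseteq> R}. ?J R) * v Q"
    using sum_jump_above[OF lam assms(4)] assms(5) by simp
  also have "\<dots> = (\<Sum>R\<in>{R\<in>\<Q>. Q \<subseteq> R}. ?J R * v Q)" by (simp add: sum_distrib_right)
  also have "\<dots> \<le> (\<Sum>R\<in>{R\<in>\<Q>. Q \<subseteq> R}. ?J R * v R)"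
    using assms by (intro sum_mono mult_left_mono jump_Max0_powr_nonneg) auto
  also have "\<dots> \<le> (\<Sum>R\<in>\<Q>. ?J R * v R)"
    using assms finite_laminar by (intro sum_mono2 mult_nonneg_nonneg jump_Max0_powr_nonneg) auto
  finally show ?thesis .
qed

text \<open>A Carleson embedding, proved by summing the packing condition over the jumps.\<close>
lemma sum_Max0_powr_le:
  fixes v :: "'a set \<Rightarrow> real"
  assumes v: "\<And>P R. P \<in> \<Q> \<Longrightarrow> R \<in> \<Q> \<Longrightarrow> R \<subseteq> P \<Longrightarrow> v R \<le> v P" "\<And>R. R \<in> \<Q> \<Longrightarrow> 0 < v R"
    and "{} \<notin> \<Q>" "0 < p" "p < q"
    and D: "\<And>P. P \<in> \<Q> \<Longrightarrow> (\<Sum>R\<in>{R\<in>\<Q>. R \<subseteq> P}. v R powr (q / p)) \<le> D * v P powr (q / p)"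
    and N: "N = (\<Sum>R\<in>\<Q>. jump \<Q> (\<lambda>C. Max0 A C powr p) R * v R)" and "0 \<le> D"
  shows "(\<Sum>R\<in>\<Q>. Max0 A {P\<in>\<Q>. R \<subseteq> P} powr q * v R powr (q / p)) \<le> D * (q / p) * N powr (q / p)"
proof -
  have v0: "0 \<le> v R" if "R \<in> \<Q>" for R using v(2)[OF that] by simp
  have N0: "0 \<le> N" unfolding N
    using v0 assms by (intro sum_nonneg mult_nonneg_nonneg jump_Max0_powr_nonneg) auto
  let ?J = "jump \<Q> (\<lambda>C. Max0 A C powr q)"
  have "(\<Sum>R\<in>\<Q>. Max0 A {P\<in>\<Q>. R \<subseteq> P} powr q * v R powr (q / p))
      = (\<Sum>R\<in>\<Q>. \<Sum>P\<in>{P\<in>\<Q>. R \<subseteq> P}. ?J P * v R powr (q / p))"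
  proof (rule sum.cong[OF refl])
    fix R assume "R \<in> \<Q>"
    then have "R \<noteq> {}" using assms by auto
    from sum_jump_above[OF lam this, of "\<lambda>C. Max0 A C powr q"] \<open>0 < p\<close> \<open>p < q\<close>
    show "Max0 A {P\<in>\<Q>. R \<subseteq> P} powr q * v R powr (q / p)
        = (\<Sum>P\<in>{P\<in>\<Q>. R \<subseteq> P}. ?J P * v R powr (q / p))"
      by (simp flip: sum_distrib_right)
  qed
  also have "\<dots> = (\<Sum>P\<in>\<Q>. \<Sum>R\<in>{R\<in>\<Q>. R \<subseteq> P}. ?J P * v R powr (q / p))"
    by (rule sum.swap_restrict) (use finite_laminar in auto)
  also have "\<dots> = (\<Sum>P\<in>\<Q>. ?J P * (\<Sum>R\<in>{R\<in>\<Q>. R \<subseteq> P}. v R powr (q / p)))"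
    by (simp add: sum_distrib_left)
  also have "\<dots> \<le> (\<Sum>P\<in>\<Q>. ?J P * (D * v P powr (q / p)))"
    using assms by (intro sum_mono mult_left_mono D jump_Max0_powr_nonneg) auto
  also have "\<dots> \<le> (\<Sum>P\<in>\<Q>. D * (q / p) * N powr (q / p - 1)
      * (jump \<Q> (\<lambda>C. Max0 A C powr p) P * v P))"
  proof (rule sum_mono)
    fix P assume P: "P \<in> \<Q>"
    let ?M = "Max0 A {R\<in>\<Q>. P \<subseteq> R}" and ?Jp = "jump \<Q> (\<lambda>C. Max0 A C powr p) P"
    have Jp: "0 \<le> ?Jp" using assms by (intro jump_Max0_powr_nonneg) auto
    have "P \<noteq> {}" using assms P by auto
    \<comment> \<open>The single-cell bound is raised to the power q/p - 1 and absorbs everything in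
      excess of the p-th power; what is left sums to one further factor N.\<close>
    then have "?M powr p * v P \<le> N" unfolding N
      using P v0 assms by (intro Max0_powr_measure_le) auto
    then have "(?M powr p * v P) powr (q / p - 1) \<le> N powr (q / p - 1)"
      using assms v0[OF P] by (intro powr_mono2) auto
    then have *: "?M powr (q - p) * v P powr (q / p - 1) \<le> N powr (q / p - 1)"
      using assms(4,5) v0[OF P] Max0_above_nonneg
      by (simp add: powr_mult powr_powr right_diff_distrib)
    have vP: "v P powr (q / p) = v P * v P powr (q / p - 1)"
      using v(2)[OF P] by (simp add: powr_diff)
    have "?J P \<le> q / p * (?M powr (q - p) * ?Jp)"
      using jump_Max0_powr_le[of "q - p" q P] assms by simp
    then have "?J P * (D * v P powr (q / p)) \<le> q / p * (?M powr (q - p) * ?Jp) * (D * v P powr (q / p))"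
      using assms by (intro mult_right_mono) auto
    also have "\<dots> = D * (q / p) * (?Jp * v P) * (?M powr (q - p) * v P powr (q / p - 1))"
      by (simp add: vP)
    also have "\<dots> \<le> D * (q / p) * (?Jp * v P) * N powr (q / p - 1)"
      using assms Jp v0[OF P] by (intro mult_left_mono * mult_nonneg_nonneg) auto
    finally show "?J P * (D * v P powr (q / p)) \<le> D * (q / p) * N powr (q / p - 1) * (?Jp * v P)"
      by (simp add: mult_ac)
  qed
  also have "\<dots> = D * (q / p) * N powr (q / p - 1) * N"
    unfolding N by (rule sum_distrib_left[symmetric])
  also have "\<dots> = D * (q / p) * (N powr (q / p - 1) * N)" by simp
  also have "N powr (q / p - 1) * N = N powr (q / p)"
    using N0 by (cases "N = 0") (auto simp: powr_diff)
  finally show ?thesis by simp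
qed

end

section \<open>Hoelder's inequality and Doob's maximal estimate\<close>

text \<open>Young's inequality after both integrals are normalised to one. If one of them vanishes,
  the product vanishes almost everywhere and there is nothing to normalise.\<close>

lemma holder_powr:
  fixes f g :: "'a \<Rightarrow> real"
  assumes f: "integrable M f" "\<And>x. 0 \<le> f x" and g: "integrable M g" "\<And>x. 0 \<le> g x"
    and \<theta>: "0 < \<theta>" "\<theta> < 1"
  shows "integrable M (\<lambda>x. f x powr \<theta> * g x powr (1 - \<theta>))" (is "integrable M ?h")
    and "(\<integral>x. f x powr \<theta> * g x powr (1 - \<theta>) \<partial>M) \<le> (\<integral>x. f x \<partial>M) powr \<theta> * (\<integral>x. g x \<partial>M) powr (1 - \<theta>)"
proof -
  have young: "a powr \<theta> * b powr (1 - \<theta>) \<le> \<theta> * a + (1 - \<theta>) * b" if "0 \<le> a" "0 \<le> b" for a b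
    using that \<theta> Youngs_inequality_0[of \<theta> "1 - \<theta>" a b] by (cases "a = 0 \<or> b = 0") auto
  have meas: "f \<in> borel_measurable M" "g \<in> borel_measurable M" using f g by auto
  show int: "integrable M ?h"
  proof (rule Bochner_Integration.integrable_bound)
    show "integrable M (\<lambda>x. \<theta> * f x + (1 - \<theta>) * g x)" using f g by auto
    show "AE x in M. norm (?h x) \<le> norm (\<theta> * f x + (1 - \<theta>) * g x)"
      using young[OF f(2) g(2)] by (intro AE_I2) (auto intro: order_trans[OF _ abs_ge_self])
  qed (use meas in measurable)
  let ?X = "\<integral>x. f x \<partial>M" and ?Y = "\<integral>x. g x \<partial>M"
  have X0: "0 \<le> ?X" "0 \<le> ?Y" using f g by auto
  show "(\<integral>x. ?h x \<partial>M) \<le> ?X powr \<theta> * ?Y powr (1 - \<theta>)"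
  proof (cases "?X = 0 \<or> ?Y = 0")
    case True
    then have "AE x in M. ?h x = 0"
    proof
      assume "?X = 0"
      then have "AE x in M. f x = 0" using f by (subst (asm) integral_nonneg_eq_0_iff_AE) auto
      then show ?thesis by eventually_elim simp
    next
      assume "?Y = 0"
      then have "AE x in M. g x = 0" using g by (subst (asm) integral_nonneg_eq_0_iff_AE) auto
      then show ?thesis by eventually_elim simp
    qed
    then have "(\<integral>x. ?h x \<partial>M) = 0" by (rule integral_eq_zero_AE)
    then show ?thesis by simp
  next
    case False
    then have XY: "0 < ?X" "0 < ?Y" using X0 by linarith+
    have "(\<integral>x. ?h x / (?X powr \<theta> * ?Y powr (1 - \<theta>)) \<partial>M)
      \<le> (\<integral>x. \<theta> * f x / ?X + (1 - \<theta>) * g x / ?Y \<partial>M)"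
    proof (rule integral_mono)
      show "?h x / (?X powr \<theta> * ?Y powr (1 - \<theta>)) \<le> \<theta> * f x / ?X + (1 - \<theta>) * g x / ?Y" for x
        using young[of "f x / ?X" "g x / ?Y"] f(2)[of x] g(2)[of x] X0 by (simp add: powr_divide)
    qed (use int f g in auto)
    also have "\<dots> = 1" using f g XY by simp
    finally show ?thesis using XY by (simp add: field_simps)
  qed
qed

lemma holder_sum:
  fixes a b :: "'a \<Rightarrow> real"
  assumes "finite I" "\<And>i. i \<in> I \<Longrightarrow> 0 \<le> a i" "\<And>i. i \<in> I \<Longrightarrow> 0 \<le> b i" "1 < q" "1 / q + 1 / q' = 1"
  shows "(\<Sum>i\<in>I. a i * b i) \<le> (\<Sum>i\<in>I. a i powr q) powr (1 / q) * (\<Sum>i\<in>I. b i powr q') powr (1 / q')"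
proof -
  have q': "1 - 1 / q = 1 / q'" "q' \<noteq> 0" using assms by auto
  have "(\<Sum>i\<in>I. a i * b i) = (\<Sum>i\<in>I. (a i powr q) powr (1 / q) * (b i powr q') powr (1 - 1 / q))"
    unfolding q' using assms q' by (intro sum.cong) (auto simp: powr_powr)
  also have "\<dots> = (\<integral>i. (a i powr q) powr (1 / q) * (b i powr q') powr (1 - 1 / q) \<partial>count_space I)"
    using assms by (simp add: lebesgue_integral_count_space_finite)
  also have "\<dots> \<le> (\<integral>i. a i powr q \<partial>count_space I) powr (1 / q)
      * (\<integral>i. b i powr q' \<partial>count_space I) powr (1 - 1 / q)"
    using assms by (intro holder_powr integrable_count_space) auto
  also have "\<dots> = (\<Sum>i\<in>I. a i powr q) powr (1 / q) * (\<Sum>i\<in>I. b i powr q') powr (1 / q')"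
    unfolding q' using assms by (simp add: lebesgue_integral_count_space_finite)
  finally show ?thesis .
qed

text \<open>The left-hand side is \<open>\<integral> (sup A)\<^sup>p v\<close>, written as a sum of jumps as in Doob's proof of his
  maximal inequality.\<close>
lemma doob_laminar:
  fixes F v w :: "'a \<Rightarrow> real"
  assumes lam: "laminar \<Q>" and sets: "\<And>R. R \<in> \<Q> \<Longrightarrow> R \<in> sets M"
    and F: "integrable M F" "\<And>x. 0 \<le> F x"
    and v: "\<And>R. R \<in> \<Q> \<Longrightarrow> set_integrable M R v" "\<And>x. 0 \<le> v x"
    and w: "integrable M w" "\<And>x. 0 \<le> w x"
    and r: "0 < r" "r < p"
    and F_eq: "AE x in M. F x = w x powr (r / p) * v x powr (1 - r / p)"
    and V: "\<And>R. R \<in> \<Q> \<Longrightarrow> V R = (LINT x:R|M. v x)"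
    and A: "\<And>R. R \<in> \<Q> \<Longrightarrow> A R powr r * V R = (LINT x:R|M. F x)"
  shows "(\<Sum>R\<in>\<Q>. jump \<Q> (\<lambda>C. Max0 A C powr p) R * V R) \<le> (p / (p - r)) powr (p / r) * (\<integral>x. w x \<partial>M)"
proof -
  note fin = finite_laminar[OF lam]
  let ?J = "\<lambda>s. jump \<Q> (\<lambda>C. Max0 A C powr s)"
  \<comment> \<open>The maximal function. By telescoping at a point, its powers are combinations of
    indicators, so integrals of G^s become sums of jumps, and N is the integral of G^p against
    v.\<close>
  define G where "G x = Max0 A {R\<in>\<Q>. x \<in> R}" for x
  define N where "N = (\<Sum>R\<in>\<Q>. ?J p R * V R)"
  define W where "W = (\<integral>x. w x \<partial>M)"
  \<comment> \<open>The exponent in F = w^\<theta> v^(1-\<theta>). As p (1 - \<theta>) = p - r,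
    Hoelder returns N itself to the power 1 - \<theta>.\<close>
  define \<theta> where "\<theta> = r / p"
  define c where "c = p / (p - r)"
  have \<theta>: "0 < \<theta>" "\<theta> < 1" "p * (1 - \<theta>) = p - r" and c: "0 < c"
    using r by (auto simp: \<theta>_def c_def field_simps)
  have Jnn: "0 \<le> ?J s R" if "0 \<le> s" for s R by (rule jump_Max0_powr_nonneg[OF lam that])
  have G0: "0 \<le> G x" for x unfolding G_def by (rule Max0_nonneg) (use fin in auto)
  have Gs: "G x powr s = (\<Sum>R\<in>\<Q>. ?J s R * indicator R x)" if "0 < s" for s x
  proof -
    have "G x powr s = (\<Sum>R\<in>{R\<in>\<Q>. x \<in> R}. ?J s R)"
      using sum_jump_point[OF lam, of "\<lambda>C. Max0 A C powr s" x] that by (simp add: G_def)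
    also have "\<dots> = (\<Sum>R\<in>\<Q>. ?J s R * indicator R x)"
      using fin by (intro sum.mono_neutral_cong_left) auto
    finally show ?thesis .
  qed
  have int_v: "integrable M (\<lambda>x. indicator R x * v x)" if "R \<in> \<Q>" for R
    using v(1)[OF that] by (simp add: set_integrable_def)
  have int_F: "integrable M (\<lambda>x. indicator R x * F x)" if "R \<in> \<Q>" for R
    using integrable_mult_indicator[OF sets[OF that] F(1)] by simp
  have vG: "v x * G x powr p = (\<Sum>R\<in>\<Q>. ?J p R * (indicator R x * v x))" for x
    using r by (subst Gs) (auto simp: sum_distrib_left mult_ac)
  have FG: "F x * G x powr (p - r) = (\<Sum>R\<in>\<Q>. ?J (p - r) R * (indicator R x * F x))" for x
    using r by (subst Gs) (auto simp: sum_distrib_left mult_ac)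
  have int_vG: "integrable M (\<lambda>x. v x * G x powr p)"
    unfolding vG using int_v by auto
  have "(\<integral>x. v x * G x powr p \<partial>M) = (\<Sum>R\<in>\<Q>. ?J p R * (\<integral>x. indicator R x * v x \<partial>M))"
    unfolding vG using int_v by (subst Bochner_Integration.integral_sum) auto
  also have "\<dots> = N"
    unfolding N_def by (intro sum.cong refl) (simp add: V set_lebesgue_integral_def)
  finally have N: "(\<integral>x. v x * G x powr p \<partial>M) = N" .
  have N0: "0 \<le> N" unfolding N[symmetric] using v by simp
  have W0: "0 \<le> W" unfolding W_def using w by simp
  \<comment> \<open>Each jump carries a factor \<open>A R powr r\<close>, since the maximum is
    attained at R wherever it jumps. Multiplied by \<open>V R\<close> this factor is the integral of
    F over R, which removes v from the sum.\<close>
  have "N \<le> (\<Sum>R\<in>\<Q>. c * (A R powr r * ?J (p - r) R) * V R)"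
  proof -
    have "0 \<le> V R" if "R \<in> \<Q>" for R
      using v by (simp add: V[OF that] set_lebesgue_integral_def)
    then show ?thesis
      unfolding N_def c_def using r by (intro sum_mono mult_right_mono jump_Max0_powr_le'[OF lam]) auto
  qed
  also have "\<dots> = (\<Sum>R\<in>\<Q>. c * (?J (p - r) R * (A R powr r * V R)))" by (simp add: mult_ac)
  also have "\<dots> = c * (\<Sum>R\<in>\<Q>. ?J (p - r) R * (\<integral>x. indicator R x * F x \<partial>M))"
    by (simp add: A set_lebesgue_integral_def sum_distrib_left)
  also have "(\<Sum>R\<in>\<Q>. ?J (p - r) R * (\<integral>x. indicator R x * F x \<partial>M)) = (\<integral>x. F x * G x powr (p - r) \<partial>M)"
    unfolding FG using int_F by (subst Bochner_Integration.integral_sum) auto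
  also have "\<dots> = (\<integral>x. w x powr \<theta> * (v x * G x powr p) powr (1 - \<theta>) \<partial>M)"
  proof (rule integral_cong_AE)
    have *: "w x powr \<theta> * (v x * G x powr p) powr (1 - \<theta>)
        = (w x powr \<theta> * v x powr (1 - \<theta>)) * G x powr (p - r)" for x
      using v G0 \<theta> by (simp add: powr_mult powr_powr mult_ac)
    show "AE x in M. F x * G x powr (p - r) = w x powr \<theta> * (v x * G x powr p) powr (1 - \<theta>)"
      using F_eq unfolding * \<theta>_def[symmetric] by eventually_elim simp
    show "(\<lambda>x. F x * G x powr (p - r)) \<in> borel_measurable M"
      unfolding FG using int_F by (auto intro!: borel_measurable_sum borel_measurable_times dest:
          borel_measurable_integrable)
    show "(\<lambda>x. w x powr \<theta> * (v x * G x powr p) powr (1 - \<theta>)) \<in> borel_measurable M"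
      using borel_measurable_integrable[OF int_vG] borel_measurable_integrable[OF w(1)] by measurable
  qed
  also have "\<dots> \<le> W powr \<theta> * N powr (1 - \<theta>)"
    unfolding W_def N[symmetric] by (rule holder_powr) (use w v int_vG \<theta> in auto)
  finally have *: "N \<le> c * (W powr \<theta> * N powr (1 - \<theta>))" using c by simp
  \<comment> \<open>N occurs on both sides. It is a finite sum, so its power 1 - \<theta> may be
    divided out.\<close>
  have "N \<le> c powr (1 / \<theta>) * W"
  proof (cases "N = 0")
    case False
    then have "N powr \<theta> = N / N powr (1 - \<theta>)" using N0 by (simp add: powr_diff)
    also have "\<dots> \<le> c * W powr \<theta>" using * False N0 by (simp add: field_simps)
    finally have "(N powr \<theta>) powr (1 / \<theta>) \<le> (c * W powr \<theta>) powr (1 / \<theta>)"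
      using \<theta> by (intro powr_mono2) auto
    then show ?thesis using N0 W0 c \<theta> by (simp add: powr_powr powr_mult)
  qed (use W0 in auto)
  then show ?thesis by (simp add: N_def W_def \<theta>_def c_def)
qed

section \<open>The bilinear form on a laminar family\<close>

text \<open>Hoelder's inequality with exponents q and q' separates the two factors. The maxima of A
  form a Carleson sum and cost D^(1/q); the jumps of B cost nothing, since the q'-th power of a jump
  is at most the jump of the q'-th power.\<close>

lemma sum_Max0_jump_le:
  fixes v u A B :: "'a set \<Rightarrow> real"
  assumes lam: "laminar \<Q>" and ne: "{} \<notin> \<Q>"
    and v: "\<And>P R. P \<in> \<Q> \<Longrightarrow> R \<in> \<Q> \<Longrightarrow> R \<subseteq> P \<Longrightarrow> v R \<le> v P" "\<And>R. R \<in> \<Q> \<Longrightarrow> 0 < v R"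
    and u: "\<And>R. R \<in> \<Q> \<Longrightarrow> 0 < u R"
    and pq: "0 < p" "p < q" "1 < q" "1 / q + 1 / q' = 1"
    and D: "\<And>P. P \<in> \<Q> \<Longrightarrow> (\<Sum>R\<in>{R\<in>\<Q>. R \<subseteq> P}. v R powr (q / p)) \<le> D * v P powr (q / p)" "0 \<le> D"
    and NA: "(\<Sum>R\<in>\<Q>. jump \<Q> (\<lambda>C. Max0 A C powr p) R * v R) \<le> NA"
    and NB: "(\<Sum>R\<in>\<Q>. jump \<Q> (\<lambda>C. Max0 B C powr q') R * u R) \<le> NB"
  shows "(\<Sum>R\<in>\<Q>. Max0 A {P\<in>\<Q>. R \<subseteq> P} * jump \<Q> (Max0 B) R * (v R powr (1 / p) * u R powr (1 / q')))
      \<le> (D * (q / p)) powr (1 / q) * NA powr (1 / p) * NB powr (1 / q')"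
proof -
  note fin = finite_laminar[OF lam]
  have q': "1 < q'" using conjugate_gt_1 pq by blast
  define N where "N = (\<Sum>R\<in>\<Q>. jump \<Q> (\<lambda>C. Max0 A C powr p) R * v R)"
  have v0: "0 \<le> v R" "0 \<le> u R" if "R \<in> \<Q>" for R using v(2)[OF that] u[OF that] by auto
  have N0: "0 \<le> N" unfolding N_def
    using v0 pq by (intro sum_nonneg mult_nonneg_nonneg jump_Max0_powr_nonneg[OF lam]) auto
  have Max00: "0 \<le> Max0 A {P\<in>\<Q>. R \<subseteq> P}" for R by (rule Max0_nonneg) (use fin in auto)
  have j0: "0 \<le> jump \<Q> (Max0 B) R" for R by (rule jump_Max0_nonneg[OF lam])
  have "(\<Sum>R\<in>\<Q>. Max0 A {P\<in>\<Q>. R \<subseteq> P} * jump \<Q> (Max0 B) R * (v R powr (1 / p) * u R powr (1 / q')))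
    = (\<Sum>R\<in>\<Q>. (Max0 A {P\<in>\<Q>. R \<subseteq> P} * v R powr (1 / p)) * (jump \<Q> (Max0 B) R * u R powr (1 / q')))"
    by (simp add: mult_ac)
  also have "\<dots> \<le> (\<Sum>R\<in>\<Q>. (Max0 A {P\<in>\<Q>. R \<subseteq> P} * v R powr (1 / p)) powr q) powr (1 / q)
      * (\<Sum>R\<in>\<Q>. (jump \<Q> (Max0 B) R * u R powr (1 / q')) powr q') powr (1 / q')"
    using pq fin Max00 j0 by (intro holder_sum) auto
  also have "\<dots> \<le> (D * (q / p) * NA powr (q / p)) powr (1 / q) * NB powr (1 / q')"
  proof (intro mult_mono powr_mono2)
    have "(\<Sum>R\<in>\<Q>. (Max0 A {P\<in>\<Q>. R \<subseteq> P} * v R powr (1 / p)) powr q)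
      = (\<Sum>R\<in>\<Q>. Max0 A {P\<in>\<Q>. R \<subseteq> P} powr q * v R powr (q / p))"
      using Max00 v0 by (intro sum.cong) (auto simp: powr_mult powr_powr)
    also have "\<dots> \<le> D * (q / p) * N powr (q / p)"
      by (rule sum_Max0_powr_le[OF lam v]) (use ne pq D N_def in auto)
    also have "\<dots> \<le> D * (q / p) * NA powr (q / p)"
      using pq D NA N0 by (intro mult_left_mono powr_mono2) (auto simp: N_def)
    finally show "(\<Sum>R\<in>\<Q>. (Max0 A {P\<in>\<Q>. R \<subseteq> P} * v R powr (1 / p)) powr q) \<le> D * (q / p) * NA powr (q / p)" .
    have "(\<Sum>R\<in>\<Q>. (jump \<Q> (Max0 B) R * u R powr (1 / q')) powr q')
      = (\<Sum>R\<in>\<Q>. jump \<Q> (Max0 B) R powr q' * u R)"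
      using j0 v0 q' by (intro sum.cong) (auto simp: powr_mult powr_powr)
    also have "\<dots> \<le> (\<Sum>R\<in>\<Q>. jump \<Q> (\<lambda>C. Max0 B C powr q') R * u R)"
      using v0 q' by (intro sum_mono mult_right_mono jump_powr_le_jump_Max0_powr[OF lam]) auto
    finally show "(\<Sum>R\<in>\<Q>. (jump \<Q> (Max0 B) R * u R powr (1 / q')) powr q') \<le> NB" using NB by simp
  qed (use pq q' in \<open>auto intro!: sum_nonneg\<close>)
  also have "(D * (q / p) * NA powr (q / p)) powr (1 / q) = (D * (q / p)) powr (1 / q) * NA powr (1 / p)"
    using D pq by (subst powr_mult) (auto simp: powr_powr)
  finally show ?thesis .
qed

text \<open>Summation by parts over the family turns the form into the sums \<open>\<Sum> \<tau>\<close> over the members below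
  \<open>R\<close>, weighted by the jumps of \<open>A B\<close>.\<close>
lemma bilinear_laminar:
  fixes v u A B \<tau> :: "'a set \<Rightarrow> real"
  assumes lam: "laminar \<Q>" and ne: "{} \<notin> \<Q>"
    and v: "\<And>P R. P \<in> \<Q> \<Longrightarrow> R \<in> \<Q> \<Longrightarrow> R \<subseteq> P \<Longrightarrow> v R \<le> v P" "\<And>R. R \<in> \<Q> \<Longrightarrow> 0 < v R"
    and u: "\<And>P R. P \<in> \<Q> \<Longrightarrow> R \<in> \<Q> \<Longrightarrow> R \<subseteq> P \<Longrightarrow> u R \<le> u P" "\<And>R. R \<in> \<Q> \<Longrightarrow> 0 < u R"
    and AB: "\<And>R. R \<in> \<Q> \<Longrightarrow> 0 \<le> A R" "\<And>R. R \<in> \<Q> \<Longrightarrow> 0 \<le> B R" "\<And>R. R \<in> \<Q> \<Longrightarrow> 0 \<le> \<tau> R" "0 \<le> c"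
    and pq: "1 < p" "p < q" "1 / p + 1 / p' = 1" "1 / q + 1 / q' = 1"
    and T: "\<And>R. R \<in> \<Q> \<Longrightarrow> (\<Sum>Q\<in>{Q\<in>\<Q>. Q \<subseteq> R}. \<tau> Q) \<le> c * (v R powr (1 / p) * u R powr (1 / q'))"
    and Dv: "\<And>P. P \<in> \<Q> \<Longrightarrow> (\<Sum>R\<in>{R\<in>\<Q>. R \<subseteq> P}. v R powr (q / p)) \<le> Dv * v P powr (q / p)" "0 \<le> Dv"
    and Du: "\<And>P. P \<in> \<Q> \<Longrightarrow> (\<Sum>R\<in>{R\<in>\<Q>. R \<subseteq> P}. u R powr (p' / q')) \<le> Du * u P powr (p' / q')" "0 \<le> Du"
    and NA: "(\<Sum>R\<in>\<Q>. jump \<Q> (\<lambda>C. Max0 A C powr p) R * v R) \<le> NA"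
    and NB: "(\<Sum>R\<in>\<Q>. jump \<Q> (\<lambda>C. Max0 B C powr q') R * u R) \<le> NB"
  shows "(\<Sum>Q\<in>\<Q>. \<tau> Q * A Q * B Q) \<le> c * (((Dv * (q / p)) powr (1 / q) + (Du * (p' / q')) powr (1 / p'))
      * (NA powr (1 / p) * NB powr (1 / q')))"
proof -
  note fin = finite_laminar[OF lam]
  have p': "1 < p'" "1 < q'" "q' < p'"
    using conjugate_gt_1[of p p'] conjugate_gt_1[of q q'] conjugate_less[of p q p' q'] pq by auto
  let ?a = "\<lambda>R. Max0 A {P\<in>\<Q>. R \<subseteq> P}" and ?b = "\<lambda>R. Max0 B {P\<in>\<Q>. R \<subseteq> P}"
  let ?H = "\<lambda>C. Max0 A C * Max0 B C"
  have Max0A0: "0 \<le> Max0 A {P\<in>\<Q>. f P}" for f by (rule Max0_nonneg) (use fin in auto)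
  have Max0B0: "0 \<le> Max0 B {P\<in>\<Q>. f P}" for f by (rule Max0_nonneg) (use fin in auto)
  \<comment> \<open>The product rule for increments: A at its new value times the jump of B, plus B
    at its old value times the jump of A. Afterwards the old value is enlarged to the new
    one.\<close>
  have J: "0 \<le> jump \<Q> ?H R" "jump \<Q> ?H R \<le> ?a R * jump \<Q> (Max0 B) R + ?b R * jump \<Q> (Max0 A) R" for R
  proof -
    have "jump \<Q> ?H R = ?a R * jump \<Q> (Max0 B) R + Max0 B {P\<in>\<Q>. R \<subset> P} * jump \<Q> (Max0 A) R"
      by (simp add: jump_def algebra_simps)
    then show "0 \<le> jump \<Q> ?H R" "jump \<Q> ?H R \<le> ?a R * jump \<Q> (Max0 B) R + ?b R * jump \<Q> (Max0 A) R"
      using Max0A0 Max0B0 jump_Max0_nonneg[OF lam] Max0_strictly_above_le[OF lam]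
      by (auto intro!: mult_right_mono)
  qed
  have "(\<Sum>Q\<in>\<Q>. \<tau> Q * A Q * B Q) \<le> (\<Sum>Q\<in>\<Q>. \<tau> Q * (?a Q * ?b Q))"
  proof (rule sum_mono)
    fix Q assume Q: "Q \<in> \<Q>"
    have "A Q \<le> ?a Q" "B Q \<le> ?b Q" using Q fin by (auto intro!: Max0_ge)
    then show "\<tau> Q * A Q * B Q \<le> \<tau> Q * (?a Q * ?b Q)"
      unfolding mult.assoc using AB Q Max0A0 by (intro mult_left_mono mult_mono) auto
  qed
  also have "\<dots> = (\<Sum>Q\<in>\<Q>. \<Sum>R\<in>{R\<in>\<Q>. Q \<subseteq> R}. \<tau> Q * jump \<Q> ?H R)"
  proof (rule sum.cong[OF refl])
    fix Q assume "Q \<in> \<Q>"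
    then have "Q \<noteq> {}" using ne by auto
    from sum_jump_above[OF lam this, of ?H]
    show "\<tau> Q * (?a Q * ?b Q) = (\<Sum>R\<in>{R\<in>\<Q>. Q \<subseteq> R}. \<tau> Q * jump \<Q> ?H R)"
      by (simp flip: sum_distrib_left)
  qed
  also have "\<dots> = (\<Sum>R\<in>\<Q>. \<Sum>Q\<in>{Q\<in>\<Q>. Q \<subseteq> R}. \<tau> Q * jump \<Q> ?H R)"
    by (rule sum.swap_restrict) (use fin in auto)
  also have "\<dots> = (\<Sum>R\<in>\<Q>. jump \<Q> ?H R * (\<Sum>Q\<in>{Q\<in>\<Q>. Q \<subseteq> R}. \<tau> Q))"
    by (simp only: sum_distrib_left mult.commute[of "\<tau> _"])
  also have "\<dots> \<le> (\<Sum>R\<in>\<Q>. (?a R * jump \<Q> (Max0 B) R + ?b R * jump \<Q> (Max0 A) R)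
      * (c * (v R powr (1 / p) * u R powr (1 / q'))))"
    using AB J T by (intro sum_mono mult_mono) (auto intro!: sum_nonneg add_nonneg_nonneg
        mult_nonneg_nonneg Max0A0 Max0B0 jump_Max0_nonneg[OF lam])
  also have "\<dots> = c * ((\<Sum>R\<in>\<Q>. ?a R * jump \<Q> (Max0 B) R * (v R powr (1 / p) * u R powr (1 / q')))
      + (\<Sum>R\<in>\<Q>. ?b R * jump \<Q> (Max0 A) R * (u R powr (1 / q') * v R powr (1 / p))))"
    by (simp add: sum_distrib_left sum.distrib algebra_simps)
  also have "\<dots> \<le> c * ((Dv * (q / p)) powr (1 / q) * NA powr (1 / p) * NB powr (1 / q')
      + (Du * (p' / q')) powr (1 / p') * NB powr (1 / q') * NA powr (1 / p))"
  proof (intro mult_left_mono add_mono AB(4))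
    show "(\<Sum>R\<in>\<Q>. ?a R * jump \<Q> (Max0 B) R * (v R powr (1 / p) * u R powr (1 / q')))
        \<le> (Dv * (q / p)) powr (1 / q) * NA powr (1 / p) * NB powr (1 / q')"
      by (rule sum_Max0_jump_le[OF lam ne v u(2)]) (use pq Dv NA NB in auto)
    \<comment> \<open>The same estimate with (v, p, q) exchanged for (u, q', p'); the condition p <
      q turns into q' < p'.\<close>
    show "(\<Sum>R\<in>\<Q>. ?b R * jump \<Q> (Max0 A) R * (u R powr (1 / q') * v R powr (1 / p)))
        \<le> (Du * (p' / q')) powr (1 / p') * NB powr (1 / q') * NA powr (1 / p)"
      by (rule sum_Max0_jump_le[OF lam ne u v(2)]) (use pq p' Du NA NB in auto)
  qed
  finally show ?thesis by (simp add: algebra_simps)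
qed

section \<open>Shifted triadic grids\<close>

definition shift :: "'n set \<Rightarrow> 'n \<Rightarrow> int" where
  "shift b i = (if i \<in> b then 1 else 0)"

text \<open>The triadic grid translated by half a cell in the directions \<open>b\<close>. As \<open>3/2 - 1/2\<close> is an
  integer, the same translation at every scale leaves the grid nested.\<close>
definition cell :: "'n::finite set \<Rightarrow> int \<Rightarrow> ('n \<Rightarrow> int) \<Rightarrow> (real^'n) set" where
  "cell b k m = {x. \<forall>i. \<lfloor>x $ i / 3 powi k - of_int (shift b i) / 2\<rfloor> = m i}"

definition grid :: "'n::finite set \<Rightarrow> (real^'n) set set" where
  "grid b = {cell b k m |k m. True}"

definition cell_center :: "'n::finite set \<Rightarrow> int \<Rightarrow> ('n \<Rightarrow> int) \<Rightarrow> real^'n" where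
  "cell_center b k m = (\<chi> i. 3 powi k * (of_int (m i) + of_int (shift b i) / 2 + 1 / 2))"

lemma mem_cell_iff:
  "x \<in> cell b k m \<longleftrightarrow> (\<forall>i. 3 powi k * (of_int (m i) + of_int (shift b i) / 2) \<le> x $ i
     \<and> x $ i < 3 powi k * (of_int (m i) + of_int (shift b i) / 2 + 1))"
  unfolding cell_def by (simp add: floor_eq_iff field_simps)

lemma inner_One: "b \<in> Basis \<Longrightarrow> One \<bullet> b = (1 :: real)"
  by (simp add: inner_sum_left inner_Basis sum.delta)

lemma One_nth: "(One :: real^'n) $ i = 1"
  unfolding cart_eq_inner_axis by (rule inner_One) (simp add: axis_in_Basis_iff)

lemma mem_cbox_One:
  fixes x c :: "real^'n"
  shows "x \<in> cbox (c - r *\<^sub>R One) (c + r *\<^sub>R One) \<longleftrightarrow> (\<forall>i. c $ i - r \<le> x $ i \<and> x $ i \<le> c $ i + r)"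
    and "x \<in> box (c - r *\<^sub>R One) (c + r *\<^sub>R One) \<longleftrightarrow> (\<forall>i. c $ i - r < x $ i \<and> x $ i < c $ i + r)"
  unfolding mem_box_cart vector_minus_component vector_add_component vector_scaleR_component One_nth
      by simp_all

lemma mem_cube_iff: "x \<in> cube c l \<longleftrightarrow> (\<forall>i. c $ i - l / 2 \<le> x $ i \<and> x $ i \<le> c $ i + l / 2)"
  unfolding cube_def mem_cbox_One ..

lemma cell_subset_cube: "cell b k m \<subseteq> cube (cell_center b k m) (3 powi k)"
proof
  fix x assume x: "x \<in> cell b k m"
  show "x \<in> cube (cell_center b k m) (3 powi k)"
    unfolding mem_cube_iff
  proof
    fix i
    show "cell_center b k m $ i - 3 powi k / 2 \<le> x $ i \<and> x $ i \<le> cell_center b k m $ i + 3 powi k / 2"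
      using x[unfolded mem_cell_iff, rule_format, of i] by (simp add: cell_center_def algebra_simps)
  qed
qed

lemma box_subset_cell:
  "box (cell_center b k m - (3 powi k / 2) *\<^sub>R One) (cell_center b k m
      + (3 powi k / 2) *\<^sub>R One) \<subseteq> cell b k m"
proof
  fix x :: "real^'a"
  assume x: "x \<in> box (cell_center b k m - (3 powi k / 2) *\<^sub>R One) (cell_center b k m
      + (3 powi k / 2) *\<^sub>R One)"
  show "x \<in> cell b k m"
    unfolding mem_cell_iff
  proof
    fix i
    show "3 powi k * (of_int (m i) + of_int (shift b i) / 2) \<le> x $ i
        \<and> x $ i < 3 powi k * (of_int (m i) + of_int (shift b i) / 2 + 1)"
      using x[unfolded mem_cbox_One, rule_format, of i] by (simp add: cell_center_def algebra_simps)
  qed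
qed

text \<open>Nesting requires half-open cells, whereas (A2) speaks of closed cubes. The two differ by
  parts of the faces only, so integrals do not distinguish them.\<close>

lemma negligible_cube_diff_cell: "negligible (cube (cell_center b k m) (3 powi k) - cell b k m)"
  by (rule negligible_subset[OF negligible_frontier_interval]) (use box_subset_cell
      in \<open>fastforce simp: cube_def\<close>)

lemma cube_sets [measurable]: "cube c l \<in> sets lebesgue"
  by (simp add: cube_def)

lemma cell_sets [measurable]: "cell b k m \<in> sets lebesgue"
proof -
  have "cell b k m = cube (cell_center b k m) (3 powi k) - (cube (cell_center b k m) (3 powi k) -
      cell b k m)"
    using cell_subset_cube[of b k m] by blast
  then show ?thesis
    using negligible_cube_diff_cell[of b k m] by (metis cube_sets negligible_imp_sets sets.Diff)
qed

lemma AE_cell_iff_cube: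
  "AE x in lebesgue. x \<in> cell b k m \<longleftrightarrow> x \<in> cube (cell_center b k m) (3 powi k)"
proof -
  have "AE x in lebesgue. x \<notin> cube (cell_center b k m) (3 powi k) - cell b k m"
    using negligible_cube_diff_cell[of b k m] by (intro AE_not_in) (simp add: negligible_iff_null_sets)
  then show ?thesis by eventually_elim (use cell_subset_cube in blast)
qed

lemma emeasure_cube: "0 \<le> l \<Longrightarrow> emeasure lebesgue (cube (c :: real^'n) l) = ennreal (l ^ CARD('n))"
proof -
  assume l: "0 \<le> l"
  have *: "(c + (l/2) *\<^sub>R One - (c - (l/2) *\<^sub>R One)) \<bullet> b = l" if "b \<in> Basis" for b
    using inner_One[OF that] unfolding inner_diff_left inner_add_left inner_scaleR_left by simp
  have "emeasure lebesgue (cube c l) = emeasure lborel (cube c l)"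
    by (simp add: cube_def)
  also have "\<dots> = ennreal (\<Prod>b\<in>(Basis :: (real^'n) set). (c + (l/2) *\<^sub>R One - (c - (l/2) *\<^sub>R One)) \<bullet> b)"
    unfolding cube_def
  proof (rule emeasure_lborel_cbox)
    fix b :: "real^'n" assume "b \<in> Basis"
    from *[OF this] l show "(c - (l/2) *\<^sub>R One) \<bullet> b \<le> (c + (l/2) *\<^sub>R One) \<bullet> b"
      unfolding inner_diff_left by linarith
  qed
  also have "(\<Prod>b\<in>(Basis :: (real^'n) set). (c + (l/2) *\<^sub>R One - (c - (l/2) *\<^sub>R One)) \<bullet> b)
      = (\<Prod>b\<in>(Basis :: (real^'n) set). l)"
    using * by (rule prod.cong[OF refl])
  finally show ?thesis by simp
qed

lemma measure_cube: "0 \<le> l \<Longrightarrow> measure lebesgue (cube (c :: real^'n) l) = l ^ CARD('n)"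
  unfolding measure_def by (simp add: emeasure_cube del: emeasure_completion)

lemma emeasure_cell: "emeasure lebesgue (cell b k (m :: 'n::finite \<Rightarrow> int))
    = ennreal ((3 powi k) ^ CARD('n))"
proof -
  have "emeasure lebesgue (cell b k m) = emeasure lebesgue (cube (cell_center b k m) (3 powi k))"
    by (rule emeasure_eq_AE[OF AE_cell_iff_cube]) auto
  then show ?thesis by (simp add: emeasure_cube del: emeasure_completion)
qed

lemma measure_cell: "measure lebesgue (cell b k (m :: 'n::finite \<Rightarrow> int)) = (3 powi k) ^ CARD('n)"
  unfolding measure_def by (simp add: emeasure_cell del: emeasure_completion)

lemma cell_nonempty: "cell b k m \<noteq> {}"
  using emeasure_cell[of b k m] by (metis emeasure_empty ennreal_eq_0_iff not_le zero_less_power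
      zero_less_power_int zero_less_numeral)

lemma cell_cases: "x \<in> cell b k (\<lambda>i. \<lfloor>x $ i / 3 powi k - of_int (shift b i) / 2\<rfloor>)"
  by (simp add: cell_def)

lemma cell_eq_of_mem: "x \<in> cell b k m \<Longrightarrow> x \<in> cell b k m' \<Longrightarrow> m = m'"
  by (auto simp: cell_def fun_eq_iff)

lemma cell_disjoint: "cell b k m \<noteq> cell b k m' \<Longrightarrow> cell b k m \<inter> cell b k m' = {}"
  using cell_eq_of_mem by blast

text \<open>With s the shift and y = x/3^k - s/2, the coordinate one generation up is (y - s)/3,
  because s/6 + s/3 = s/2. Its floor depends only on the floor of y, as s is an integer.\<close>

lemma cell_subset_parent: "cell b k m \<subseteq> cell b (k + 1) (\<lambda>i. (m i - shift b i) div 3)"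
proof
  fix x assume x: "x \<in> cell b k m"
  have "\<lfloor>x $ i / 3 powi (k + 1) - of_int (shift b i) / 2\<rfloor> = (m i - shift b i) div 3" for i
  proof -
    define y where "y = x $ i / 3 powi k - of_int (shift b i) / 2"
    have "x $ i / 3 powi (k + 1) - of_int (shift b i) / 2 = (y - of_int (shift b i)) / of_int 3"
      by (simp add: y_def power_int_add field_simps)
    also have "\<lfloor>\<dots>\<rfloor> = \<lfloor>y - of_int (shift b i)\<rfloor> div 3"
      using floor_divide_real_eq_div[of 3 "y - of_int (shift b i)"] by simp
    also have "\<lfloor>y - of_int (shift b i)\<rfloor> = \<lfloor>y\<rfloor> - shift b i" by simp
    also have "\<lfloor>y\<rfloor> = m i" using x by (simp add: cell_def y_def)
    finally show ?thesis .
  qed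
  then show "x \<in> cell b (k + 1) (\<lambda>i. (m i - shift b i) div 3)" by (simp add: cell_def)
qed

lemma cell_ancestor: "\<exists>m'. cell b k m \<subseteq> cell b (k + int d) m'"
proof (induction d)
  case (Suc d)
  then obtain m' where "cell b k m \<subseteq> cell b (k + int d) m'" by blast
  also have "\<dots> \<subseteq> cell b (k + int d + 1) (\<lambda>i. (m' i - shift b i) div 3)" by (rule cell_subset_parent)
  finally show ?case by (auto simp: algebra_simps)
qed auto

lemma cell_nested:
  assumes "j \<le> k" "cell b j m' \<inter> cell b k m \<noteq> {}"
  shows "cell b j m' \<subseteq> cell b k m"
proof -
  obtain m'' where "cell b j m' \<subseteq> cell b (j + int (nat (k - j))) m''" using cell_ancestor by blast
  then have *: "cell b j m' \<subseteq> cell b k m''" using assms(1) by simp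
  then have "m'' = m" using assms(2) cell_eq_of_mem by blast
  with * show ?thesis by simp
qed

lemma laminar_grid: "finite \<Q> \<Longrightarrow> \<Q> \<subseteq> grid b \<Longrightarrow> laminar \<Q>"
  unfolding laminar_def
proof (intro conjI ballI)
  fix P R assume "\<Q> \<subseteq> grid b" "P \<in> \<Q>" "R \<in> \<Q>"
  then have "P \<in> grid b" "R \<in> grid b" by auto
  then obtain k m k' m' where "P = cell b k m" "R = cell b k' m'" unfolding grid_def by blast
  then show "P \<subseteq> R \<or> R \<subseteq> P \<or> P \<inter> R = {}"
    using cell_nested[of k k' b m m'] cell_nested[of k' k b m' m] linear[of k k'] by blast
qed

lemma cell_subset_imp_le:
  assumes "cell b j m' \<subseteq> cell b k m"
  shows "j \<le> k"
proof -
  have "emeasure lebesgue (cell b j m') \<le> emeasure lebesgue (cell b k m)"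
    using assms by (intro emeasure_mono) auto
  then have "(3::real) powi j \<le> 3 powi k"
    by (simp add: emeasure_cell del: emeasure_completion)
  then show ?thesis using power_int_strict_increasing[of k j "3::real"]
      by (meson not_le numeral_eq_one_iff one_less_numeral_iff semiring_norm(77))
qed

section \<open>Generations of a grid and packing\<close>

definition children :: "'n::finite set \<Rightarrow> int \<Rightarrow> ('n \<Rightarrow> int) \<Rightarrow> (real^'n) set set" where
  "children b k m = {cell b (k - 1) m' |m'. cell b (k - 1) m' \<subseteq> cell b k m}"

lemma finite_cells_in_bounded:
  assumes "bounded S"
  shows "finite {m. cell b k m \<inter> S \<noteq> {}}"
proof -
  obtain B where B: "\<And>x. x \<in> S \<Longrightarrow> norm x \<le> B" using assms by (auto simp: bounded_iff)
  define N where "N = \<lceil>B / 3 powi k\<rceil> + 1"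
  have "{m. cell b k m \<inter> S \<noteq> {}} \<subseteq> (\<Pi>\<^sub>E i\<in>UNIV. {-N-1..N})"
  proof
    fix m assume "m \<in> {m. cell b k m \<inter> S \<noteq> {}}"
    then obtain x where x: "x \<in> cell b k m" "x \<in> S" by blast
    have "- N - 1 \<le> m i \<and> m i \<le> N" for i
    proof -
    have "\<bar>x $ i\<bar> \<le> B" using B[OF x(2)] component_le_norm_cart[of x i] by linarith
    then have "\<bar>x $ i / 3 powi k\<bar> \<le> B / 3 powi k" by (simp add: divide_right_mono abs_divide)
    then have "\<bar>x $ i / 3 powi k\<bar> \<le> of_int N - 1"
      using le_of_int_ceiling[of "B / 3 powi k"] unfolding N_def by linarith
    moreover have "m i = \<lfloor>x $ i / 3 powi k - of_int (shift b i) / 2\<rfloor>" using x by (simp add: cell_def)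
    moreover have "0 \<le> shift b i" "shift b i \<le> 1" by (auto simp: shift_def)
    ultimately show ?thesis by linarith
    qed
    then show "m \<in> (\<Pi>\<^sub>E i\<in>UNIV. {-N-1..N})" by (simp add: PiE_UNIV_domain Pi_iff)
  qed
  then show ?thesis by (rule finite_subset) (simp add: finite_PiE)
qed

lemma bounded_cube: "bounded (cube c l)"
  by (simp add: cube_def)

lemma bounded_cell: "bounded (cell b k m)"
  using bounded_cube cell_subset_cube by (rule bounded_subset)

lemma finite_children: "finite (children b k m)"
proof -
  have "children b k m \<subseteq> cell b (k - 1) ` {m'. cell b (k - 1) m' \<inter> cell b k m \<noteq> {}}"
    using cell_nonempty by (fastforce simp: children_def)
  then show ?thesis using finite_cells_in_bounded[OF bounded_cell] finite_surj by blast
qed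

lemma disjoint_children: "disjoint_family_on (\<lambda>c. c) (children b k m)"
  unfolding disjoint_family_on_def children_def using cell_disjoint by blast

lemma Union_children: "\<Union>(children b k m) = cell b k m"
proof (rule equalityI)
  show "cell b k m \<subseteq> \<Union>(children b k m)"
  proof
    fix x assume x: "x \<in> cell b k m"
    obtain m' where m': "x \<in> cell b (k - 1) m'" using cell_cases by blast
    then have "cell b (k - 1) m' \<subseteq> cell b k m" using x by (intro cell_nested) auto
    then show "x \<in> \<Union>(children b k m)" using m' by (auto simp: children_def)
  qed
qed (auto simp: children_def)

text \<open>A geometric series over generations: if the children together carry at most the
  proportion \<rho> of \<mu>, then d generations of descendants carry at most \<rho>^d of
  it.\<close>

lemma grid_packing:
  fixes \<mu> :: "(real^'n::finite) set \<Rightarrow> real"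
  assumes nn: "\<And>k m. 0 \<le> \<mu> (cell b k m)" and \<rho>: "0 \<le> \<rho>" "\<rho> < 1"
    and ch: "\<And>k m. (\<Sum>c\<in>children b k m. \<mu> c) \<le> \<rho> * \<mu> (cell b k m)"
    and \<Q>: "finite \<Q>" "\<Q> \<subseteq> grid b" "\<And>Q. Q \<in> \<Q> \<Longrightarrow> Q \<subseteq> cell b k m"
  shows "(\<Sum>Q\<in>\<Q>. \<mu> Q) \<le> \<mu> (cell b k m) / (1 - \<rho>)"
proof -
  \<comment> \<open>Induction on the number of generations below the top cell. Every member other
    than the top cell lies in exactly one child, and 1 + \<rho>/(1-\<rho>) = 1/(1-\<rho>) closes the
    step.\<close>
  have *: "(\<Sum>Q\<in>\<Q>. \<mu> Q) \<le> \<mu> (cell b k m) / (1 - \<rho>)"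
    if "finite \<Q>" "\<And>Q. Q \<in> \<Q> \<Longrightarrow> Q \<subseteq> cell b k m"
      "\<And>Q. Q \<in> \<Q> \<Longrightarrow> \<exists>j m'. Q = cell b j m' \<and> k - int d \<le> j" for d \<Q> k m
    using that
  proof (induction d arbitrary: \<Q> k m)
    case 0
    have "\<Q> \<subseteq> {cell b k m}"
    proof
      fix Q assume Q: "Q \<in> \<Q>"
      obtain j m' where j: "Q = cell b j m'" "k \<le> j" using "0.prems"(3)[OF Q] by auto
      then have "j = k" using "0.prems"(2)[OF Q] cell_subset_imp_le [of b j m' k m] by simp
      then show "Q \<in> {cell b k m}"
        using "0.prems"(2)[OF Q] j cell_disjoint[of b k m' m] cell_nonempty[of b k m'] by auto
    qed
    then have "(\<Sum>Q\<in>\<Q>. \<mu> Q) \<le> (\<Sum>Q\<in>{cell b k m}. \<mu> Q)" by (intro sum_mono2) (auto simp: nn)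
    also have "\<dots> \<le> \<mu> (cell b k m) / (1 - \<rho>)"
      using nn[of k m] \<rho> by (simp add: field_simps)
    finally show ?case .
  next
    case (Suc d)
    let ?R = "cell b k m"
    have sub: "\<Q> \<subseteq> insert ?R (\<Union>c\<in>children b k m. {Q\<in>\<Q>. Q \<subseteq> c})"
    proof
      fix Q assume Q: "Q \<in> \<Q>"
      obtain j m' where j: "Q = cell b j m'" using Suc.prems(3)[OF Q] by auto
      have jk: "j \<le> k" using Suc.prems(2)[OF Q] cell_subset_imp_le j by blast
      obtain x where x: "x \<in> Q" using cell_nonempty j by blast
      show "Q \<in> insert ?R (\<Union>c\<in>children b k m. {Q\<in>\<Q>. Q \<subseteq> c})"
      proof (cases "j = k")
        case True
        then show ?thesis
          using Suc.prems(2)[OF Q] j cell_disjoint[of b k m' m] cell_nonempty[of b k m'] by auto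
      next
        case False
        obtain c where c: "c \<in> children b k m" "x \<in> c"
          using Union_children[of b k m] Suc.prems(2)[OF Q] x by blast
        then obtain m'' where "c = cell b (k - 1) m''" by (auto simp: children_def)
        moreover have "cell b j m' \<subseteq> cell b (k - 1) m''" if "c = cell b (k - 1) m''"
          by (rule cell_nested) (use that c x j jk False in auto)
        ultimately have "Q \<subseteq> c" using j by simp
        then show ?thesis using c Q by blast
      qed
    qed
    have fin: "finite (\<Union>c\<in>children b k m. {Q\<in>\<Q>. Q \<subseteq> c})"
      by (rule finite_UN_I[OF finite_children]) (use Suc.prems(1) in auto)
    have nnQ: "0 \<le> \<mu> Q" if "Q \<in> \<Q>" for Q using Suc.prems(3)[OF that] nn by auto
    have "(\<Sum>Q\<in>\<Q>. \<mu> Q) \<le> (\<Sum>Q\<in>insert ?R (\<Union>c\<in>children b k m. {Q\<in>\<Q>. Q \<subseteq> c}). \<mu> Q)"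
      using sub fin nn nnQ by (intro sum_mono2) auto
    also have "\<dots> \<le> \<mu> ?R + (\<Sum>Q\<in>(\<Union>c\<in>children b k m. {Q\<in>\<Q>. Q \<subseteq> c}). \<mu> Q)"
      using fin nn[of k m] by (cases "?R \<in> (\<Union>c\<in>children b k m. {Q\<in>\<Q>. Q \<subseteq> c})") (simp_all add: insert_absorb)
    also have "(\<Sum>Q\<in>(\<Union>c\<in>children b k m. {Q\<in>\<Q>. Q \<subseteq> c}). \<mu> Q) \<le> (\<Sum>c\<in>children b k m. \<Sum>Q\<in>{Q\<in>\<Q>. Q \<subseteq> c}. \<mu> Q)"
    proof (subst sum.UNION_disjoint)
      show "\<forall>c\<in>children b k m. \<forall>c'\<in>children b k m. c \<noteq> c' \<longrightarrow> {Q\<in>\<Q>. Q \<subseteq> c} \<inter> {Q\<in>\<Q>. Q \<subseteq> c'} = {}"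
      proof (intro ballI impI)
        fix c c' assume c: "c \<in> children b k m" "c' \<in> children b k m" "c \<noteq> c'"
        then have "c \<inter> c' = {}" using disjoint_children[of b k m] by (auto simp: disjoint_family_on_def)
        moreover have "Q \<noteq> {}" if "Q \<in> \<Q>" for Q using Suc.prems(3)[OF that] cell_nonempty by blast
        ultimately show "{Q\<in>\<Q>. Q \<subseteq> c} \<inter> {Q\<in>\<Q>. Q \<subseteq> c'} = {}" by blast
      qed
    qed (use finite_children Suc.prems(1) in auto)
    also have "\<dots> \<le> (\<Sum>c\<in>children b k m. \<mu> c / (1 - \<rho>))"
    proof (rule sum_mono)
      fix c assume "c \<in> children b k m"
      then obtain m' where c: "c = cell b (k - 1) m'" by (auto simp: children_def)
      show "(\<Sum>Q\<in>{Q\<in>\<Q>. Q \<subseteq> c}. \<mu> Q) \<le> \<mu> c / (1 - \<rho>)"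
        unfolding c
      proof (rule Suc.IH)
        fix Q assume "Q \<in> {Q\<in>\<Q>. Q \<subseteq> cell b (k - 1) m'}"
        then obtain j m'' where j: "Q = cell b j m''" "k - int (Suc d) \<le> j"
          using Suc.prems(3)[of Q] by blast
        then have "k - 1 - int d \<le> j" by simp
        with j(1) show "\<exists>j m'. Q = cell b j m' \<and> k - 1 - int d \<le> j" by blast
      qed (use Suc.prems(1) in auto)
    qed
    also have "\<dots> \<le> \<rho> * \<mu> ?R / (1 - \<rho>)"
      using \<rho> ch[of k m] by (simp add: divide_right_mono flip: sum_divide_distrib)
    also have "\<mu> ?R + \<rho> * \<mu> ?R / (1 - \<rho>) = \<mu> ?R / (1 - \<rho>)"
      using \<rho> by (simp add: field_simps)
    finally show ?case by simp
  qed
  have "\<forall>Q\<in>\<Q>. \<exists>j m'. Q = cell b j m'" using \<Q>(2) by (auto simp: grid_def)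
  then obtain j where j: "\<And>Q. Q \<in> \<Q> \<Longrightarrow> \<exists>m'. Q = cell b (j Q) m'" by metis
  \<comment> \<open>Any bound on the depths of the finitely many members would do; the sum of the
    depths avoids a maximum over a possibly empty family.\<close>
  define d where "d = nat (\<Sum>Q\<in>\<Q>. \<bar>k - j Q\<bar>)"
  have "k - int d \<le> j Q" if "Q \<in> \<Q>" for Q
  proof -
    have "\<bar>k - j Q\<bar> \<le> (\<Sum>Q\<in>\<Q>. \<bar>k - j Q\<bar>)" using \<Q>(1) that by (intro member_le_sum) auto
    then show ?thesis by (simp add: d_def)
  qed
  then show ?thesis using *[of \<Q> k m d] \<Q> j by blast
qed

text \<open>An interval shorter than half a cell that straddles an unshifted grid point cannot also
  straddle a point shifted by half a cell. So each coordinate has a good choice, and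
  \<open>b\<close> collects the coordinates where the shift is needed.\<close>

lemma cube_subset_cell:
  fixes c :: "real^'n::finite"
  assumes "0 \<le> l" "l < 3 powi k / 2"
  shows "\<exists>b m. cube c l \<subseteq> cell b k m"
proof -
  define y z where "y i = (c $ i - l / 2) / 3 powi k" and "z i = (c $ i + l / 2) / 3 powi k" for i
  define b where "b = {i. \<lfloor>y i\<rfloor> \<noteq> \<lfloor>z i\<rfloor>}"
  define m where "m i = \<lfloor>y i - of_int (shift b i) / 2\<rfloor>" for i
  have yz: "y i \<le> z i" "z i < y i + 1 / 2" for i
    using assms by (auto simp: y_def z_def field_simps)
  have m: "m i = \<lfloor>z i - of_int (shift b i) / 2\<rfloor>" for i
  proof (cases "i \<in> b")
    case True
    then have "\<lfloor>y i\<rfloor> \<noteq> \<lfloor>z i\<rfloor>" by (simp add: b_def)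
    then have "\<lfloor>y i\<rfloor> < \<lfloor>z i\<rfloor>" using floor_mono[OF yz(1)[of i]] by linarith
    then have "y i < of_int \<lfloor>z i\<rfloor>" by (simp add: floor_less_iff)
    then have "of_int (\<lfloor>z i\<rfloor> - 1) \<le> y i - 1 / 2" "z i - 1 / 2 < of_int (\<lfloor>z i\<rfloor> - 1) + 1"
      using yz[of i] of_int_floor_le[of "z i"] unfolding of_int_diff by linarith+
    then have "\<lfloor>y i - 1 / 2\<rfloor> = \<lfloor>z i\<rfloor> - 1" "\<lfloor>z i - 1 / 2\<rfloor> = \<lfloor>z i\<rfloor> - 1"
      using yz[of i] by (intro floor_unique; linarith)+
    then have "\<lfloor>y i - 1 / 2\<rfloor> = \<lfloor>z i - 1 / 2\<rfloor>" by simp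
    then show ?thesis using True by (simp add: m_def shift_def)
  qed (simp add: m_def shift_def b_def)
  have "cube c l \<subseteq> cell b k m"
  proof
    fix x assume x: "x \<in> cube c l"
    have "\<lfloor>x $ i / 3 powi k - of_int (shift b i) / 2\<rfloor> = m i" for i
    proof -
      have "y i \<le> x $ i / 3 powi k" "x $ i / 3 powi k \<le> z i"
        using x unfolding mem_cube_iff y_def z_def by (auto intro!: divide_right_mono)
      then have "\<lfloor>y i - of_int (shift b i) / 2\<rfloor> \<le> \<lfloor>x $ i / 3 powi k - of_int (shift b i) / 2\<rfloor>"
        "\<lfloor>x $ i / 3 powi k - of_int (shift b i) / 2\<rfloor> \<le> \<lfloor>z i - of_int (shift b i) / 2\<rfloor>"
        by (auto intro!: floor_mono)
      then show ?thesis using m[of i] m_def[of i] by linarith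
    qed
    then show "x \<in> cell b k m" by (simp add: cell_def)
  qed
  then show ?thesis by blast
qed

section \<open>Pairs of weights on a grid\<close>

definition wint :: "(real^'n \<Rightarrow> real) \<Rightarrow> (real^'n) set \<Rightarrow> real" where
  "wint w Q = (LINT x:Q|lebesgue. w x)"

abbreviation vol :: "(real^'n) set \<Rightarrow> real" where
  "vol Q \<equiv> measure lebesgue Q"

lemma vol_cell_pos: "0 < vol (cell b k m)"
  by (simp add: measure_cell)

lemma vol_child_le:
  assumes "c \<in> children b k (m :: 'n::finite \<Rightarrow> int)"
  shows "vol c \<le> vol (cell b k m) / 3"
proof -
  obtain m' where c: "c = cell b (k - 1) m'" using assms by (auto simp: children_def)
  have "vol c = (3 powi k / 3) ^ CARD('n)" by (simp add: c measure_cell power_int_diff)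
  also have "\<dots> = vol (cell b k m) * (1 / 3) ^ CARD('n)" by (simp add: measure_cell power_divide)
  also have "\<dots> \<le> vol (cell b k m) * (1 / 3) ^ 1"
    by (intro mult_left_mono power_decreasing) (auto simp: Suc_le_eq)
  finally show ?thesis by simp
qed

lemma child_sets: "c \<in> children b k m \<Longrightarrow> c \<in> sets lebesgue"
  by (auto simp: children_def)

lemma child_subset: "c \<in> children b k m \<Longrightarrow> c \<subseteq> cell b k m"
  by (auto simp: children_def)

lemma sum_children_wint:
  assumes "set_integrable lebesgue (cell b k m) w"
  shows "(\<Sum>c\<in>children b k m. wint w c) = wint w (cell b k m)"
proof -
  have "(LINT x:(\<Union>c\<in>children b k m. c)|lebesgue. w x) = (\<Sum>c\<in>children b k m. LINT x:c|lebesgue. w x)"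
  proof (rule set_integral_finite_Union)
    show "set_integrable lebesgue c w" if "c \<in> children b k m" for c
      using assms child_sets[OF that] child_subset[OF that] by (rule set_integrable_subset)
  qed (use finite_children disjoint_children child_sets in auto)
  then show ?thesis using Union_children[of b k m] by (simp add: wint_def)
qed

lemma wint_mono:
  assumes "set_integrable lebesgue S w" "\<And>x. 0 \<le> w x" "T \<in> sets lebesgue" "T \<subseteq> S"
  shows "wint w T \<le> wint w S"
proof -
  have "set_integrable lebesgue T w" using assms by (intro set_integrable_subset[OF assms(1)])
  then show ?thesis
    using assms unfolding wint_def set_lebesgue_integral_def set_integrable_def
    by (intro integral_mono) (auto simp: indicator_def)
qed

lemma wint_nonneg: "(\<And>x. 0 \<le> w x) \<Longrightarrow> 0 \<le> wint w S"
  unfolding wint_def set_lebesgue_integral_def by simp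

text \<open>Turns a loss factor 1 - x, raised to the power s, back into a linear loss. For s < 1
  this is Bernoulli's inequality with exponent 1/s.\<close>

lemma powr_one_minus_le:
  fixes x s :: real
  assumes "0 < s" "0 \<le> x" "x \<le> 1"
  shows "(1 - x) powr s \<le> 1 - min 1 s * x"
proof (cases "1 \<le> s")
  case True
  have "(1 - x) powr s \<le> (1 - x) powr 1"
    using assms True by (intro powr_mono') auto
  then show ?thesis using True assms by simp
next
  case False
  have "1 - ((1 - x) powr s) powr (1 / s) \<le> 1 / s * (1 - (1 - x) powr s)"
    by (rule bernoulli_powr) (use assms False in auto)
  then show ?thesis using assms False by (simp add: powr_powr field_simps)
qed

text \<open>In the application \<open>v = \<omega>\<^bsup>-r1\<^esup>\<close> and \<open>u = \<omega>\<^bsup>r2\<^esup>\<close>, and \<open>K\<close> is the product of the two weight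
  constants.\<close>
locale weight_pair =
  fixes b :: "'n::finite set" and v u :: "real^'n \<Rightarrow> real" and r1 r2 K :: real
  assumes r: "0 < r1" "0 < r2"
    and v_int: "\<And>k m. set_integrable lebesgue (cell b k m) v"
    and u_int: "\<And>k m. set_integrable lebesgue (cell b k m) u"
    and v_nonneg: "\<And>x. 0 \<le> v x" and u_nonneg: "\<And>x. 0 \<le> u x"
    and vu: "AE x in lebesgue. v x powr (1 / r1) * u x powr (1 / r2) = 1"
    and K: "\<And>k m. (wint v (cell b k m) / vol (cell b k m)) powr (1 / r1)
      * (wint u (cell b k m) / vol (cell b k m)) powr (1 / r2) \<le> K"
begin

lemma swap: "weight_pair b u v r2 r1 K"
  using r v_int u_int v_nonneg u_nonneg vu K by unfold_locales (simp_all add: mult.commute)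

text \<open>The two-weight characteristic of a single cell, whose supremum K bounds. It is unrelated
  to the homogeneity of the semigroup that bears the same letter.\<close>

definition \<kappa> :: "(real^'n) set \<Rightarrow> real" where
  "\<kappa> Q = (wint v Q / vol Q) powr (1 / r1) * (wint u Q / vol Q) powr (1 / r2)"

text \<open>Chosen so that the h-th power of v^(1/r1) u^(1/r2) = 1 has exponents h/r1 and h/r2
  adding up to one, as Hoelder's inequality wants them.\<close>

definition h where "h = 1 / (1 / r1 + 1 / r2)"

lemma h: "0 < h" "h / r1 + h / r2 = 1" "0 < h / r1" "h / r1 < 1" "1 - h / r1 = h / r2"
proof -
  show "0 < h" using r by (simp add: h_def add_pos_pos)
  have "0 < 1 / r1 + 1 / r2" using r by (simp add: add_pos_pos)
  moreover have "h / r1 + h / r2 = h * (1 / r1 + 1 / r2)" by (simp add: distrib_left)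
  ultimately show *: "h / r1 + h / r2 = 1" by (simp add: h_def)
  show "0 < h / r1" using \<open>0 < h\<close> r by simp
  moreover have "0 < h / r2" using \<open>0 < h\<close> r by simp
  ultimately show "h / r1 < 1" "1 - h / r1 = h / r2" using * by linarith+
qed

text \<open>The weights multiply to one at these exponents, so Hoelder compares volume with both
  weights.\<close>
lemma vol_le_wint:
  assumes "E \<in> sets lebesgue" "E \<subseteq> cell b k m"
  shows "vol E \<le> wint v E powr (h / r1) * wint u E powr (h / r2)"
proof -
  let ?f = "\<lambda>x. indicator E x * v x" and ?g = "\<lambda>x. indicator E x * u x"
  have f: "integrable lebesgue ?f"
    using set_integrable_subset[OF v_int assms] by (simp add: set_integrable_def)
  have g: "integrable lebesgue ?g"
    using set_integrable_subset[OF u_int assms] by (simp add: set_integrable_def)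
  have "(\<integral>x. indicator E x \<partial>lebesgue) = (\<integral>x. ?f x powr (h / r1) * ?g x powr (1 - h / r1) \<partial>lebesgue)"
  proof (rule integral_cong_AE)
    show "AE x in lebesgue. indicator E x = ?f x powr (h / r1) * ?g x powr (1 - h / r1)"
      using vu
    proof eventually_elim
      case (elim x)
      have "v x powr (h / r1) * u x powr (h / r2) = (v x powr (1 / r1) * u x powr (1 / r2)) powr h"
        using v_nonneg u_nonneg by (simp add: powr_mult powr_powr)
      then show ?case using elim by (simp add: h(5) indicator_def)
    qed
  qed (use borel_measurable_integrable[OF f] borel_measurable_integrable[OF g] assms(1) in measurable)
  also have "\<dots> \<le> (\<integral>x. ?f x \<partial>lebesgue) powr (h / r1) * (\<integral>x. ?g x \<partial>lebesgue) powr (1 - h / r1)"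
    by (rule holder_powr) (use f g h v_nonneg u_nonneg in auto)
  also have "(\<integral>x. indicator E x \<partial>lebesgue) = vol E"
    using assms(1) by simp
  finally show ?thesis by (simp add: h(5) wint_def set_lebesgue_integral_def)
qed

lemma wint_pos: "0 < wint v (cell b k m)" "0 < wint u (cell b k m)"
proof -
  have "0 < wint v (cell b k m) powr (h / r1) * wint u (cell b k m) powr (h / r2)"
    using vol_le_wint[of "cell b k m" k m] vol_cell_pos[of b k m] by simp
  then have "wint v (cell b k m) \<noteq> 0" "wint u (cell b k m) \<noteq> 0" by auto
  then show "0 < wint v (cell b k m)" "0 < wint u (cell b k m)"
    using wint_nonneg[of v "cell b k m"] wint_nonneg[of u "cell b k m"] v_nonneg u_nonneg by auto
qed

text \<open>Identifies the h-th power of the characteristic as the deficit in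
  \<open>vol_le_wint\<close> on the whole cell. A bound by K thus reverses that Hoelder
  inequality.\<close>

lemma \<kappa>_powr: "\<kappa> (cell b k m) powr h * vol (cell b k m)
    = wint v (cell b k m) powr (h / r1) * wint u (cell b k m) powr (h / r2)"
proof -
  let ?Q = "cell b k m"
  have "vol ?Q powr (h / r1) * vol ?Q powr (h / r2) = vol ?Q"
    using vol_cell_pos[of b k m] h(2) by (simp flip: powr_add)
  then show ?thesis
    using wint_pos[of k m] vol_cell_pos[of b k m]
    by (simp add: \<kappa>_def powr_mult powr_powr powr_divide field_simps)
qed

lemma \<kappa>_le: "\<kappa> (cell b k m) \<le> K"
  using K by (simp add: \<kappa>_def)

lemma \<kappa>_ge_1: "1 \<le> \<kappa> (cell b k m)"
proof -
  have "vol (cell b k m) \<le> \<kappa> (cell b k m) powr h * vol (cell b k m)"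
    unfolding \<kappa>_powr by (rule vol_le_wint) auto
  then have "1 \<le> \<kappa> (cell b k m) powr h" using vol_cell_pos[of b k m] by simp
  moreover have "0 \<le> \<kappa> (cell b k m)" by (simp add: \<kappa>_def)
  ultimately show ?thesis using h(1)
    by (metis linorder_not_less powr_less_mono2 powr_one_eq_one)
qed

lemma K_ge_1: "1 \<le> K"
  using \<kappa>_ge_1 \<kappa>_le order_trans by blast

text \<open>From |R| <= (3/2) |E|, where E is R without a child, raised to the power r1/h = 1 +
  r1/r2; the deficit K^h becomes K^r1 in the same way.\<close>

definition gap :: real where
  "gap = 1 / ((3 / 2) powr (1 + r1 / r2) * K powr r1)"

lemma gap_pos: "0 < gap"
  using K_ge_1 by (simp add: gap_def)

text \<open>The rest E of the cell R after a child is removed keeps two thirds of the volume.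
  Hoelder on E bounds this volume by the v-mass of E and the u-mass of R; the reversed Hoelder
  inequality on R then cancels the u-mass and leaves a lower bound for the v-mass of E.\<close>

lemma wint_child_le:
  assumes "c \<in> children b k m"
  shows "gap \<le> 1" "wint v c \<le> (1 - gap) * wint v (cell b k m)"
proof -
  let ?R = "cell b k m"
  let ?E = "?R - c"
  have c: "c \<in> sets lebesgue" "c \<subseteq> ?R" using assms child_sets child_subset by blast+
  then have E: "?E \<in> sets lebesgue" "?E \<subseteq> ?R" by auto
  have "vol ?E = vol ?R - vol c"
    using c emeasure_cell[of b k m] by (intro measure_Diff) (auto simp del: emeasure_completion)
  then have "vol ?R \<le> 3 / 2 * vol ?E" using vol_child_le[OF assms] by simp
  also have "\<dots> \<le> 3 / 2 * (wint v ?E powr (h / r1) * wint u ?E powr (h / r2))"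
    using vol_le_wint[OF E] by simp
  also have "\<dots> \<le> 3 / 2 * (wint v ?E powr (h / r1) * wint u ?R powr (h / r2))"
    using h(3-5) E u_int wint_nonneg[of u ?E] u_nonneg
    by (intro mult_left_mono powr_mono2 wint_mono) auto
  finally have *: "vol ?R \<le> 3 / 2 * (wint v ?E powr (h / r1) * wint u ?R powr (h / r2))" .
  have vE: "0 \<le> wint v ?E" by (rule wint_nonneg) (rule v_nonneg)
  have "wint v ?R powr (h / r1) * wint u ?R powr (h / r2) = \<kappa> ?R powr h * vol ?R"
    by (simp add: \<kappa>_powr)
  also have "\<dots> \<le> K powr h * (3 / 2 * (wint v ?E powr (h / r1) * wint u ?R powr (h / r2)))"
    using * \<kappa>_le[of k m] h(1) by (intro mult_mono powr_mono2) (auto simp: \<kappa>_def)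
  finally have "wint v ?R powr (h / r1) \<le> 3 / 2 * K powr h * wint v ?E powr (h / r1)"
    using wint_pos(2)[of k m] by simp
  then have "(wint v ?R powr (h / r1)) powr (r1 / h) \<le> (3 / 2 * K powr h
      * wint v ?E powr (h / r1)) powr (r1 / h)"
    using r h(1) by (intro powr_mono2) auto
  also have "\<dots> = (3 / 2) powr (r1 / h) * K powr r1 * wint v ?E"
    unfolding powr_mult powr_powr using vE r h(1) K_ge_1 by simp
  also have "(wint v ?R powr (h / r1)) powr (r1 / h) = wint v ?R"
    using wint_pos[of k m] r h(1) by (simp add: powr_powr)
  also have "r1 / h = 1 + r1 / r2" using r by (simp add: h_def field_simps)
  finally have "gap * wint v ?R \<le> wint v ?E"
    using K_ge_1 by (simp add: gap_def field_simps)
  moreover have "wint v ?E \<le> wint v ?R" using E v_int v_nonneg by (intro wint_mono) auto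
  ultimately have "gap * wint v ?R \<le> 1 * wint v ?R" by simp
  then show "gap \<le> 1" using wint_pos(1)[of k m] by (subst (asm) mult_le_cancel_right_pos) auto
  have "wint v ?R = wint v ?E + wint v c"
  proof -
    have "?R = ?E \<union> c" using c by auto
    then have "wint v ?R = wint v (?E \<union> c)" by simp
    also have "\<dots> = wint v ?E + wint v c"
      unfolding wint_def
      by (rule set_integral_Un) (use E c v_int[of k m] set_integrable_subset in blast)+
    finally show ?thesis .
  qed
  with \<open>gap * wint v ?R \<le> wint v ?E\<close> show "wint v c \<le> (1 - gap) * wint v ?R"
    by (simp add: algebra_simps)
qed

lemma grid_wint:
  assumes "Q \<in> grid b"
  shows "0 < wint v Q" "0 < wint u Q" "0 < vol Q" "Q \<in> sets lebesgue" "set_integrable lebesgue Q v"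
    "set_integrable lebesgue Q u" "1 \<le> \<kappa> Q" "\<kappa> Q \<le> K" "Q \<noteq> {}"
proof -
  obtain k m where Q: "Q = cell b k m" using assms by (auto simp: grid_def)
  show "0 < wint v Q" "0 < wint u Q" "0 < vol Q" "Q \<in> sets lebesgue" "set_integrable lebesgue Q v"
    "set_integrable lebesgue Q u" "1 \<le> \<kappa> Q" "\<kappa> Q \<le> K" "Q \<noteq> {}"
    unfolding Q by (rule wint_pos vol_cell_pos cell_sets v_int u_int \<kappa>_ge_1 \<kappa>_le cell_nonempty)+
qed

text \<open>The power 1 + s > 1 is what makes the loss count: masses of children only add up to the
  mass of the parent, but the extra power s gains (1 - gap)^s in each generation. Summing the series
  costs 1/(min 1 s * gap), hence K^r1.\<close>

lemma packing:
  assumes s: "0 < s" and \<Q>: "finite \<Q>" "\<Q> \<subseteq> grid b" and P: "P \<in> grid b" "\<And>Q. Q \<in> \<Q> \<Longrightarrow> Q \<subseteq> P"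
  shows "(\<Sum>Q\<in>\<Q>. wint v Q powr (1 + s))
    \<le> ((3 / 2) powr (1 + r1 / r2) / min 1 s * K powr r1) * wint v P powr (1 + s)"
proof -
  obtain k m where Pkm: "P = cell b k m" using P by (auto simp: grid_def)
  obtain c0 where "c0 \<in> children b k m" using Union_children[of b k m] cell_nonempty[of b k m] by auto
  then have gap1: "gap \<le> 1" by (rule wint_child_le)
  let ?\<rho> = "(1 - gap) powr s"
  have \<rho>: "?\<rho> \<le> 1 - min 1 s * gap" using s gap_pos gap1 by (intro powr_one_minus_le) auto
  have pos: "0 < min 1 s * gap" using s gap_pos by simp
  have "(\<Sum>Q\<in>\<Q>. wint v Q powr (1 + s)) \<le> wint v (cell b k m) powr (1 + s) / (1 - ?\<rho>)"
  proof (rule grid_packing)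
    fix k m
    let ?R = "cell b k m"
    have "(\<Sum>c\<in>children b k m. wint v c powr (1 + s)) \<le> (\<Sum>c\<in>children b k m. ?\<rho> * wint v ?R powr s
        * wint v c)"
    proof (rule sum_mono)
      fix c assume c: "c \<in> children b k m"
      have c0: "0 < wint v c" using c wint_pos by (auto simp: children_def)
      have "wint v c powr (1 + s) = wint v c powr s * wint v c" using c0 by (simp add: powr_add)
      also have "\<dots> \<le> ((1 - gap) * wint v ?R) powr s * wint v c"
        using wint_child_le(2)[OF c] c0 s by (intro mult_right_mono powr_mono2) auto
      also have "\<dots> = ?\<rho> * wint v ?R powr s * wint v c"
        using gap1 wint_pos(1)[of k m] by (subst powr_mult) auto
      finally show "wint v c powr (1 + s) \<le> ?\<rho> * wint v ?R powr s * wint v c" .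
    qed
    also have "\<dots> = ?\<rho> * wint v ?R powr s * wint v ?R"
      by (simp add: sum_children_wint[OF v_int] flip: sum_distrib_left)
    also have "\<dots> = ?\<rho> * wint v ?R powr (1 + s)"
      using wint_pos(1)[of k m] by (simp add: powr_add)
    finally show "(\<Sum>c\<in>children b k m. wint v c powr (1 + s)) \<le> ?\<rho> * wint v ?R powr (1 + s)" .
  qed (use \<rho> pos \<Q> P Pkm in auto)
  also have "\<dots> \<le> wint v (cell b k m) powr (1 + s) / (min 1 s * gap)"
    using \<rho> pos by (intro divide_left_mono) (auto intro!: mult_pos_pos[OF pos])
  also have "\<dots> = ((3 / 2) powr (1 + r1 / r2) / min 1 s * K powr r1) * wint v P powr (1 + s)"
    using K_ge_1 by (simp add: gap_def Pkm)
  finally show ?thesis .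
qed

text \<open>As \<open>\<kappa>\<close> is almost constant on \<open>\<Q>\<close>, a factor \<open>\<kappa>\<^bsup>-\<delta>\<^esup>\<close> can be inserted; it contributes a
  positive power of the volume, which makes the sum over the generations geometric.\<close>
lemma sum_\<kappa>_below:
  assumes pq: "0 < p" "0 < q'" "1 / p + 1 / q' = 1 + \<eta>" "0 < \<eta>"
    and \<delta>: "\<delta> = min (\<eta> * h) (min (r1 / p) (r2 / q'))"
    and \<Q>: "finite \<Q>" "\<Q> \<subseteq> grid b" and \<nu>: "\<And>Q. Q \<in> \<Q> \<Longrightarrow> \<nu> / 2 < \<kappa> Q" "\<And>Q. Q \<in> \<Q> \<Longrightarrow> \<kappa> Q \<le> \<nu>"
    and R: "R \<in> \<Q>"
  shows "(\<Sum>Q\<in>{Q\<in>\<Q>. Q \<subseteq> R}. \<kappa> Q * (wint v Q powr (1 / p) * wint u Q powr (1 / q')))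
      \<le> 2 powr \<delta> / (1 - 3 powr (- (\<delta> / h))) * \<nu> * (wint v R powr (1 / p) * wint u R powr (1 / q'))"
proof -
  \<comment> \<open>Exponents of volume, v-mass and u-mass once the power -\<delta> of the
    characteristic is inserted. The three entries of the minimum \<delta> secure x <= \<eta>, 0 <= y
    and 0 <= z; the first gives y + z = 1 + \<eta> - x >= 1.\<close>
  define x where "x = \<delta> / h"
  define y where "y = 1 / p - \<delta> / r1"
  define z where "z = 1 / q' - \<delta> / r2"
  have \<delta>0: "0 < \<delta>" "\<delta> \<le> \<eta> * h" "\<delta> \<le> r1 / p" "\<delta> \<le> r2 / q'"
    unfolding \<delta> using pq h(1) r by auto
  have x0: "0 < x" using \<delta>0 h(1) by (simp add: x_def)
  have "x \<le> \<eta>" using \<delta>0 h(1) by (simp add: x_def field_simps)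
  moreover have "x = \<delta> / r1 + \<delta> / r2" using r by (simp add: x_def h_def field_simps)
  ultimately have yz: "1 \<le> y + z" unfolding y_def z_def using pq by linarith
  have yz0: "0 \<le> y" "0 \<le> z"
    unfolding y_def z_def using \<delta>0 r pq by (simp_all add: field_simps)
  have xe: "x = \<delta> / r1 + \<delta> / r2" using r by (simp add: x_def h_def field_simps)
  have lam0: "0 < \<nu>" using \<nu>(2)[OF R] grid_wint(7)[of R] R \<Q> by force
  define \<mu> where "\<mu> Q = vol Q powr x * wint v Q powr y * wint u Q powr z" for Q
  have \<mu>: "\<mu> Q = \<kappa> Q powr (- \<delta>) * (wint v Q powr (1 / p) * wint u Q powr (1 / q'))" if "Q \<in> grid b" for Q
  proof -
    note g = grid_wint[OF that]
    have "\<kappa> Q powr (- \<delta>) = (wint v Q / vol Q) powr (- \<delta> / r1) * (wint u Q / vol Q) powr (- \<delta> / r2)"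
      using g by (simp add: \<kappa>_def powr_mult powr_powr)
    also have "\<dots> = wint v Q powr (- \<delta> / r1) * wint u Q powr (- \<delta> / r2) * vol Q powr x"
      using g unfolding xe powr_add by (simp add: powr_divide powr_minus field_simps)
    finally show ?thesis
      using g unfolding \<mu>_def y_def z_def by (simp add: powr_diff powr_minus field_simps)
  qed
  have sum_\<mu>: "(\<Sum>Q\<in>{Q\<in>\<Q>. Q \<subseteq> R}. \<mu> Q) \<le> \<mu> R / (1 - 3 powr (- x))"
  proof -
    obtain k m where Rkm: "R = cell b k m" using R \<Q> by (auto simp: grid_def)
    show ?thesis unfolding Rkm
    proof (rule grid_packing)
      fix k m
      let ?R = "cell b k m"
      \<comment> \<open>Normalised exponents a <= y and 1 - a <= z. The mass ratios of a child are
        at most one, so lowering the exponents is allowed, and Young's inequality makes the product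
        a convex combination that sums to one over the children. The volume contributes the decay
        3^(-x).\<close>
      define a where "a = y / (y + z)"
      have a: "0 \<le> a" "a \<le> y" "0 \<le> 1 - a" "1 - a \<le> z"
      proof -
        have "1 - a = z / (y + z)" using yz by (simp add: a_def field_simps)
        then show "0 \<le> a" "a \<le> y" "0 \<le> 1 - a" "1 - a \<le> z"
          using yz yz0 mult_left_mono[OF yz yz0(1)] mult_left_mono[OF yz yz0(2)]
          by (auto simp: a_def divide_le_eq)
      qed
      have "(\<Sum>c\<in>children b k m. \<mu> c) \<le> (\<Sum>c\<in>children b k m. 3 powr (- x) * \<mu> ?R *
          (a * (wint v c / wint v ?R) + (1 - a) * (wint u c / wint u ?R)))"
      proof (rule sum_mono)
        fix c assume c: "c \<in> children b k m"
        then have "c \<in> grid b" by (auto simp: children_def grid_def)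
        note g = grid_wint[OF this]
        let ?s = "wint v c / wint v ?R" and ?t = "wint u c / wint u ?R"
        have R0: "0 < wint v ?R" "0 < wint u ?R" using wint_pos by auto
        have st: "0 < ?s" "?s \<le> 1" "0 < ?t" "?t \<le> 1"
          using R0 g wint_mono[OF v_int v_nonneg child_sets[OF c] child_subset[OF c]]
            wint_mono[OF u_int u_nonneg child_sets[OF c] child_subset[OF c]]
          by auto
        have "?s powr y * ?t powr z \<le> ?s powr a * ?t powr (1 - a)"
          using st a by (intro mult_mono powr_mono') auto
        also have "\<dots> \<le> a * ?s + (1 - a) * ?t"
          using st a by (intro Youngs_inequality_0) auto
        finally have *: "?s powr y * ?t powr z \<le> a * ?s + (1 - a) * ?t" .
        have vol_c: "vol c powr x \<le> 3 powr (- x) * vol ?R powr x"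
        proof -
          have "vol c powr x \<le> (vol ?R / 3) powr x"
            using vol_child_le[OF c] x0 g by (intro powr_mono2) auto
          then show ?thesis using vol_cell_pos[of b k m] by (simp add: powr_divide powr_minus field_simps)
        qed
        have "\<mu> c = vol c powr x * (?s powr y * ?t powr z) * (wint v ?R powr y * wint u ?R powr z)"
          using R0 g by (simp add: \<mu>_def powr_divide)
        also have "\<dots> \<le> (3 powr (- x) * vol ?R powr x) * (a * ?s + (1 - a) * ?t) * (wint v ?R powr y
            * wint u ?R powr z)"
          using vol_c * by (intro mult_right_mono mult_mono) auto
        also have "\<dots> = 3 powr (- x) * \<mu> ?R * (a * ?s + (1 - a) * ?t)"
          by (simp add: \<mu>_def mult_ac)
        finally show "\<mu> c \<le> 3 powr (- x) * \<mu> ?R * (a * ?s + (1 - a) * ?t)" .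
      qed
      also have "\<dots> = 3 powr (- x) * \<mu> ?R *
          (a * ((\<Sum>c\<in>children b k m. wint v c) / wint v ?R) + (1 - a)
              * ((\<Sum>c\<in>children b k m. wint u c) / wint u ?R))"
        unfolding sum_distrib_left[symmetric] sum.distrib sum_divide_distrib ..
      also have "\<dots> = 3 powr (- x) * \<mu> ?R"
        using wint_pos[of k m] by (simp add: sum_children_wint[OF v_int] sum_children_wint[OF u_int])
      finally show "(\<Sum>c\<in>children b k m. \<mu> c) \<le> 3 powr (- x) * \<mu> ?R" .
    next
      show "3 powr (- x) < 1" using x0 powr_less_mono[of "-x" 0 3] by simp
    qed (use \<Q> Rkm in \<open>auto simp: \<mu>_def\<close>)
  qed
  have "(\<Sum>Q\<in>{Q\<in>\<Q>. Q \<subseteq> R}. \<kappa> Q * (wint v Q powr (1 / p) * wint u Q powr (1 / q')))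
      \<le> (\<Sum>Q\<in>{Q\<in>\<Q>. Q \<subseteq> R}. \<nu> powr (1 + \<delta>) * \<mu> Q)"
  proof (rule sum_mono)
    fix Q assume "Q \<in> {Q\<in>\<Q>. Q \<subseteq> R}"
    then have Q: "Q \<in> \<Q>" "Q \<in> grid b" using \<Q> by auto
    note g = grid_wint[OF Q(2)]
    have "\<kappa> Q = \<kappa> Q powr (1 + \<delta>) * \<kappa> Q powr (- \<delta>)"
      using g by (simp flip: powr_add)
    also have "\<dots> \<le> \<nu> powr (1 + \<delta>) * \<kappa> Q powr (- \<delta>)"
      using g \<nu>(2)[OF Q(1)] \<delta>0 by (intro mult_right_mono powr_mono2) auto
    finally have "\<kappa> Q * (wint v Q powr (1 / p) * wint u Q powr (1 / q'))
      \<le> (\<nu> powr (1 + \<delta>) * \<kappa> Q powr (- \<delta>)) * (wint v Q powr (1 / p) * wint u Q powr (1 / q'))"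
      by (intro mult_right_mono) auto
    then show "\<kappa> Q * (wint v Q powr (1 / p) * wint u Q powr (1 / q')) \<le> \<nu> powr (1 + \<delta>) * \<mu> Q"
      unfolding \<mu>[OF Q(2)] by (simp add: mult_ac)
  qed
  also have "\<dots> = \<nu> powr (1 + \<delta>) * (\<Sum>Q\<in>{Q\<in>\<Q>. Q \<subseteq> R}. \<mu> Q)" by (simp add: sum_distrib_left)
  also have "\<dots> \<le> \<nu> powr (1 + \<delta>) * (\<mu> R / (1 - 3 powr (- x)))"
    by (intro mult_left_mono sum_\<mu>) auto
  also have "\<dots>
      \<le> \<nu> powr (1 + \<delta>) * (((\<nu> / 2) powr (- \<delta>) * (wint v R powr (1 / p)
          * wint u R powr (1 / q'))) / (1 - 3 powr (- x)))"
  proof (intro mult_left_mono divide_right_mono)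
    have RG: "R \<in> grid b" using R \<Q> by auto
    \<comment> \<open>Here the lower bound \<nu>/2 of the class enters: removing the inserted power
      at R costs 2^\<delta> instead of a power of K.\<close>
    have "\<kappa> R powr (- \<delta>) \<le> (\<nu> / 2) powr (- \<delta>)"
      using \<nu>(1)[OF R] lam0 \<delta>0 by (intro powr_mono2') auto
    then show "\<mu> R \<le> (\<nu> / 2) powr (- \<delta>) * (wint v R powr (1 / p) * wint u R powr (1 / q'))"
      unfolding \<mu>[OF RG] by (intro mult_right_mono) auto
    show "0 \<le> 1 - 3 powr (- x)" using x0 powr_less_mono[of "-x" 0 3] by simp
  qed auto
  also have "\<dots> = 2 powr \<delta> / (1 - 3 powr (- x)) * \<nu> * (wint v R powr (1 / p) * wint u R powr (1 / q'))"
  proof -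
    have e: "\<nu> powr (1 + \<delta>) * (\<nu> / 2) powr (- \<delta>) = 2 powr \<delta> * \<nu>"
      using lam0 by (simp add: powr_divide powr_minus powr_add field_simps)
    show ?thesis by (simp flip: e)
  qed
  finally show ?thesis by (simp add: x_def)
qed

end

section \<open>The bilinear form on one grid\<close>

text \<open>A single class of cells. The constants are spelled out as hypotheses to make visible
  that they depend on exponents only, so that one constant serves all classes, weights and
  functions.\<close>

lemma (in weight_pair) bilinear_class:
  assumes pq: "0 < p0" "p0 < p" "1 < p" "p < q" "1 / p + 1 / p' = 1" "1 / q + 1 / q' = 1"
      "0 < s0" "1 / p0 = 1 / p + 1 / r1" "1 / s0 = 1 / q' + 1 / r2"
    and F: "integrable lebesgue F" "\<And>x. 0 \<le> F x" "integrable lebesgue wF" "\<And>x. 0 \<le> wF x"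
      "AE x in lebesgue. F x = wF x powr (p0 / p) * v x powr (1 - p0 / p)"
    and H: "integrable lebesgue H" "\<And>x. 0 \<le> H x" "integrable lebesgue wH" "\<And>x. 0 \<le> wH x"
      "AE x in lebesgue. H x = wH x powr (s0 / q') * u x powr (1 - s0 / q')"
    and \<Q>: "finite \<Q>" "\<Q> \<subseteq> grid b" and \<nu>: "0 < \<nu>" "\<And>Q. Q \<in> \<Q> \<Longrightarrow> \<nu> / 2 < \<kappa> Q" "\<And>Q. Q \<in> \<Q> \<Longrightarrow> \<kappa> Q \<le> \<nu>"
    and \<delta>: "\<delta> = min ((1 / p - 1 / q) * h) (min (r1 / p) (r2 / q'))"
    and e: "eT = 2 powr \<delta> / (1 - 3 powr (- (\<delta> / h)))"
      "eV = ((3 / 2) powr (1 + r1 / r2) / min 1 (q / p - 1) * (q / p)) powr (1 / q)"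
      "eU = ((3 / 2) powr (1 + r2 / r1) / min 1 (p' / q' - 1) * (p' / q')) powr (1 / p')"
      "eN = (p / (p - p0)) powr (1 / p0) * (q' / (q' - s0)) powr (1 / s0)"
  shows "(\<Sum>Q\<in>\<Q>. vol Q powr (1 / p + 1 / q') * ((wint F Q / vol Q) powr (1 / p0)
      * (wint H Q / vol Q) powr (1 / s0)))
    \<le> \<nu> * (eT * (eV + eU) * eN * K powr (max (r1 / q) (r2 / p'))
        * ((\<integral>x. wF x \<partial>lebesgue) powr (1 / p) * (\<integral>x. wH x \<partial>lebesgue) powr (1 / q')))"
proof -
  let ?V = "wint v" and ?U = "wint u"
  \<comment> \<open>Averages of F/v relative to v, and of H/u relative to u, replace the Lebesgue
    averages: their maximal functions are bounded in L^p(v) and L^q'(u) with constants free of the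
    weights.\<close>
  define A where "A Q = (wint F Q / ?V Q) powr (1 / p0)" for Q
  define B where "B Q = (wint H Q / ?U Q) powr (1 / s0)" for Q
  define \<tau> where "\<tau> Q = \<kappa> Q * (?V Q powr (1 / p) * ?U Q powr (1 / q'))" for Q
  define NA where "NA = (p / (p - p0)) powr (p / p0) * (\<integral>x. wF x \<partial>lebesgue)"
  define NB where "NB = (q' / (q' - s0)) powr (q' / s0) * (\<integral>x. wH x \<partial>lebesgue)"
  define Dv where "Dv = (3 / 2) powr (1 + r1 / r2) / min 1 (q / p - 1) * K powr r1"
  define Du where "Du = (3 / 2) powr (1 + r2 / r1) / min 1 (p' / q' - 1) * K powr r2"
  have p': "1 < p'" "1 < q'" "q' < p'"
    using conjugate_gt_1[of p p'] conjugate_gt_1[of q q'] conjugate_less[of p q p' q'] pq by auto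
  have ratio: "0 < q / p - 1" "0 < p' / q' - 1" using pq(1-4) p' by simp_all
  have s0: "s0 < q'"
  proof -
    have "1 / q' < 1 / s0" using pq r by simp
    moreover have "1 / s0 \<le> 1 / q'" if "q' \<le> s0" using that p' by (intro divide_left_mono) auto
    ultimately show ?thesis by (meson not_le)
  qed
  note lam = laminar_grid[OF \<Q>]
  note g = grid_wint[OF subsetD[OF \<Q>(2)]]
  have F0: "0 \<le> wint F Q" "0 \<le> wint H Q" for Q using wint_nonneg F(2) H(2) by blast+
  have \<delta>0: "0 < \<delta>" unfolding \<delta> using pq r h(1) p' by (auto simp: field_simps)
  have eT0: "0 \<le> eT"
    unfolding e using \<delta>0 h(1) powr_less_mono[of "- (\<delta> / h)" 0 3] by auto
  have K0: "0 \<le> K powr r1" "0 \<le> K powr r2" by auto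
  have mono: "?V R \<le> ?V P" "?U R \<le> ?U P" if "P \<in> \<Q>" "R \<in> \<Q>" "R \<subseteq> P" for P R
    using g[OF that(1)] g[OF that(2)] that v_nonneg u_nonneg by (auto intro!: wint_mono)
  have NA: "(\<Sum>R\<in>\<Q>. jump \<Q> (\<lambda>C. Max0 A C powr p) R * ?V R) \<le> NA"
    unfolding NA_def
  proof (rule doob_laminar[OF lam])
    show "A R powr p0 * ?V R = (LINT x:R|lebesgue. F x)" if "R \<in> \<Q>" for R
      using g(1)[OF that] F0[of R] pq(1) by (simp add: A_def powr_powr wint_def)
  qed (use g F v_nonneg pq wint_def in auto)
  have NB: "(\<Sum>R\<in>\<Q>. jump \<Q> (\<lambda>C. Max0 B C powr q') R * ?U R) \<le> NB"
    unfolding NB_def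
  proof (rule doob_laminar[OF lam])
    show "B R powr s0 * ?U R = (LINT x:R|lebesgue. H x)" if "R \<in> \<Q>" for R
      using g(2)[OF that] F0[of R] pq(7) by (simp add: B_def powr_powr wint_def)
  qed (use g H u_nonneg pq s0 wint_def in auto)
  \<comment> \<open>The change of measure. All powers of v-mass, u-mass and volume match because
    1/p0 = 1/p + 1/r1 and 1/s0 = 1/q' + 1/r2; what remains is the characteristic in \<tau>.\<close>
  have "vol Q powr (1 / p + 1 / q') * ((wint F Q / vol Q) powr (1 / p0)
      * (wint H Q / vol Q) powr (1 / s0)) = \<tau> Q * A Q * B Q"
    if Q: "Q \<in> \<Q>" for Q
  proof -
    note gQ = g(1,2,3)[OF Q]
    have "\<tau> Q * A Q * B Q = (?V Q powr (1 / p + 1 / r1) / ?V Q powr (1 / p0)) * (?U Q powr (1 / q'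
        + 1 / r2) / ?U Q powr (1 / s0))
        * (wint F Q powr (1 / p0) * wint H Q powr (1 / s0)) / (vol Q powr (1 / r1) * vol Q powr (1 / r2))"
      using gQ F0 unfolding \<tau>_def \<kappa>_def A_def B_def powr_add by (simp add: powr_divide mult_ac)
    also have "\<dots> = (wint F Q powr (1 / p0) * wint H Q powr (1 / s0)) / (vol Q powr (1 / r1)
        * vol Q powr (1 / r2))"
      using gQ by (simp flip: pq(8,9))
    also have "vol Q powr (1 / r1) = vol Q powr (1 / p0) / vol Q powr (1 / p)"
      using gQ by (simp add: pq(8) powr_add)
    also have "vol Q powr (1 / r2) = vol Q powr (1 / s0) / vol Q powr (1 / q')"
      using gQ by (simp add: pq(9) powr_add)
    finally show ?thesis using gQ F0 by (simp add: powr_divide powr_add)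
  qed
  then have "(\<Sum>Q\<in>\<Q>. vol Q powr (1 / p + 1 / q') * ((wint F Q / vol Q) powr (1 / p0)
      * (wint H Q / vol Q) powr (1 / s0)))
      = (\<Sum>Q\<in>\<Q>. \<tau> Q * A Q * B Q)"
    by (rule sum.cong[OF refl])
  also have "\<dots> \<le> (eT * \<nu>) * (((Dv * (q / p)) powr (1 / q) + (Du * (p' / q')) powr (1 / p'))
      * (NA powr (1 / p) * NB powr (1 / q')))"
  proof (rule bilinear_laminar[OF lam _ mono(1) g(1) mono(2) g(2)])
    show "{} \<notin> \<Q>" using g(9) by auto
    show "0 \<le> \<tau> Q" if "Q \<in> \<Q>" for Q using g(7)[OF that] by (simp add: \<tau>_def)
    show "(\<Sum>Q\<in>{Q\<in>\<Q>. Q \<subseteq> R}. \<tau> Q) \<le> eT * \<nu> * (?V R powr (1 / p) * ?U R powr (1 / q'))" if "R \<in> \<Q>" for R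
      unfolding \<tau>_def e
    proof (rule sum_\<kappa>_below)
      show "1 / p + 1 / q' = 1 + (1 / p - 1 / q)" using pq by simp
      show "0 < 1 / p - 1 / q" using pq by (simp add: field_simps)
    qed (use pq p' \<delta> \<Q> \<nu> that in auto)
    show "(\<Sum>R\<in>{R\<in>\<Q>. R \<subseteq> P}. ?V R powr (q / p)) \<le> Dv * ?V P powr (q / p)" if "P \<in> \<Q>" for P
    proof -
      have "(\<Sum>R\<in>{R\<in>\<Q>. R \<subseteq> P}. ?V R powr (1 + (q / p - 1))) \<le> Dv * ?V P powr (1 + (q / p - 1))"
        unfolding Dv_def using \<Q> that by (intro packing ratio) auto
      then show ?thesis by simp
    qed
    show "(\<Sum>R\<in>{R\<in>\<Q>. R \<subseteq> P}. ?U R powr (p' / q')) \<le> Du * ?U P powr (p' / q')" if "P \<in> \<Q>" for P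
    proof -
      have "(\<Sum>R\<in>{R\<in>\<Q>. R \<subseteq> P}. ?U R powr (1 + (p' / q' - 1))) \<le> Du * ?U P powr (1 + (p' / q' - 1))"
        unfolding Du_def using \<Q> that by (intro weight_pair.packing[OF swap] ratio) auto
      then show ?thesis by simp
    qed
    show "0 \<le> Dv" "0 \<le> Du"
      using pq p' K0 by (auto simp: Dv_def Du_def intro!: mult_nonneg_nonneg divide_nonneg_nonneg)
    show "0 \<le> eT * \<nu>" using eT0 \<nu>(1) by simp
    show "0 \<le> A Q" "0 \<le> B Q" for Q by (simp_all add: A_def B_def)
  qed (use NA NB pq(3-6) in auto)
  also have "\<dots> \<le> (eT * \<nu>) * ((eV * K powr (max (r1 / q) (r2 / p')) + eU * K powr (max (r1 / q) (r2 / p')))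
      * (NA powr (1 / p) * NB powr (1 / q')))"
  proof (intro mult_left_mono mult_right_mono add_mono)
    have "(Dv * (q / p)) powr (1 / q) = eV * K powr (r1 / q)"
      using K_ge_1 pq by (simp add: Dv_def e powr_mult powr_powr powr_divide mult_ac)
    also have "\<dots> \<le> eV * K powr (max (r1 / q) (r2 / p'))"
      using K_ge_1 by (intro mult_left_mono powr_mono) (auto simp: e)
    finally show "(Dv * (q / p)) powr (1 / q) \<le> eV * K powr (max (r1 / q) (r2 / p'))" .
    have "(Du * (p' / q')) powr (1 / p') = eU * K powr (r2 / p')"
      using K_ge_1 p' by (simp add: Du_def e powr_mult powr_powr powr_divide mult_ac)
    also have "\<dots> \<le> eU * K powr (max (r1 / q) (r2 / p'))"
      using K_ge_1 by (intro mult_left_mono powr_mono) (auto simp: e)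
    finally show "(Du * (p' / q')) powr (1 / p') \<le> eU * K powr (max (r1 / q) (r2 / p'))" .
  qed (use eT0 \<nu> in auto)
  also have "NA powr (1 / p) * NB powr (1 / q') = eN * ((\<integral>x. wF x \<partial>lebesgue) powr (1 / p)
      * (\<integral>x. wH x \<partial>lebesgue) powr (1 / q'))"
    using pq p' s0 F H unfolding NA_def NB_def e by (simp add: powr_mult powr_powr)
  finally show ?thesis by (simp add: algebra_simps)
qed

lemma sum_half_power_le:
  assumes "finite I"
  shows "(\<Sum>i\<in>I. (1 / 2 :: real) ^ i) \<le> 2"
proof -
  have "(\<Sum>i\<in>I. (1 / 2 :: real) ^ i) \<le> (\<Sum>i. (1 / 2) ^ i)"
    using assms by (intro sum_le_suminf summable_geometric) auto
  then show ?thesis by (simp add: suminf_geometric)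
qed

text \<open>Sorting the cells by the size of \<open>\<kappa>\<close> keeps the power of \<open>K\<close> sharp: the classes sum
  geometrically.\<close>
lemma bilinear_grid:
  fixes p0 p q p' q' s0 r1 r2 :: real
  assumes pq: "0 < p0" "p0 < p" "1 < p" "p < q" "1 / p + 1 / p' = 1" "1 / q + 1 / q' = 1"
      "0 < s0" "1 / p0 = 1 / p + 1 / r1" "1 / s0 = 1 / q' + 1 / r2"
  shows "\<exists>C\<ge>0. \<forall>(b :: 'n::finite set) v u K F wF H wH \<Q>. weight_pair b v u r1 r2 K \<longrightarrow>
      integrable lebesgue F \<longrightarrow> (\<forall>x. 0 \<le> F x) \<longrightarrow> integrable lebesgue wF \<longrightarrow> (\<forall>x. 0 \<le> wF x) \<longrightarrow>
      (AE x in lebesgue. F x = wF x powr (p0 / p) * v x powr (1 - p0 / p)) \<longrightarrow>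
      integrable lebesgue H \<longrightarrow> (\<forall>x. 0 \<le> H x) \<longrightarrow> integrable lebesgue wH \<longrightarrow> (\<forall>x. 0 \<le> wH x) \<longrightarrow>
      (AE x in lebesgue. H x = wH x powr (s0 / q') * u x powr (1 - s0 / q')) \<longrightarrow>
      finite \<Q> \<longrightarrow> \<Q> \<subseteq> grid b \<longrightarrow>
      (\<Sum>Q\<in>\<Q>. vol Q powr (1 / p + 1 / q') * ((wint F Q / vol Q) powr (1 / p0)
          * (wint H Q / vol Q) powr (1 / s0)))
      \<le> C * (K powr (1 + max (r1 / q) (r2 / p'))
          * ((\<integral>x. wF x \<partial>lebesgue) powr (1 / p) * (\<integral>x. wH x \<partial>lebesgue) powr (1 / q')))"
proof -
  \<comment> \<open>As a locale constant \<open>h\<close> depends on r1 and r2 alone, so the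
    constant C can be fixed before the weights are introduced.\<close>
  define hh where "hh = weight_pair.h r1 r2"
  define \<delta> where "\<delta> = min ((1 / p - 1 / q) * hh) (min (r1 / p) (r2 / q'))"
  define eT where "eT = 2 powr \<delta> / (1 - 3 powr (- (\<delta> / hh)))"
  define eV where "eV = ((3 / 2) powr (1 + r1 / r2) / min 1 (q / p - 1) * (q / p)) powr (1 / q)"
  define eU where "eU = ((3 / 2) powr (1 + r2 / r1) / min 1 (p' / q' - 1) * (p' / q')) powr (1 / p')"
  define eN where "eN = (p / (p - p0)) powr (1 / p0) * (q' / (q' - s0)) powr (1 / s0)"
  define C where "C = 2 * \<bar>eT * (eV + eU) * eN\<bar>"
  show ?thesis
  proof (intro exI[of _ C] conjI allI impI)
    show "0 \<le> C" by (simp add: C_def)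
    fix b :: "'n set" and v u K F wF H wH \<Q>
    assume wp: "weight_pair b v u r1 r2 K" and F: "integrable lebesgue F" "\<forall>x. 0 \<le> F x"
      "integrable lebesgue wF" "\<forall>x. 0 \<le> wF x"
      "AE x in lebesgue. F x = wF x powr (p0 / p) * v x powr (1 - p0 / p)"
      and H: "integrable lebesgue H" "\<forall>x. 0 \<le> H x" "integrable lebesgue wH" "\<forall>x. 0 \<le> wH x"
      "AE x in lebesgue. H x = wH x powr (s0 / q') * u x powr (1 - s0 / q')"
      and \<Q>: "finite \<Q>" "\<Q> \<subseteq> grid b"
    interpret weight_pair b v u r1 r2 K by (rule wp)
    note g = grid_wint[OF subsetD[OF \<Q>(2)]]
    let ?X = "K powr (max (r1 / q) (r2 / p')) * ((\<integral>x. wF x \<partial>lebesgue) powr (1 / p)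
        * (\<integral>x. wH x \<partial>lebesgue) powr (1 / q'))"
    \<comment> \<open>The class index: the characteristic of Q lies in the half-open interval from
      K/2^(i+1) to K/2^i. It is a natural number since the characteristic never exceeds K.\<close>
    define i where "i Q = nat \<lfloor>log 2 (K / \<kappa> Q)\<rfloor>" for Q
    let ?S = "\<lambda>\<Q>. \<Sum>Q\<in>\<Q>. vol Q powr (1 / p + 1 / q') * ((wint F Q / vol Q) powr (1 / p0)
        * (wint H Q / vol Q) powr (1 / s0))"
    have i: "K / 2 ^ i Q / 2 < \<kappa> Q" "\<kappa> Q \<le> K / 2 ^ i Q" if Q: "Q \<in> \<Q>" for Q
    proof -
      have ge: "0 \<le> log 2 (K / \<kappa> Q)" and pos: "0 < K / \<kappa> Q" using g(7,8)[OF Q] by auto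
      have "real (i Q) \<le> log 2 (K / \<kappa> Q)" "log 2 (K / \<kappa> Q) < real (Suc (i Q))"
        using ge unfolding i_def by linarith+
      then have "2 powr real (i Q) \<le> K / \<kappa> Q" "K / \<kappa> Q < 2 powr real (Suc (i Q))"
        using pos by (auto simp: le_log_iff log_less_iff)
      then have "2 ^ i Q \<le> K / \<kappa> Q" "K / \<kappa> Q < 2 ^ Suc (i Q)"
        unfolding powr_realpow[OF zero_less_numeral] by auto
      then show "K / 2 ^ i Q / 2 < \<kappa> Q" "\<kappa> Q \<le> K / 2 ^ i Q" using g(7)[OF Q] by (auto simp: field_simps)
    qed
    have "?S \<Q> = (\<Sum>j\<in>i ` \<Q>. ?S {Q\<in>\<Q>. i Q = j})" by (rule sum.image_gen[OF \<Q>(1)])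
    also have "\<dots> \<le> (\<Sum>j\<in>i ` \<Q>. (1 / 2) ^ j * (K * (C / 2 * ?X)))"
    proof (rule sum_mono)
      fix j
      have "?S {Q\<in>\<Q>. i Q = j} \<le> K / 2 ^ j * (eT * (eV + eU) * eN * K powr (max (r1 / q) (r2 / p'))
          * ((\<integral>x. wF x \<partial>lebesgue) powr (1 / p) * (\<integral>x. wH x \<partial>lebesgue) powr (1 / q')))"
        by (rule bilinear_class[of p0 p q p' q' s0 F wF H wH _ _ \<delta>])
          (use pq F H \<Q> i K_ge_1 in \<open>auto simp: \<delta>_def hh_def eT_def eV_def eU_def eN_def\<close>)
      also have "\<dots> = K / 2 ^ j * (eT * (eV + eU) * eN * ?X)" by (simp add: mult_ac)
      also have "\<dots> \<le> K / 2 ^ j * (C / 2 * ?X)"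
        using K_ge_1 unfolding C_def by (intro mult_left_mono mult_right_mono) auto
      finally show "?S {Q\<in>\<Q>. i Q = j} \<le> (1 / 2) ^ j * (K * (C / 2 * ?X))"
        by (simp add: power_divide)
    qed
    also have "\<dots> = (\<Sum>j\<in>i ` \<Q>. (1 / 2) ^ j) * (K * (C / 2 * ?X))" by (simp add: sum_distrib_right)
    also have "\<dots> \<le> 2 * (K * (C / 2 * ?X))"
      using \<Q>(1) K_ge_1 by (intro mult_right_mono sum_half_power_le) (auto simp: C_def)
    also have "\<dots> = C * (K powr (1 + max (r1 / q) (r2 / p'))
          * ((\<integral>x. wF x \<partial>lebesgue) powr (1 / p) * (\<integral>x. wH x \<partial>lebesgue) powr (1 / q')))"
      using K_ge_1 by (simp add: powr_add)
    finally show "?S \<Q> \<le> C * (K powr (1 + max (r1 / q) (r2 / p'))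
          * ((\<integral>x. wF x \<partial>lebesgue) powr (1 / p) * (\<integral>x. wH x \<partial>lebesgue) powr (1 / q')))" .
  qed
qed

section \<open>Completeness of the Hilbert space\<close>

lemma abs_rep_L2 [simp]: "abs_L2 (rep_L2 F) = F"
  using Quotient3_abs_rep[OF Quotient3_L2] .

lemma square_int_rep [simp]: "square_int (rep_L2 F)"
  using Quotient3_rep_reflp[OF Quotient3_L2] by blast

lemma rep_measurable [measurable]: "rep_L2 F \<in> borel_measurable lebesgue"
  using square_int_rep[of F] by (simp add: square_int_def)

lemma rep_abs_L2: "square_int f \<Longrightarrow> AE x in lebesgue. rep_L2 (abs_L2 f) x = f x"
  using rep_abs_rsp_left[OF Quotient3_L2, of f f] by auto

lemma abs_L2_eqI: "square_int f \<Longrightarrow> square_int g \<Longrightarrow> AE x in lebesgue. f x = g x \<Longrightarrow> abs_L2 f = abs_L2 g"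
  using Quotient3_rel_abs[OF Quotient3_L2, of f g] by auto

lemma L2_eqI: "AE x in lebesgue. rep_L2 F x = rep_L2 G x \<Longrightarrow> F = G"
  using abs_L2_eqI[of "rep_L2 F" "rep_L2 G"] by simp

lemma abs_L2_add: "square_int f \<Longrightarrow> square_int g \<Longrightarrow> abs_L2 f + abs_L2 g = abs_L2 (\<lambda>x. f x + g x)"
  by (simp add: plus_L2.abs_eq)

lemma abs_L2_zero: "abs_L2 (\<lambda>x. 0) = 0"
  by (simp add: zero_L2.abs_eq)

lemma rep_add: "AE x in lebesgue. rep_L2 (F + G) x = rep_L2 F x + rep_L2 G x"
proof -
  have "F + G = abs_L2 (\<lambda>x. rep_L2 F x + rep_L2 G x)"
    using abs_L2_add[of "rep_L2 F" "rep_L2 G"] by simp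
  then show ?thesis using rep_abs_L2[OF square_int_add[OF square_int_rep square_int_rep], of F G] by simp
qed

lemma rep_diff: "AE x in lebesgue. rep_L2 (F - G) x = rep_L2 F x - rep_L2 G x"
proof -
  have "abs_L2 (rep_L2 F) - abs_L2 (rep_L2 G) = abs_L2 (\<lambda>x. rep_L2 F x - rep_L2 G x)"
    by (rule minus_L2.abs_eq) auto
  then show ?thesis using rep_abs_L2[OF square_int_diff[OF square_int_rep square_int_rep], of F G] by simp
qed

lemma rep_scaleR: "AE x in lebesgue. rep_L2 (r *\<^sub>R F) x = r *\<^sub>R rep_L2 F x"
proof -
  have "r *\<^sub>R abs_L2 (rep_L2 F) = abs_L2 (\<lambda>x. r *\<^sub>R rep_L2 F x)"
    by (rule scaleR_L2.abs_eq) auto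
  then show ?thesis using rep_abs_L2[OF square_int_scaleR[OF square_int_rep], of r F] by simp
qed

lemma rep_zero: "AE x in lebesgue. rep_L2 0 x = 0"
  using rep_abs_L2[OF square_int_0] by (simp add: abs_L2_zero)

lemma norm_L2_sq: "(norm F)\<^sup>2 = (\<integral>x. (norm (rep_L2 F x))\<^sup>2 \<partial>lebesgue)"
proof -
  have "inner F F = (\<integral>x. inner (rep_L2 F x) (rep_L2 F x) \<partial>lebesgue)"
    using inner_L2.rep_eq[of F F] by simp
  then show ?thesis by (simp add: norm_eq_sqrt_inner power2_norm_eq_inner flip: dot_square_norm)
qed

lemma integrable_rep_sq: "integrable lebesgue (\<lambda>x. (norm (rep_L2 F x))\<^sup>2)"
  using square_int_rep[of F] by (simp add: square_int_def)

lemma nn_integral_rep_sq: "(\<integral>\<^sup>+x. ennreal ((norm (rep_L2 F x))\<^sup>2) \<partial>lebesgue) = ennreal ((norm F)\<^sup>2)"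
  unfolding norm_L2_sq by (intro nn_integral_eq_integral integrable_rep_sq) auto

text \<open>Norms of \<open>L\<^sup>-\<^sup>\<alpha>\<^sup>/\<^sup>\<kappa> f\<close> are estimated by duality, so only seminorms that pair with a fixed
  weight are needed; these are continuous on the Hilbert space.\<close>
definition wnorm :: "(real^'n \<Rightarrow> real) \<Rightarrow> 'n::finite L2 \<Rightarrow> real" where
  "wnorm g F = (\<integral>x. norm (rep_L2 F x) * g x \<partial>lebesgue)"

definition sq_weight :: "(real^'n \<Rightarrow> real) \<Rightarrow> bool" where
  "sq_weight g \<longleftrightarrow> g \<in> borel_measurable lebesgue \<and> (\<forall>x. 0 \<le> g x) \<and> integrable lebesgue (\<lambda>x. (g x)\<^sup>2)"

lemma wnorm_integrable:
  assumes "sq_weight g"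
  shows "integrable lebesgue (\<lambda>x. norm (rep_L2 F x) * g x)"
    and "wnorm g F \<le> sqrt (\<integral>x. (g x)\<^sup>2 \<partial>lebesgue) * norm F"
proof -
  note g = assms[unfolded sq_weight_def]
  have eq: "((norm (rep_L2 F x))\<^sup>2) powr (1 / 2) * ((g x)\<^sup>2) powr (1 - 1 / 2) = norm (rep_L2 F x)
      * g x" for x
    using g by (simp add: powr_half_sqrt)
  note h = holder_powr[of lebesgue "\<lambda>x. (norm (rep_L2 F x))\<^sup>2" "\<lambda>x. (g x)\<^sup>2" "1 / 2", unfolded eq]
  show "integrable lebesgue (\<lambda>x. norm (rep_L2 F x) * g x)"
    by (rule h(1)) (use g integrable_rep_sq in auto)
  have "wnorm g F \<le> ((norm F)\<^sup>2) powr (1 / 2) * (\<integral>x. (g x)\<^sup>2 \<partial>lebesgue) powr (1 - 1 / 2)"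
    unfolding wnorm_def norm_L2_sq by (rule h(2)) (use g integrable_rep_sq in auto)
  also have "\<dots> = sqrt (\<integral>x. (g x)\<^sup>2 \<partial>lebesgue) * norm F"
    using g by (simp add: powr_half_sqrt)
  finally show "wnorm g F \<le> sqrt (\<integral>x. (g x)\<^sup>2 \<partial>lebesgue) * norm F" .
qed

lemma wnorm_nonneg: "sq_weight g \<Longrightarrow> 0 \<le> wnorm g F"
  unfolding wnorm_def sq_weight_def by simp

lemma wnorm_add:
  assumes "sq_weight g"
  shows "wnorm g (F + G) \<le> wnorm g F + wnorm g G"
proof -
  have "wnorm g (F + G) \<le> (\<integral>x. norm (rep_L2 F x) * g x + norm (rep_L2 G x) * g x \<partial>lebesgue)"
    unfolding wnorm_def
  proof (rule integral_mono_AE)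
    show "AE x in lebesgue. norm (rep_L2 (F + G) x) * g x \<le> norm (rep_L2 F x) * g x
        + norm (rep_L2 G x) * g x"
      using rep_add[of F G]
    proof eventually_elim
      case (elim x)
      then show ?case using assms unfolding sq_weight_def
        by (simp add: distrib_right[symmetric] mult_right_mono norm_triangle_ineq)
    qed
  qed (use wnorm_integrable(1)[OF assms] in auto)
  then show ?thesis using wnorm_integrable(1)[OF assms] by (simp add: wnorm_def)
qed

lemma wnorm_scaleR:
  assumes "sq_weight g"
  shows "wnorm g (r *\<^sub>R F) = \<bar>r\<bar> * wnorm g F"
proof -
  have [measurable]: "g \<in> borel_measurable lebesgue" using assms by (simp add: sq_weight_def)
  have "wnorm g (r *\<^sub>R F) = (\<integral>x. \<bar>r\<bar> * (norm (rep_L2 F x) * g x) \<partial>lebesgue)"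
    unfolding wnorm_def
  proof (rule integral_cong_AE)
    show "AE x in lebesgue. norm (rep_L2 (r *\<^sub>R F) x) * g x = \<bar>r\<bar> * (norm (rep_L2 F x) * g x)"
      using rep_scaleR[of r F] by eventually_elim simp
  qed measurable
  then show ?thesis by (simp add: wnorm_def)
qed

section \<open>Pointwise limits and Riesz-Fischer\<close>

text \<open>Summable increments in L^1 of every ball make the telescoping series converge absolutely
  almost everywhere. It yields the limit both in the completeness proof and for the truncated
  fractional integrals.\<close>

lemma AE_convergent_of_summable:
  fixes w :: "nat \<Rightarrow> real^'n \<Rightarrow> complex"
  assumes meas: "\<And>n. w n \<in> borel_measurable lebesgue"
    and sum: "\<And>j :: nat. (\<Sum>n. \<integral>\<^sup>+x\<in>cball 0 (real j). ennreal (norm (w (Suc n) x - w n x)) \<partial>lebesgue) < \<infinity>"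
  obtains w' where "w' \<in> borel_measurable lebesgue" "AE x in lebesgue. (\<lambda>n. w n x) \<longlonglongrightarrow> w' x"
proof
  have "AE x in lebesgue. x \<in> cball 0 (real j) \<longrightarrow> summable (\<lambda>n. norm (w (Suc n) x - w n x))" for j :: nat
  proof -
    have [measurable]: "cball 0 (real j) \<in> sets (lebesgue :: (real^'n) measure)" by simp
    note meas[measurable]
    have "(\<integral>\<^sup>+x. (\<Sum>n. ennreal (norm (w (Suc n) x - w n x)) * indicator (cball 0 (real j)) x) \<partial>lebesgue) \<noteq> \<infinity>"
      using sum[of j] by (subst nn_integral_suminf) auto
    then have "AE x in lebesgue. (\<Sum>n. ennreal (norm (w (Suc n) x - w n x))
        * indicator (cball 0 (real j)) x) \<noteq> \<infinity>"
      by (intro nn_integral_noteq_infinite) auto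
    then show ?thesis
    proof eventually_elim
      case (elim x)
      then show ?case by (auto intro!: summable_suminf_not_top)
    qed
  qed
  then have "AE x in lebesgue. \<forall>j::nat. x \<in> cball 0 (real j) \<longrightarrow> summable (\<lambda>n. norm (w (Suc n) x - w n x))"
    by (subst AE_all_countable) blast
  then show "AE x in lebesgue. (\<lambda>n. w n x) \<longlonglongrightarrow> lim (\<lambda>n. w n x)"
  proof eventually_elim
    case (elim x)
    obtain j :: nat where "norm x \<le> real j" using real_arch_simple by blast
    then have "summable (\<lambda>n. norm (w (Suc n) x - w n x))" using elim by auto
    then have "summable (\<lambda>n. w (Suc n) x - w n x)" by (rule summable_norm_cancel)
    then have "(\<lambda>n. \<Sum>i<n. w (Suc i) x - w i x) \<longlonglongrightarrow> (\<Sum>n. w (Suc n) x - w n x)"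
      by (rule summable_LIMSEQ)
    then have "(\<lambda>n. (w n x - w 0 x) + w 0 x) \<longlonglongrightarrow> (\<Sum>n. w (Suc n) x - w n x) + w 0 x"
      by (intro tendsto_add tendsto_const) (simp add: sum_lessThan_telescope[of "\<lambda>i. w i x"])
    then have "convergent (\<lambda>n. w n x)" by (auto simp: convergent_def)
    then show ?case by (simp add: convergent_LIMSEQ_iff)
  qed
  show "(\<lambda>x. lim (\<lambda>n. w n x)) \<in> borel_measurable lebesgue"
    using meas by measurable
qed

lemma sq_weight_indicator:
  assumes "K \<in> sets lebesgue" "emeasure lebesgue K < \<infinity>"
  shows "sq_weight (indicator K)"
proof -
  have "(indicator K x :: real)\<^sup>2 = indicator K x" for x by (simp add: indicator_def)
  then show ?thesis using assms unfolding sq_weight_def by (auto simp: integrable_indicator_iff)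
qed

lemma wnorm_indicator:
  assumes "K \<in> sets lebesgue" "emeasure lebesgue K < \<infinity>"
  shows "(\<integral>\<^sup>+x\<in>K. ennreal (norm (rep_L2 F x)) \<partial>lebesgue) = ennreal (wnorm (indicator K) F)"
proof -
  have "(\<integral>\<^sup>+x. ennreal (norm (rep_L2 F x) * indicator K x) \<partial>lebesgue) = ennreal (wnorm (indicator K) F)"
    unfolding wnorm_def
    by (rule nn_integral_eq_integral[OF wnorm_integrable(1)[OF sq_weight_indicator[OF assms]]]) auto
  then show ?thesis by (simp add: ennreal_mult'' ennreal_indicator)
qed

lemma emeasure_cball_finite: "emeasure lebesgue (cball (a::real^'n) r) < \<infinity>"
  using emeasure_bounded_finite[of "cball a r"] by simp

text \<open>Completeness is what makes continuous orbits integrable and the Baire argument below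
  applicable. A subsequence with increments 2^(-n) converges almost everywhere; Fatou's lemma puts
  the limit in the space and gives convergence in norm.\<close>

instance L2 :: (finite) complete_space
proof
  fix X :: "nat \<Rightarrow> 'a L2"
  assume X: "Cauchy X"
  have "\<exists>r. strict_mono r \<and> (\<forall>n. norm (X (r (Suc n)) - X (r n)) \<le> (1 / 2) ^ n)"
  proof -
    have "\<exists>M. \<forall>m\<ge>M. \<forall>k\<ge>M. dist (X m) (X k) < (1 / 2) ^ n" for n
      using X by (rule metric_CauchyD) auto
    then obtain M where M: "\<And>n m k. M n \<le> m \<Longrightarrow> M n \<le> k \<Longrightarrow> dist (X m) (X k) < (1 / 2) ^ n" by metis
    have "\<exists>r. \<forall>n. M n \<le> r n \<and> r n < r (Suc n)"
    proof (rule dependent_nat_choice)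
      show "\<exists>y. M (Suc n) \<le> y \<and> x < y" for x n by (rule exI[of _ "max (M (Suc n)) (Suc x)"]) auto
    qed auto
    then obtain r where r: "\<And>n. M n \<le> r n" "\<And>n. r n < r (Suc n)" by blast
    have "norm (X (r (Suc n)) - X (r n)) \<le> (1 / 2) ^ n" for n
      using M[of n "r (Suc n)" "r n"] r(1)[of n] r(2)[of n] by (simp add: dist_norm less_imp_le)
    then show ?thesis using r(2) by (intro exI[of _ r]) (auto simp: strict_mono_Suc_iff)
  qed
  then obtain r where r: "strict_mono r" "\<And>n. norm (X (r (Suc n)) - X (r n)) \<le> (1 / 2) ^ n" by blast
  define w where "w n = rep_L2 (X (r n))" for n
  obtain w' where w': "w' \<in> borel_measurable lebesgue" "AE x in lebesgue. (\<lambda>n. w n x) \<longlonglongrightarrow> w' x"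
  proof (rule AE_convergent_of_summable)
    show "w n \<in> borel_measurable lebesgue" for n by (simp add: w_def)
    fix j :: nat
    let ?K = "cball 0 (real j) :: (real^'a) set"
    let ?c = "sqrt (\<integral>x. (indicator ?K x)\<^sup>2 \<partial>lebesgue)"
    have "(\<integral>\<^sup>+x\<in>?K. ennreal (norm (w (Suc n) x - w n x)) \<partial>lebesgue) \<le> ennreal (?c * (1 / 2) ^ n)" for n
    proof -
      have "(\<integral>\<^sup>+x\<in>?K. ennreal (norm (w (Suc n) x - w n x)) \<partial>lebesgue)
          = (\<integral>\<^sup>+x\<in>?K. ennreal (norm (rep_L2 (X (r (Suc n)) - X (r n)) x)) \<partial>lebesgue)"
        unfolding w_def using rep_diff[of "X (r (Suc n))" "X (r n)"]
        by (intro nn_integral_cong_AE) (auto elim: AE_mp)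
      also have "\<dots> = ennreal (wnorm (indicator ?K) (X (r (Suc n)) - X (r n)))"
        by (intro wnorm_indicator) (use emeasure_cball_finite in \<open>auto simp del: emeasure_completion\<close>)
      also have "\<dots> \<le> ennreal (?c * norm (X (r (Suc n)) - X (r n)))"
        by (intro ennreal_leI wnorm_integrable(2) sq_weight_indicator) (use emeasure_cball_finite
            in \<open>auto simp del: emeasure_completion\<close>)
      also have "\<dots> \<le> ennreal (?c * (1 / 2) ^ n)"
        using r(2)[of n] by (intro ennreal_leI mult_left_mono) auto
      finally show ?thesis .
    qed
    then have "(\<Sum>n. \<integral>\<^sup>+x\<in>?K. ennreal (norm (w (Suc n) x - w n x)) \<partial>lebesgue) \<le> (\<Sum>n. ennreal (?c
        * (1 / 2) ^ n))"
      by (intro suminf_le) auto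
    also have "\<dots> = ennreal (\<Sum>n. ?c * (1 / 2) ^ n)"
      by (intro suminf_ennreal2 summable_mult summable_geometric) auto
    finally show "(\<Sum>n. \<integral>\<^sup>+x\<in>?K. ennreal (norm (w (Suc n) x - w n x)) \<partial>lebesgue) < \<infinity>"
      by (simp add: le_less_trans)
  qed blast
  have diff: "(\<integral>\<^sup>+x. ennreal ((norm (w n x - w' x))\<^sup>2) \<partial>lebesgue) \<le> ennreal (\<epsilon>\<^sup>2)"
    if "\<And>m. m \<ge> n \<Longrightarrow> norm (X (r n) - X (r m)) \<le> \<epsilon>" for n \<epsilon>
  proof -
    have "(\<integral>\<^sup>+x. ennreal ((norm (w n x - w' x))\<^sup>2) \<partial>lebesgue)
      = (\<integral>\<^sup>+x. liminf (\<lambda>m. ennreal ((norm (w n x - w m x))\<^sup>2)) \<partial>lebesgue)"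
    proof (rule nn_integral_cong_AE, use w'(2) in eventually_elim)
      case (elim x)
      then have "(\<lambda>m. ennreal ((norm (w n x - w m x))\<^sup>2)) \<longlonglongrightarrow> ennreal ((norm (w n x - w' x))\<^sup>2)"
        by (intro tendsto_ennrealI tendsto_intros)
      then show ?case by (metis lim_imp_Liminf trivial_limit_sequentially)
    qed
    also have "\<dots> \<le> liminf (\<lambda>m. \<integral>\<^sup>+x. ennreal ((norm (w n x - w m x))\<^sup>2) \<partial>lebesgue)"
      by (intro nn_integral_liminf) (auto simp: w_def)
    also have "\<dots> \<le> liminf (\<lambda>m. ennreal (\<epsilon>\<^sup>2))"
    proof (intro Liminf_mono, use eventually_ge_at_top[of n] in eventually_elim)
      case (elim m)
      have "(\<integral>\<^sup>+x. ennreal ((norm (w n x - w m x))\<^sup>2) \<partial>lebesgue)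
         = (\<integral>\<^sup>+x. ennreal ((norm (rep_L2 (X (r n) - X (r m)) x))\<^sup>2) \<partial>lebesgue)"
        unfolding w_def using rep_diff[of "X (r n)" "X (r m)"]
        by (intro nn_integral_cong_AE) (auto elim: AE_mp)
      also have "\<dots> = ennreal ((norm (X (r n) - X (r m)))\<^sup>2)" by (rule nn_integral_rep_sq)
      also have "\<dots> \<le> ennreal (\<epsilon>\<^sup>2)"
        using that[OF elim] by (intro ennreal_leI power_mono) auto
      finally show ?case .
    qed
    finally show ?thesis by (simp add: Liminf_const)
  qed
  have Xr: "Cauchy (\<lambda>n. X (r n))" using Cauchy_subseq_Cauchy[OF X r(1)] by (simp add: o_def)
  have sq: "square_int (\<lambda>x. w n x - w' x)" if "\<And>m. m \<ge> n \<Longrightarrow> norm (X (r n) - X (r m)) \<le> \<epsilon>" for n \<epsilon>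
    unfolding square_int_def
  proof (intro conjI integrableI_bounded)
    show "(\<integral>\<^sup>+x. ennreal (norm ((norm (w n x - w' x))\<^sup>2)) \<partial>lebesgue) < \<infinity>"
      using diff[OF that] by (auto intro: le_less_trans)
  qed (use w'(1) in \<open>auto simp: w_def\<close>)
  have ev: "\<exists>N. \<forall>n\<ge>N. \<forall>m\<ge>n. norm (X (r n) - X (r m)) \<le> \<epsilon>" if "0 < \<epsilon>" for \<epsilon>
    using metric_CauchyD[OF Xr that] by (metis dist_norm less_imp_le order_trans)
  have w'_sq: "square_int w'"
  proof -
    obtain N where "\<And>m. m \<ge> N \<Longrightarrow> norm (X (r N) - X (r m)) \<le> 1" using ev[of 1] by auto
    from square_int_diff[OF square_int_rep sq[OF this], of "X (r N)"]
    show ?thesis by (simp add: w_def)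
  qed
  have "(\<lambda>n. X (r n)) \<longlonglongrightarrow> abs_L2 w'"
  proof (rule metric_LIMSEQ_I)
    fix \<epsilon> :: real assume "0 < \<epsilon>"
    then obtain N where N: "\<And>n m. n \<ge> N \<Longrightarrow> m \<ge> n \<Longrightarrow> norm (X (r n) - X (r m)) \<le> \<epsilon> / 2"
      using ev[of "\<epsilon> / 2"] by auto
    have "norm (X (r n) - abs_L2 w') \<le> \<epsilon> / 2" if "n \<ge> N" for n
    proof -
      have "ennreal ((norm (X (r n) - abs_L2 w'))\<^sup>2)
        = (\<integral>\<^sup>+x. ennreal ((norm (rep_L2 (X (r n) - abs_L2 w') x))\<^sup>2) \<partial>lebesgue)"
        by (rule nn_integral_rep_sq[symmetric])
      also have "\<dots> = (\<integral>\<^sup>+x. ennreal ((norm (w n x - w' x))\<^sup>2) \<partial>lebesgue)"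
      proof (rule nn_integral_cong_AE, use rep_diff[of "X (r n)" "abs_L2 w'"] rep_abs_L2[OF w'_sq]
          in eventually_elim)
        case (elim x)
        then show ?case by (simp add: w_def)
      qed
      also have "\<dots> \<le> ennreal ((\<epsilon> / 2)\<^sup>2)" using N[OF that] by (rule diff)
      finally have "(norm (X (r n) - abs_L2 w'))\<^sup>2 \<le> (\<epsilon> / 2)\<^sup>2" by (simp add: ennreal_le_iff)
      then show ?thesis using \<open>0 < \<epsilon>\<close> by (simp add: power2_le_iff_abs_le)
    qed
    then show "\<exists>N. \<forall>n\<ge>N. dist (X (r n)) (abs_L2 w') < \<epsilon>"
      using \<open>0 < \<epsilon>\<close> by (intro exI[of _ N]) (force simp: dist_norm)
  qed
  then show "convergent X"
    using Cauchy_converges_subseq[OF X r(1)] by (auto simp: convergent_def o_def)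
qed

instance L2 :: (finite) banach ..

section \<open>Uniqueness of the semigroup\<close>

text \<open>By Baire category one of the closed sets \<open>E n\<close> contains a ball, and a small
  multiple of x is a difference of two points of it. It turns strong continuity of a semigroup into
  a uniform bound on compact time intervals.\<close>

lemma Banach_Steinhaus:
  fixes T :: "'i \<Rightarrow> 'a::banach \<Rightarrow> 'b::real_normed_vector"
  assumes lin: "\<And>i. i \<in> I \<Longrightarrow> bounded_linear (T i)" and bdd: "\<And>x. \<exists>B. \<forall>i\<in>I. norm (T i x) \<le> B"
  obtains M where "0 \<le> M" "\<And>i x. i \<in> I \<Longrightarrow> norm (T i x) \<le> M * norm x"
proof -
  define E where "E n = {x. \<forall>i\<in>I. norm (T i x) \<le> real n}" for n :: nat
  have "closed (E n)" for n
  proof -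
    have "E n = (\<Inter>i\<in>I. {x. norm (T i x) \<le> real n})" by (auto simp: E_def)
    also have "closed \<dots>"
      using lin by (intro closed_INT ballI closed_Collect_le continuous_intros)
        (auto intro: linear_continuous_on)
    finally show ?thesis .
  qed
  moreover have "x \<in> (\<Union>n. E n)" for x
  proof -
    obtain B where "\<forall>i\<in>I. norm (T i x) \<le> B" using bdd by blast
    moreover obtain n :: nat where "B \<le> real n" using real_arch_simple by blast
    ultimately show ?thesis unfolding E_def by (force intro: order_trans)
  qed
  then have "\<Union>(range E) = UNIV" by auto
  then have "euclidean interior_of \<Union>(range E) \<noteq> {}" by simp
  ultimately obtain n where "interior (E n) \<noteq> {}"
    using Baire_category_alt[of "euclidean :: 'a topology" "range E"] completely_metrizable_space_euclidean
    by (force simp: closed_closedin[symmetric])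
  then obtain x0 e where e: "0 < e" "cball x0 e \<subseteq> E n"
    using mem_interior_cball by blast
  show thesis
  proof (rule that)
    show "0 \<le> 2 * real n / e" using e by simp
    fix i x assume i: "i \<in> I"
    interpret bounded_linear "T i" by (rule lin[OF i])
    show "norm (T i x) \<le> 2 * real n / e * norm x"
    proof (cases "x = 0")
      case False
      have "x0 + (e / norm x) *\<^sub>R x \<in> cball x0 e" "x0 \<in> cball x0 e" using False e by (auto simp: dist_norm)
      then have "norm (T i (x0 + (e / norm x) *\<^sub>R x)) \<le> real n" "norm (T i x0) \<le> real n"
        using e i unfolding E_def by blast+
      moreover have "(e / norm x) *\<^sub>R T i x = T i (x0 + (e / norm x) *\<^sub>R x) - T i x0"
        by (simp add: add scaleR)
      then have "norm ((e / norm x) *\<^sub>R T i x) \<le> norm (T i (x0 + (e / norm x) *\<^sub>R x)) + norm (T i x0)"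
        by (simp only: norm_triangle_ineq4)
      ultimately have "norm ((e / norm x) *\<^sub>R T i x) \<le> 2 * real n" by linarith
      then show ?thesis using False e by (simp add: field_simps)
    qed (simp add: zero)
  qed
qed

text \<open>Only a right derivative is available. The estimate |\<phi>(r) - \<phi>(0)| <= \<epsilon>
  r holds on a maximal interval from 0; continuity gives it at the right end, and the vanishing
  right derivative would extend it further unless that end is t.\<close>

lemma constant_if_right_derivative_zero:
  fixes \<phi> :: "real \<Rightarrow> 'a::real_normed_vector"
  assumes cont: "continuous_on {0..t} \<phi>" and "0 \<le> t"
    and der: "\<And>s. 0 \<le> s \<Longrightarrow> s < t \<Longrightarrow> ((\<lambda>h. norm (\<phi> (s + h) - \<phi> s) / h) \<longlongrightarrow> 0) (at_right 0)"
  shows "\<phi> t = \<phi> 0"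
proof -
  have bound: "norm (\<phi> t - \<phi> 0) \<le> \<epsilon> * t" if "0 < \<epsilon>" for \<epsilon>
  proof -
    define A where "A = {s\<in>{0..t}. \<forall>r\<in>{0..s}. norm (\<phi> r - \<phi> 0) \<le> \<epsilon> * r}"
    define m where "m = Sup A"
    have A0: "0 \<in> A" using \<open>0 \<le> t\<close> by (auto simp: A_def)
    have bdd: "bdd_above A" by (rule bdd_aboveI[of _ t]) (auto simp: A_def)
    have m: "0 \<le> m" "m \<le> t"
      unfolding m_def using A0 bdd by (auto intro!: cSup_upper cSup_least simp: A_def)
    have less: "norm (\<phi> r - \<phi> 0) \<le> \<epsilon> * r" if "0 \<le> r" "r < m" for r
    proof -
      have "\<exists>s\<in>A. r < s" by (rule less_cSupD) (use A0 that(2) in \<open>auto simp: m_def\<close>)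
      then obtain s where "s \<in> A" "r < s" by (elim bexE)
      then show ?thesis using that by (auto simp: A_def)
    qed
    have at_m: "norm (\<phi> m - \<phi> 0) \<le> \<epsilon> * m"
    proof (cases "m = 0")
      case False
      then have "0 < m" using m by simp
      have "(\<phi> \<longlongrightarrow> \<phi> m) (at m within {0..t})" using cont m by (auto simp: continuous_on_def)
      then have lim: "(\<phi> \<longlongrightarrow> \<phi> m) (at m within {0..<m})" by (rule tendsto_within_subset) (use m in auto)
      have "at m within {0..<m} \<noteq> bot"
        using \<open>0 < m\<close> by (simp add: at_within_eq_bot_iff closure_atLeastLessThan)
      then show ?thesis
      proof (rule tendsto_le)
        show "((\<lambda>r. \<epsilon> * r) \<longlongrightarrow> \<epsilon> * m) (at m within {0..<m})" by (intro tendsto_intros)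
        show "((\<lambda>r. norm (\<phi> r - \<phi> 0)) \<longlongrightarrow> norm (\<phi> m - \<phi> 0)) (at m within {0..<m})"
            by (intro tendsto_intros lim)
        show "eventually (\<lambda>r. norm (\<phi> r - \<phi> 0) \<le> \<epsilon> * r) (at m within {0..<m})"
          unfolding eventually_at_filter by (auto intro!: always_eventually less)
      qed
    qed simp
    have "m = t"
    proof (rule ccontr)
      assume "m \<noteq> t"
      then have "m < t" using m by simp
      have "eventually (\<lambda>h. norm (\<phi> (m + h) - \<phi> m) / h < \<epsilon>) (at_right 0)"
        using der[OF m(1) \<open>m < t\<close>] \<open>0 < \<epsilon>\<close> by (rule order_tendstoD)
      then obtain d where d: "0 < d" "\<And>h. 0 < h \<Longrightarrow> h < d \<Longrightarrow> norm (\<phi> (m + h) - \<phi> m) / h < \<epsilon>"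
        unfolding eventually_at_right_field by auto
      define k where "k = min (d / 2) (t - m)"
      have k: "0 < k" "k < d" "m + k \<le> t" using d \<open>m < t\<close> by (auto simp: k_def min_def)
      have "norm (\<phi> r - \<phi> 0) \<le> \<epsilon> * r" if r: "0 \<le> r" "r \<le> m + k" for r
      proof (cases "r \<le> m")
        case False
        have "norm (\<phi> (m + (r - m)) - \<phi> m) / (r - m) < \<epsilon>" using False r k by (intro d(2)) auto
        then have "norm (\<phi> r - \<phi> m) \<le> \<epsilon> * (r - m)" using False by (simp add: field_simps)
        moreover have "norm (\<phi> r - \<phi> 0) \<le> norm (\<phi> r - \<phi> m) + norm (\<phi> m - \<phi> 0)"
          using norm_triangle_ineq[of "\<phi> r - \<phi> m" "\<phi> m - \<phi> 0"] by simp
        ultimately show ?thesis using at_m by (simp add: algebra_simps)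
      next
        case True
        then consider "r = m" | "r < m" by linarith
        then show ?thesis
        proof cases
          case 2
          then show ?thesis by (rule less[OF r(1)])
        qed (simp add: at_m)
      qed
      then have "m + k \<in> A" using m k by (auto simp: A_def)
      then have "m + k \<le> m" unfolding m_def using bdd by (rule cSup_upper)
      then show False using k by simp
    qed
    then show ?thesis using at_m by simp
  qed
  have "norm (\<phi> t - \<phi> 0) \<le> 0"
  proof (rule field_le_epsilon)
    fix e :: real assume "0 < e"
    then have "norm (\<phi> t - \<phi> 0) \<le> (e / (t + 1)) * t" using \<open>0 \<le> t\<close> by (intro bound) auto
    also have "\<dots> \<le> e" using \<open>0 < e\<close> \<open>0 \<le> t\<close> by (simp add: field_simps)
    finally show "norm (\<phi> t - \<phi> 0) \<le> 0 + e" by simp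
  qed
  then show ?thesis by simp
qed

text \<open>The orbit \<open>s \<mapsto> T(t - s) S(s) f\<close> joins \<open>T(t) f\<close> to \<open>S(t) f\<close> and has vanishing right
  derivative.\<close>
lemma semigroup_unique:
  assumes T: "is_semigroup_of L T" and S: "is_semigroup_of L S" and dense: "closure (Domain L)
      = UNIV" and "0 \<le> t"
  shows "T t f = S t f"
proof -
  have T_lin: "bounded_linear (T s)" if "0 \<le> s" for s using T that unfolding is_semigroup_of_def by blast
  have S_lin: "bounded_linear (S s)" if "0 \<le> s" for s using S that unfolding is_semigroup_of_def by blast
  have T_add: "T (s + r) f = T s (T r f)" if "0 \<le> s" "0 \<le> r" for s r f
    using T that unfolding is_semigroup_of_def by (metis comp_apply)
  have S_add: "S (s + r) f = S s (S r f)" if "0 \<le> s" "0 \<le> r" for s r f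
    using S that unfolding is_semigroup_of_def by (metis comp_apply)
  have T_cont: "continuous_on {0..} (\<lambda>s. T s f)" for f using T unfolding is_semigroup_of_def by blast
  have S_cont: "continuous_on {0..} (\<lambda>s. S s f)" for f using S unfolding is_semigroup_of_def by blast
  have T0: "T 0 f = f" "S 0 f = f" for f using T S unfolding is_semigroup_of_def by simp_all
  have LT: "((\<lambda>h. (f - T h f) /\<^sub>R h) \<longlongrightarrow> g) (at_right 0)" if "(f, g) \<in> L" for f g
    using T that unfolding is_semigroup_of_def by blast
  have LS: "((\<lambda>h. (f - S h f) /\<^sub>R h) \<longlongrightarrow> g) (at_right 0)" if "(f, g) \<in> L" for f g
    using S that unfolding is_semigroup_of_def by blast
  have LS': "(f, g) \<in> L" if "((\<lambda>h. (f - S h f) /\<^sub>R h) \<longlongrightarrow> g) (at_right 0)" for f g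
    using S that unfolding is_semigroup_of_def by blast
  obtain M where M: "0 \<le> M" "\<And>s f. s \<in> {0..t} \<Longrightarrow> norm (T s f) \<le> M * norm f"
  proof (rule Banach_Steinhaus[of "{0..t}" T])
    fix f
    have "bounded ((\<lambda>s. T s f) ` {0..t})"
      by (intro compact_imp_bounded compact_continuous_image continuous_on_subset[OF T_cont]) auto
    then show "\<exists>B. \<forall>s\<in>{0..t}. norm (T s f) \<le> B" by (auto simp: bounded_iff)
  qed (use T_lin in auto)
  have on_domain: "T t f = S t f" if fg: "(f, g) \<in> L" for f g
  proof -
    define \<phi> where "\<phi> s = T (t - s) (S s f)" for s
    have "\<phi> t = \<phi> 0"
    proof (rule constant_if_right_derivative_zero)
      show "continuous_on {0..t} \<phi>"
        unfolding continuous_on_def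
      proof
        fix s assume s: "s \<in> {0..t}"
        have "((\<lambda>r. T (t - r) (S s f)) \<longlongrightarrow> T (t - s) (S s f)) (at s within {0..t})"
        proof -
          have "continuous_on {0..t} (\<lambda>r. T (t - r) (S s f))"
            by (rule continuous_on_compose2[OF T_cont[of "S s f"]]) (auto intro!: continuous_intros)
          then show ?thesis using s by (auto simp: continuous_on_def)
        qed
        \<comment> \<open>Joint continuity: the uniform bound M keeps the moving operator T(t - r)
          from spoiling the convergence of its argument.\<close>
        moreover have "((\<lambda>r. T (t - r) (S r f - S s f)) \<longlongrightarrow> 0) (at s within {0..t})"
        proof (rule Lim_null_comparison)
          have "((\<lambda>r. S r f) \<longlongrightarrow> S s f) (at s within {0..t})"
            using continuous_on_subset[OF S_cont, of "{0..t}" f] s by (auto simp: continuous_on_def)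
          then show "((\<lambda>r. M * norm (S r f - S s f)) \<longlongrightarrow> 0) (at s within {0..t})"
            by (intro tendsto_mult_right_zero tendsto_norm_zero LIM_zero)
          show "eventually (\<lambda>r. norm (T (t - r) (S r f - S s f)) \<le> M
              * norm (S r f - S s f)) (at s within {0..t})"
            unfolding eventually_at_filter by (auto intro!: always_eventually M)
        qed
        ultimately have "((\<lambda>r. T (t - r) (S r f - S s f) + T (t - r) (S s f)) \<longlongrightarrow> 0
            + T (t - s) (S s f)) (at s within {0..t})"
          by (intro tendsto_add)
        then have "((\<lambda>r. T (t - r) (S r f - S s f) + T (t - r) (S s f)) \<longlongrightarrow> \<phi> s) (at s within {0..t})"
          by (simp add: \<phi>_def)
        then show "(\<phi> \<longlongrightarrow> \<phi> s) (at s within {0..t})"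
        proof (rule Lim_transform_eventually)
          show "eventually (\<lambda>r. T (t - r) (S r f - S s f) + T (t - r) (S s f) = \<phi> r) (at s within {0..t})"
            unfolding eventually_at_filter
            by (auto intro!: always_eventually simp: \<phi>_def linear_diff[OF bounded_linear.linear[OF T_lin]])
        qed
      qed
      fix s assume s: "0 \<le> s" "s < t"
      let ?y = "S s f"
      have "((\<lambda>h. S s ((f - S h f) /\<^sub>R h)) \<longlongrightarrow> S s g) (at_right 0)"
        by (rule bounded_linear.tendsto[OF S_lin[OF s(1)] LS[OF fg]])
      then have "((\<lambda>h. (?y - S h ?y) /\<^sub>R h) \<longlongrightarrow> S s g) (at_right 0)"
      proof (rule Lim_transform_eventually)
        show "eventually (\<lambda>h. S s ((f - S h f) /\<^sub>R h) = (?y - S h ?y) /\<^sub>R h) (at_right 0)"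
          using eventually_at_right_less[of 0]
        proof eventually_elim
          case (elim h)
          have "S s (S h f) = S h (S s f)" using S_add[of s h f] S_add[of h s f] elim s
              by (simp add: add.commute)
          then show ?case
            using s by (simp add: linear_diff[OF bounded_linear.linear[OF S_lin]] linear_scale[OF
                bounded_linear.linear[OF S_lin]])
        qed
      qed
      \<comment> \<open>S(s) preserves the domain of L. Hence both difference quotients at S(s) f
        tend to the same vector, and their difference controls the right derivative of
        \<phi>.\<close>
      then have y: "(?y, S s g) \<in> L" by (rule LS')
      have "((\<lambda>h. (?y - T h ?y) /\<^sub>R h - (?y - S h ?y) /\<^sub>R h) \<longlongrightarrow> S s g - S s g) (at_right 0)"
        by (rule tendsto_diff[OF LT[OF y] LS[OF y]])
      then have z: "((\<lambda>h. M * norm ((?y - T h ?y) /\<^sub>R h - (?y - S h ?y) /\<^sub>R h)) \<longlongrightarrow> 0) (at_right 0)"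
        by (intro tendsto_mult_right_zero tendsto_norm_zero) simp
      show "((\<lambda>h. norm (\<phi> (s + h) - \<phi> s) / h) \<longlongrightarrow> 0) (at_right 0)"
      proof (rule Lim_null_comparison[OF _ z])
        have "eventually (\<lambda>h. 0 < h \<and> h < t - s) (at_right 0)"
          by (rule eventually_mono[OF eventually_at_right_real[of 0 "t - s"]]) (use s in auto)
        then show "eventually (\<lambda>h. norm (norm (\<phi> (s + h) - \<phi> s) / h)
            \<le> M * norm ((?y - T h ?y) /\<^sub>R h - (?y - S h ?y) /\<^sub>R h)) (at_right 0)"
        proof eventually_elim
          case (elim h)
          have "\<phi> (s + h) = T (t - s - h) (S h ?y)"
            using S_add[of h s f] elim s by (simp add: \<phi>_def add.commute diff_diff_eq)
          moreover have "\<phi> s = T (t - s - h) (T h ?y)"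
            using T_add[of "t - s - h" h ?y] elim s by (simp add: \<phi>_def)
          ultimately have "\<phi> (s + h) - \<phi> s = T (t - s - h) (S h ?y - T h ?y)"
            using elim by (simp add: linear_diff[OF bounded_linear.linear[OF T_lin]])
          then have "norm (\<phi> (s + h) - \<phi> s) \<le> M * norm (S h ?y - T h ?y)"
            using elim s by (auto intro!: M)
          then have "norm (\<phi> (s + h) - \<phi> s) / h \<le> M * (norm (S h ?y - T h ?y) / h)"
            using elim by (simp add: divide_right_mono)
          also have "norm (S h ?y - T h ?y) / h = norm ((?y - T h ?y) /\<^sub>R h - (?y - S h ?y) /\<^sub>R h)"
            using elim by (simp add: divide_inverse_commute flip: scaleR_diff_right)
          finally show ?case using elim by simp
        qed
      qed
    qed (rule \<open>0 \<le> t\<close>)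
    then show ?thesis by (simp add: \<phi>_def T0)
  qed
  have "closed {f. T t f = S t f}"
    by (intro closed_Collect_eq linear_continuous_on T_lin S_lin \<open>0 \<le> t\<close>)
  then have "closure (Domain L) \<subseteq> {f. T t f = S t f}"
    using on_domain by (intro closure_minimal) auto
  then show ?thesis using dense by auto
qed

text \<open>If no semigroup exists, the definite description in \<^const>\<open>exp_neg\<close> is one junk value.\<close>
lemma exp_neg_cases:
  assumes "closed_densely_defined L"
  obtains T where "is_semigroup_of L T" "\<And>t f. 0 \<le> t \<Longrightarrow> exp_neg L t f = T t f"
  | c where "\<And>t f. exp_neg L t f = c"
proof (cases "\<exists>T. is_semigroup_of L T")
  case True
  then obtain T where T: "is_semigroup_of L T" by blast
  have "exp_neg L t f = T t f" if "0 \<le> t" for t f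
    unfolding exp_neg_def
  proof (rule the_equality)
    fix g assume "\<exists>T. is_semigroup_of L T \<and> g = T t f"
    then show "g = T t f"
      using semigroup_unique[OF _ T _ that] assms by (auto simp: closed_densely_defined_def)
  qed (use T in blast)
  then show thesis using that T by blast
next
  case False
  then show thesis using that(2)[of "THE g. False"] by (simp add: exp_neg_def)
qed

section \<open>Off-diagonal estimates\<close>

lemma wnorm_zero: "wnorm g 0 = 0"
proof -
  have "(\<integral>x. norm (rep_L2 0 x) * g x \<partial>lebesgue) = 0"
    using rep_zero by (intro integral_eq_zero_AE) (auto elim: eventually_mono)
  then show ?thesis by (simp add: wnorm_def)
qed

lemma wnorm_sum:
  assumes "sq_weight g"
  shows "wnorm g (\<Sum>i\<in>I. F i) \<le> (\<Sum>i\<in>I. wnorm g (F i))"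
proof (induction I rule: infinite_finite_induct)
  case (insert i I)
  then show ?case using wnorm_add[OF assms, of "F i" "\<Sum>i\<in>I. F i"] by simp
qed (simp_all add: wnorm_zero)

text \<open>The triangle inequality for integrals, in a seminorm. Both integrals are compared with
  Riemann sums over one tagged division fine for both; subadditivity handles the sums.\<close>

lemma wnorm_integral_le:
  fixes E :: "real \<Rightarrow> 'n::finite L2" and \<phi> :: "real \<Rightarrow> real"
  assumes g: "sq_weight g" and cont: "continuous_on {a..b} E" "continuous_on {a..b} \<phi>"
    and le: "\<And>s. a \<le> s \<Longrightarrow> s \<le> b \<Longrightarrow> wnorm g (E s) \<le> \<phi> s"
  shows "wnorm g (integral {a..b} E) \<le> integral {a..b} \<phi>"
proof (rule field_le_epsilon)
  fix e :: real assume e: "0 < e"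
  define c where "c = sqrt (\<integral>x. (g x)\<^sup>2 \<partial>lebesgue)"
  have c0: "0 \<le> c" by (simp add: c_def)
  \<comment> \<open>The error of the vector sum enters as c d, with c the norm of the seminorm, and
    that of the scalar sum as d; together they make e.\<close>
  define d where "d = e / (1 + c)"
  have d: "0 < d" "d * (1 + c) = e" using e c0 by (auto simp: d_def)
  have "(E has_integral integral {a..b} E) (cbox a b)" "(\<phi> has_integral integral {a..b} \<phi>) (cbox a b)"
    using cont by (auto intro!: integrable_integral integrable_continuous_real)
  then obtain \<gamma>1 \<gamma>2 where \<gamma>: "gauge \<gamma>1" "gauge \<gamma>2"
    "\<And>\<D>. \<D> tagged_division_of (cbox a b) \<Longrightarrow> \<gamma>1 fine \<D> \<Longrightarrow> norm ((\<Sum>(x, k)\<in>\<D>. measure lborel k *\<^sub>R E x) -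
        integral {a..b} E) < d"
    "\<And>\<D>. \<D> tagged_division_of (cbox a b) \<Longrightarrow> \<gamma>2 fine \<D> \<Longrightarrow> norm ((\<Sum>(x, k)\<in>\<D>. measure lborel k *\<^sub>R \<phi> x) -
        integral {a..b} \<phi>) < d"
    unfolding has_integral using d(1) by metis
  obtain \<D> where \<D>: "\<D> tagged_division_of (cbox a b)" "(\<lambda>x. \<gamma>1 x \<inter> \<gamma>2 x) fine \<D>"
    using fine_division_exists[OF gauge_Int[OF \<gamma>(1,2)]] by blast
  then have fine: "\<gamma>1 fine \<D>" "\<gamma>2 fine \<D>" by (auto simp: fine_Int)
  let ?S = "\<Sum>(x, k)\<in>\<D>. measure lborel k *\<^sub>R E x"
  have "wnorm g (integral {a..b} E) \<le> wnorm g ?S + wnorm g (integral {a..b} E - ?S)"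
    using wnorm_add[OF g, of ?S "integral {a..b} E - ?S"] by simp
  also have "wnorm g (integral {a..b} E - ?S) \<le> c * d"
  proof -
    have "wnorm g (integral {a..b} E - ?S) \<le> c * norm (integral {a..b} E - ?S)"
      unfolding c_def by (rule wnorm_integrable(2)[OF g])
    also have "\<dots> \<le> c * d"
      using \<gamma>(3)[OF \<D>(1) fine(1)] c0 by (intro mult_left_mono) (auto simp: norm_minus_commute)
    finally show ?thesis .
  qed
  also have "wnorm g ?S \<le> (\<Sum>(x, k)\<in>\<D>. measure lborel k *\<^sub>R \<phi> x)"
  proof -
    have "wnorm g ?S \<le> (\<Sum>i\<in>\<D>. wnorm g (case i of (x, k) \<Rightarrow> measure lborel k *\<^sub>R E x))"
        by (rule wnorm_sum[OF g])
    also have "\<dots> \<le> (\<Sum>(x, k)\<in>\<D>. measure lborel k *\<^sub>R \<phi> x)"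
    proof (intro sum_mono, clarify)
      fix x k assume "(x, k) \<in> \<D>"
      then have "x \<in> cbox a b" using \<D>(1) by (blast dest: tag_in_interval)
      then show "wnorm g (measure lborel k *\<^sub>R E x) \<le> measure lborel k *\<^sub>R \<phi> x"
        using le[of x] by (simp add: wnorm_scaleR[OF g] mult_left_mono)
    qed
    finally show ?thesis .
  qed
  also have "\<dots> \<le> integral {a..b} \<phi> + d"
    using \<gamma>(4)[OF \<D>(1) fine(2)] by (simp add: abs_less_iff)
  finally show "wnorm g (integral {a..b} E) \<le> integral {a..b} \<phi> + e"
    using d(2) by (simp add: algebra_simps)
qed

section \<open>Norm bounds as bounds on integrals\<close>

lemma epowr_le_iff:
  assumes "0 < a" "0 \<le> c"
  shows "X epowr a \<le> ennreal c \<longleftrightarrow> X \<le> ennreal (c powr (1 / a))"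
proof (cases X)
  case (real r)
  have "r powr a \<le> c \<longleftrightarrow> r \<le> c powr (1 / a)"
  proof
    assume "r powr a \<le> c"
    then have "(r powr a) powr (1 / a) \<le> c powr (1 / a)" using assms by (intro powr_mono2) auto
    then show "r \<le> c powr (1 / a)" using real assms by (simp add: powr_powr)
  next
    assume "r \<le> c powr (1 / a)"
    then have "r powr a \<le> (c powr (1 / a)) powr a" using real assms by (intro powr_mono2) auto
    then show "r powr a \<le> c" using assms by (simp add: powr_powr)
  qed
  then show ?thesis using real assms by (simp add: epowr_def ennreal_le_iff)
qed (simp add: epowr_def top_unique)

lemma recip_ennreal: "0 < q \<Longrightarrow> recip (ennreal q) = 1 / q"
  by (simp add: recip_def inverse_ennreal divide_inverse)

lemma recip_infinity: "recip \<infinity> = 0" "recip top = 0"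
  by (simp_all add: recip_def)

lemma lp_norm_le_iff:
  assumes "0 < p" "0 \<le> c"
  shows "lp_norm (ennreal p) M f \<le> ennreal c \<longleftrightarrow> (\<integral>\<^sup>+x. ennreal (norm (f x) powr p) \<partial>M) \<le> ennreal (c powr p)"
  using assms epowr_le_iff[of "1 / p" c] by (simp add: lp_norm_def)

lemma lp_norm_inf_le_iff:
  assumes "f \<in> borel_measurable M" "0 \<le> c"
  shows "lp_norm \<infinity> M f \<le> ennreal c \<longleftrightarrow> (AE x in M. norm (f x) \<le> c)"
proof -
  have "esssup M (\<lambda>x. ennreal (norm (f x))) \<le> ennreal c \<longleftrightarrow> (AE x in M. ennreal (norm (f x)) \<le> ennreal c)"
  proof
    assume *: "esssup M (\<lambda>x. ennreal (norm (f x))) \<le> ennreal c"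
    show "AE x in M. ennreal (norm (f x)) \<le> ennreal c"
      using esssup_AE[of "\<lambda>x. ennreal (norm (f x))" M] by eventually_elim (rule order_trans[OF _ *])
  next
    assume "AE x in M. ennreal (norm (f x)) \<le> ennreal c"
    then show "esssup M (\<lambda>x. ennreal (norm (f x))) \<le> ennreal c" using assms(1) by (intro esssup_I) auto
  qed
  then show ?thesis using assms by (simp add: lp_norm_def ennreal_le_iff)
qed

lemma divide_ennreal_le_iff:
  assumes "0 < v" "0 \<le> d"
  shows "X / ennreal v \<le> ennreal d \<longleftrightarrow> X \<le> ennreal (d * v)"
proof (cases X)
  case (real r)
  then show ?thesis using assms by (simp add: divide_ennreal ennreal_le_iff divide_le_eq)
qed (use assms in \<open>simp add: ennreal_top_divide top_unique\<close>)

lemma avg_norm_le_iff: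
  fixes f :: "real^'n \<Rightarrow> complex"
  assumes f: "f \<in> borel_measurable lebesgue" and Q: "Q \<in> sets lebesgue" "emeasure lebesgue Q
      = ennreal (vol Q)" "0 < vol Q"
    and p: "0 < p" "0 \<le> c"
  shows "avg_norm (ennreal p) Q f \<le> ennreal c
    \<longleftrightarrow> (\<integral>\<^sup>+x\<in>Q. ennreal (norm (f x) powr p) \<partial>lebesgue) \<le> ennreal (c powr p * vol Q)"
proof -
  have "avg_norm (ennreal p) Q f \<le> ennreal c
      \<longleftrightarrow> (\<integral>\<^sup>+x\<in>Q. ennreal (norm (f x) powr p) \<partial>lebesgue) / ennreal (vol Q) \<le> ennreal (c powr p)"
    unfolding avg_norm_def lp_norm_le_iff[OF p] using f Q(1)
    by (subst nn_integral_uniform_measure) (auto simp: Q(2) simp del: emeasure_completion)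
  then show ?thesis using Q(3) by (simp add: divide_ennreal_le_iff)
qed

lemma avg_norm_inf_le_iff:
  fixes f :: "real^'n \<Rightarrow> complex"
  assumes f: "f \<in> borel_measurable lebesgue" and Q: "Q \<in> sets lebesgue" "emeasure lebesgue Q
      = ennreal (vol Q)" "0 < vol Q"
    and c: "0 \<le> c"
  shows "avg_norm \<infinity> Q f \<le> ennreal c \<longleftrightarrow> (AE x in lebesgue. x \<in> Q \<longrightarrow> norm (f x) \<le> c)"
proof -
  have "avg_norm \<infinity> Q f \<le> ennreal c \<longleftrightarrow> (AE x in uniform_measure lebesgue Q. norm (f x) \<le> c)"
    unfolding avg_norm_def by (rule lp_norm_inf_le_iff) (use f c in auto)
  also have "\<dots> \<longleftrightarrow> (AE x in lebesgue. x \<in> Q \<longrightarrow> norm (f x) \<le> c)"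
    by (rule AE_uniform_measure) (use Q in \<open>auto simp del: emeasure_completion\<close>)
  finally show ?thesis .
qed

lemma avg_norm_le_lp_norm:
  fixes f :: "real^'n \<Rightarrow> complex"
  assumes f: "f \<in> borel_measurable lebesgue" and Q: "Q \<in> sets lebesgue" "emeasure lebesgue Q
      = ennreal (vol Q)" "0 < vol Q"
    and "0 < q0" "0 \<le> c" and le: "lp_norm q0 lebesgue f \<le> ennreal c"
  shows "avg_norm q0 Q f \<le> ennreal (vol Q powr (- recip q0) * c)"
proof (cases "q0 = \<infinity>")
  case True
  have "vol Q powr (- recip q0) * c = c" using Q(3) by (simp add: True recip_infinity)
  moreover have "AE x in lebesgue. norm (f x) \<le> c"
    using le unfolding True lp_norm_inf_le_iff[OF f \<open>0 \<le> c\<close>] .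
  then have "avg_norm q0 Q f \<le> ennreal c"
    unfolding True avg_norm_inf_le_iff[OF f Q \<open>0 \<le> c\<close>] by eventually_elim simp
  ultimately show ?thesis by (simp only:)
next
  case False
  then obtain q where q: "q0 = ennreal q" "0 < q" using \<open>0 < q0\<close> by (cases q0) auto
  have "(\<integral>\<^sup>+x\<in>Q. ennreal (norm (f x) powr q) \<partial>lebesgue) \<le> (\<integral>\<^sup>+x. ennreal (norm (f x) powr q) \<partial>lebesgue)"
    by (intro nn_integral_mono) (auto simp: indicator_def)
  also have "\<dots> \<le> ennreal (c powr q)" using le q \<open>0 \<le> c\<close> by (simp add: lp_norm_le_iff)
  also have "c powr q = (vol Q powr (- recip q0) * c) powr q * vol Q"
  proof -
    have "(vol Q powr (- (1 / q))) powr q = 1 / vol Q"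
      using q Q(3) by (simp add: powr_powr powr_neg_one)
    then show ?thesis
      using q Q(3) \<open>0 \<le> c\<close> by (simp only: recip_ennreal powr_mult) simp
  qed
  finally show ?thesis
    unfolding q(1) using q Q(3) \<open>0 \<le> c\<close> by (subst avg_norm_le_iff[OF f Q]) auto
qed

text \<open>Hoelder's inequality on Q with exponents q0 and s0 = q0', in averaged form. The endpoint
  q0 = \<infinity> forces s0 = 1 and is a plain supremum bound.\<close>

lemma nn_integral_pairing_le:
  fixes f :: "real^'n \<Rightarrow> complex"
  assumes f: "f \<in> borel_measurable lebesgue" and Q: "Q \<in> sets lebesgue" "emeasure lebesgue Q
      = ennreal (vol Q)" "0 < vol Q"
    and q0: "1 < q0" "1 / s0 = 1 - recip q0" and c: "0 \<le> c" "avg_norm q0 Q f \<le> ennreal c"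
    and h: "h \<in> borel_measurable lebesgue" "\<And>x. 0 \<le> h x" "set_integrable lebesgue Q (\<lambda>x. h x powr s0)"
  shows "(\<integral>\<^sup>+x. ennreal (norm (f x) * (h x * indicator Q x)) \<partial>lebesgue)
    \<le> ennreal (vol Q * c * (wint (\<lambda>x. h x powr s0) Q / vol Q) powr (1 / s0))"
proof (cases "q0 = \<infinity>")
  case True
  then have s0: "s0 = 1" using q0 by (simp add: recip_infinity)
  have int: "integrable lebesgue (\<lambda>x. h x * indicator Q x)"
    using h by (simp add: s0 set_integrable_def mult.commute)
  have "(\<integral>\<^sup>+x. ennreal (norm (f x) * (h x * indicator Q x)) \<partial>lebesgue) \<le> (\<integral>\<^sup>+x. ennreal (c * (h x
      * indicator Q x)) \<partial>lebesgue)"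
  proof (intro nn_integral_mono_AE)
    have "AE x in lebesgue. x \<in> Q \<longrightarrow> norm (f x) \<le> c"
      using c True avg_norm_inf_le_iff[OF f Q c(1)] by simp
    then show "AE x in lebesgue. ennreal (norm (f x) * (h x * indicator Q x)) \<le> ennreal (c * (h x
        * indicator Q x))"
      by eventually_elim (use h in \<open>auto intro!: ennreal_leI mult_right_mono simp: indicator_def\<close>)
  qed
  also have "\<dots> = ennreal (\<integral>x. c * (h x * indicator Q x) \<partial>lebesgue)"
    using int h c by (intro nn_integral_eq_integral) auto
  also have "(\<integral>x. c * (h x * indicator Q x) \<partial>lebesgue) = c * wint h Q"
    by (simp add: wint_def set_lebesgue_integral_def mult.commute)
  finally show ?thesis
    using Q(3) c wint_nonneg[of h Q] h by (simp add: s0)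
next
  case False
  then obtain q where q: "q0 = ennreal q" "1 < q" using q0 by (cases q0) auto
  have s0: "1 / s0 = 1 - 1 / q" using q0 q by (simp add: recip_ennreal)
  then have s0': "s0 \<noteq> 0" "1 - 1 / q = 1 / s0" using q by auto
  have fin: "(\<integral>\<^sup>+x\<in>Q. ennreal (norm (f x) powr q) \<partial>lebesgue) \<le> ennreal (c powr q * vol Q)"
    using c q avg_norm_le_iff[OF f Q _ c(1), of q] by auto
  have int_f: "integrable lebesgue (\<lambda>x. norm (f x) powr q * indicator Q x)"
  proof (rule integrableI_bounded)
    have "(\<integral>\<^sup>+x. ennreal (norm (norm (f x) powr q * indicator Q x)) \<partial>lebesgue)
        = (\<integral>\<^sup>+x\<in>Q. ennreal (norm (f x) powr q) \<partial>lebesgue)"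
      by (intro nn_integral_cong) (auto simp: indicator_def)
    then show "(\<integral>\<^sup>+x. ennreal (norm (norm (f x) powr q * indicator Q x)) \<partial>lebesgue) < \<infinity>"
      using fin by (auto intro: le_less_trans)
  qed (use f Q in auto)
  have int_h: "integrable lebesgue (\<lambda>x. h x powr s0 * indicator Q x)"
    using h by (simp add: set_integrable_def mult.commute)
  have eq: "(norm (f x) powr q * indicator Q x) powr (1 / q) * (h x powr s0
      * indicator Q x) powr (1 - 1 / q)
      = norm (f x) * (h x * indicator Q x)" for x
    unfolding s0'(2) using q s0' h by (auto simp: indicator_def powr_powr)
  note hol = holder_powr[OF int_f _ int_h _, of "1 / q", unfolded eq]
  have "(\<integral>\<^sup>+x. ennreal (norm (f x) * (h x * indicator Q x)) \<partial>lebesgue) = ennreal (\<integral>x. norm (f x)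
      * (h x * indicator Q x) \<partial>lebesgue)"
    using q h by (intro nn_integral_eq_integral hol(1)) auto
  also have "\<dots> \<le> ennreal ((\<integral>x. norm (f x) powr q * indicator Q x \<partial>lebesgue) powr (1 / q)
      * (\<integral>x. h x powr s0 * indicator Q x \<partial>lebesgue) powr (1 - 1 / q))"
    using q h by (intro ennreal_leI hol(2)) auto
  also have "\<dots> \<le> ennreal ((c powr q * vol Q) powr (1 / q) * (wint (\<lambda>x. h x powr s0) Q) powr (1 / s0))"
  proof (intro ennreal_leI mult_mono powr_mono2)
    have "ennreal (\<integral>x. norm (f x) powr q * indicator Q x \<partial>lebesgue)
        = (\<integral>\<^sup>+x. ennreal (norm (f x) powr q * indicator Q x) \<partial>lebesgue)"
      using int_f by (intro nn_integral_eq_integral[symmetric]) auto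
    also have "\<dots> = (\<integral>\<^sup>+x\<in>Q. ennreal (norm (f x) powr q) \<partial>lebesgue)"
      by (intro nn_integral_cong) (auto simp: indicator_def)
    also note fin
    finally show "(\<integral>x. norm (f x) powr q * indicator Q x \<partial>lebesgue) \<le> c powr q * vol Q"
      using Q(3) by (simp add: ennreal_le_iff)
    show "(\<integral>x. h x powr s0 * indicator Q x \<partial>lebesgue) powr (1 - 1 / q)
        \<le> wint (\<lambda>x. h x powr s0) Q powr (1 / s0)"
      unfolding s0'(2) by (simp add: wint_def set_lebesgue_integral_def mult.commute)
  qed (use q in auto)
  also have "(c powr q * vol Q) powr (1 / q) * (wint (\<lambda>x. h x powr s0) Q) powr (1 / s0)
      = vol Q * c * (wint (\<lambda>x. h x powr s0) Q / vol Q) powr (1 / s0)"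
  proof -
    have "vol Q powr (1 / q) = vol Q / vol Q powr (1 / s0)" using Q(3) s0 by (simp add: powr_diff)
    then show ?thesis
      using q c Q(3) wint_nonneg[of "\<lambda>x. h x powr s0" Q]
      by (simp add: powr_mult powr_powr powr_divide field_simps)
  qed
  finally show ?thesis .
qed

lemma bcs_integrable:
  fixes f :: "real^'n \<Rightarrow> complex"
  assumes "bounded_comp_supp f" "0 < p"
  shows "integrable lebesgue (\<lambda>x. norm (f x) powr p)"
proof -
  let ?K = "closure {x. f x \<noteq> 0}"
  obtain B where B: "\<And>x. norm (f x) \<le> B" using assms by (auto simp: bounded_comp_supp_def bounded_iff)
  have K: "?K \<in> sets lebesgue" "emeasure lebesgue ?K < \<infinity>"
    using assms emeasure_bounded_finite[of ?K] by (auto simp: bounded_comp_supp_def compact_imp_bounded)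
  show ?thesis
  proof (rule Bochner_Integration.integrable_bound)
    show "integrable lebesgue (\<lambda>x. B powr p * indicator ?K x)"
      using K by (intro integrable_mult_right) (auto simp: integrable_indicator_iff simp del:
          emeasure_completion)
    show "(\<lambda>x. norm (f x) powr p) \<in> borel_measurable lebesgue"
      using assms by (auto simp: bounded_comp_supp_def)
    show "AE x in lebesgue. norm (norm (f x) powr p) \<le> norm (B powr p * indicator ?K x)"
    proof (rule AE_I2)
      fix x
      show "norm (norm (f x) powr p) \<le> norm (B powr p * indicator ?K x)"
        using B[of x] assms(2) closure_subset[of "{x. f x \<noteq> 0}"]
        by (cases "f x = 0") (auto simp: indicator_def intro!: powr_mono2)
    qed
  qed
qed

lemma bcs_square_int: "bounded_comp_supp f \<Longrightarrow> square_int f"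
  using bcs_integrable[of f 2] by (simp add: square_int_def bounded_comp_supp_def)

lemma bcs_restrict:
  assumes "bounded_comp_supp f" "A \<in> sets lebesgue"
  shows "bounded_comp_supp (\<lambda>x. f x * indicator A x)"
  unfolding bounded_comp_supp_def
proof (intro conjI)
  show "bounded (range (\<lambda>x. f x * indicator A x))"
  proof -
    obtain B where B: "\<And>x. norm (f x) \<le> B" using assms by (auto simp: bounded_comp_supp_def bounded_iff)
    have "norm (f x * indicator A x) \<le> B" for x
      using B[of x] norm_ge_zero[of "f x"] by (auto simp: indicator_def intro: order_trans[OF norm_ge_zero])
    then show ?thesis by (auto simp: bounded_iff)
  qed
  have "closure {x. f x * indicator A x \<noteq> 0} \<subseteq> closure {x. f x \<noteq> 0}"
    by (intro closure_mono) auto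
  then show "compact (closure {x. f x * indicator A x \<noteq> 0})"
    using assms by (auto simp: bounded_comp_supp_def compact_eq_bounded_closed intro: bounded_subset)
qed (use assms in \<open>auto simp: bounded_comp_supp_def\<close>)

lemma pow_exp_neg_0: "pow_exp_neg L 0 t f = exp_neg L t f"
  by (simp add: pow_exp_neg_def)

lemma lp_norm_rep_abs:
  assumes "square_int f" "0 < p"
  shows "lp_norm (ennreal p) lebesgue (rep_L2 (abs_L2 f)) = lp_norm (ennreal p) lebesgue f"
proof -
  have "(\<integral>\<^sup>+x. ennreal (norm (rep_L2 (abs_L2 f) x) powr p) \<partial>lebesgue)
      = (\<integral>\<^sup>+x. ennreal (norm (f x) powr p) \<partial>lebesgue)"
    by (intro nn_integral_cong_AE eventually_mono[OF rep_abs_L2[OF assms(1)]]) simp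
  then show ?thesis using assms by (simp add: lp_norm_def)
qed

lemma lp_norm_bcs:
  assumes "bounded_comp_supp f" "0 < p"
  shows "lp_norm (ennreal p) lebesgue (rep_L2 (abs_L2 f))
      \<le> ennreal ((\<integral>x. norm (f x) powr p \<partial>lebesgue) powr (1 / p))"
proof -
  have "(\<integral>\<^sup>+x. ennreal (norm (f x) powr p) \<partial>lebesgue) = ennreal (\<integral>x. norm (f x) powr p \<partial>lebesgue)"
    using bcs_integrable[OF assms] by (intro nn_integral_eq_integral) auto
  then show ?thesis
    unfolding lp_norm_rep_abs[OF bcs_square_int[OF assms(1)] assms(2)]
    using assms(2) by (subst lp_norm_le_iff) (auto simp: powr_powr)
qed

section \<open>Consequences of (A2) for the semigroup\<close>

locale frac_setup =
  fixes L :: "'n::finite graph" and p0 \<epsilon> \<kappa> :: real and q0 :: ennreal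
  assumes p0: "1 \<le> p0" "ennreal p0 < q0" and \<epsilon>: "0 < \<epsilon>" and \<kappa>: "0 < \<kappa>"
    and L: "closed_densely_defined L" and A2: "condA2 L p0 q0 \<epsilon> \<kappa>"
begin

abbreviation E :: "real \<Rightarrow> 'n L2 \<Rightarrow> 'n L2" where "E \<equiv> exp_neg L"

lemma q0_pos: "0 < q0"
  by (rule le_less_trans[OF zero_le p0(2)])

definition on_diagonal :: "ennreal \<Rightarrow> ennreal \<Rightarrow> real \<Rightarrow> bool" where
  "on_diagonal p q C \<longleftrightarrow> (\<forall>t f. 0 < t \<longrightarrow> lp_norm p lebesgue (rep_L2 f) < \<infinity> \<longrightarrow>
      lp_norm q lebesgue (rep_L2 (E t f)) \<le> ennreal (C * t powr (- (real CARD('n) / \<kappa>)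
          * (recip p - recip q))) * lp_norm p lebesgue (rep_L2 f))"

definition off_diagonal :: "ennreal \<Rightarrow> ennreal \<Rightarrow> real \<Rightarrow> bool" where
  "off_diagonal p q C \<longleftrightarrow> (\<forall>t c l j f. 0 < t \<longrightarrow> 0 < l \<longrightarrow> 2 \<le> j \<longrightarrow> lp_norm p lebesgue (rep_L2 f) < \<infinity> \<longrightarrow>
      (AE x in lebesgue. x \<notin> annulus c l j \<longrightarrow> rep_L2 f x = 0) \<longrightarrow>
      avg_norm q (cube c l) (rep_L2 (E t f)) \<le> ennreal (C
        * max ((3 ^ j * l / t powr (1/\<kappa>)) powr real CARD('n)) ((3 ^ j
            * l / t powr (1/\<kappa>)) powr (real CARD('n) * recip p))
        * (1 + t powr (1/\<kappa>) / l) powr (real CARD('n) * recip q)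
        * (1 + 3 ^ j * l / t powr (1/\<kappa>)) powr (- real CARD('n) - \<epsilon>))
            * avg_norm p (annulus c l j) (rep_L2 f))"

lemma A2_exp:
  assumes "ennreal p0 \<le> p" "p \<le> q" "q \<le> q0"
  shows "\<exists>C\<ge>0. on_diagonal p q C \<and> off_diagonal p q C"
proof -
  from A2[unfolded condA2_def, rule_format, OF assms, of 0] obtain C where
    C: "on_diagonal p q C" "off_diagonal p q C"
    unfolding pow_exp_neg_0 on_diagonal_def off_diagonal_def by (elim exE conjE) blast
  have mono: "ennreal (C * x) \<le> ennreal (max C 0 * x)" if "0 \<le> x" for x
    using that by (intro ennreal_leI mult_right_mono) auto
  have "on_diagonal p q (max C 0)"
    unfolding on_diagonal_def
  proof (intro allI impI)
    fix t :: real and f :: "'n L2" assume *: "0 < t" "lp_norm p lebesgue (rep_L2 f) < \<infinity>"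
    show "lp_norm q lebesgue (rep_L2 (E t f)) \<le> ennreal (max C 0 * t powr (- (real CARD('n) / \<kappa>)
        * (recip p - recip q))) * lp_norm p lebesgue (rep_L2 f)"
      by (rule order_trans[OF C(1)[unfolded on_diagonal_def, rule_format, OF *]]) (intro
          mult_right_mono mono, auto)
  qed
  moreover have "off_diagonal p q (max C 0)"
    unfolding off_diagonal_def
  proof (intro allI impI)
    fix t l :: real and c :: "real^'n" and j and f :: "'n L2" assume *: "0 < t" "0 < l" "2 \<le> j"
        "lp_norm p lebesgue (rep_L2 f) < \<infinity>"
      "AE x in lebesgue. x \<notin> annulus c l j \<longrightarrow> rep_L2 f x = 0"
    show "avg_norm q (cube c l) (rep_L2 (E t f)) \<le> ennreal (max C 0
        * max ((3 ^ j * l / t powr (1/\<kappa>)) powr real CARD('n)) ((3 ^ j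
            * l / t powr (1/\<kappa>)) powr (real CARD('n) * recip p))
        * (1 + t powr (1/\<kappa>) / l) powr (real CARD('n) * recip q)
        * (1 + 3 ^ j * l / t powr (1/\<kappa>)) powr (- real CARD('n) - \<epsilon>))
            * avg_norm p (annulus c l j) (rep_L2 f)"
      by (rule order_trans[OF C(2)[unfolded off_diagonal_def, rule_format, OF *]])
        (unfold mult.assoc, intro mult_right_mono mono mult_nonneg_nonneg, auto simp: max.coboundedI1)
  qed
  ultimately show ?thesis by (intro exI[of _ "max C 0"]) auto
qed

text \<open>Covers also the case where \<open>exp_neg\<close> is a default value: if no semigroup
  exists it is a constant c, and (A2) applied to f = 0 bounds the norm of c by 0. So c = 0, for
  which both claims are trivial.\<close>

lemma E_add_and_continuous:
  "(\<forall>t>0. \<forall>f g. E t (f + g) = E t f + E t g) \<and> (\<forall>f. continuous_on {0<..} (\<lambda>s. E s f))"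
  using L
proof (cases rule: exp_neg_cases)
  case (1 T)
  have "E t (f + g) = E t f + E t g" if "0 < t" for t f g
    using 1 that unfolding is_semigroup_of_def by (simp add: linear_add[OF bounded_linear.linear])
  moreover have "continuous_on {0<..} (\<lambda>s. E s f)" for f
  proof -
    have c: "continuous_on {0<..} (\<lambda>t. T t f)"
      using 1(1) unfolding is_semigroup_of_def by (auto intro: continuous_on_subset)
    show ?thesis by (rule continuous_on_eq[OF c]) (simp add: 1(2))
  qed
  ultimately show ?thesis by blast
next
  case (2 c)
  obtain C where "lp_norm (ennreal p0) lebesgue (rep_L2 (E 1 0)) \<le> ennreal (C * 1)
      * lp_norm (ennreal p0) lebesgue (rep_L2 (0 :: 'n L2))"
  proof -
    obtain C where C: "on_diagonal (ennreal p0) (ennreal p0) C"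
      using A2_exp[of "ennreal p0" "ennreal p0"] less_imp_le[OF p0(2)] by auto
    have "lp_norm (ennreal p0) lebesgue (rep_L2 (0 :: 'n L2)) \<le> ennreal 0"
      using p0(1) rep_zero by (subst lp_norm_le_iff) (auto intro!: nn_integral_zero' elim: eventually_mono)
    then show thesis using C[unfolded on_diagonal_def, rule_format, of 1 0] that[of C]
        by (auto intro: le_less_trans)
  qed
  moreover have "lp_norm (ennreal p0) lebesgue (rep_L2 (0 :: 'n L2)) \<le> ennreal 0"
    using p0(1) rep_zero by (subst lp_norm_le_iff) (auto intro!: nn_integral_zero' elim: eventually_mono)
  ultimately have "lp_norm (ennreal p0) lebesgue (rep_L2 c) \<le> ennreal 0" by (simp add: 2)
  then have "(\<integral>\<^sup>+x. ennreal (norm (rep_L2 c x) powr p0) \<partial>lebesgue) = 0"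
    using p0(1) by (subst (asm) lp_norm_le_iff) auto
  then have "AE x in lebesgue. ennreal (norm (rep_L2 c x) powr p0) = 0"
    by (subst (asm) nn_integral_0_iff_AE) auto
  then have "AE x in lebesgue. rep_L2 c x = rep_L2 0 x"
    using rep_zero by eventually_elim auto
  then have "c = 0" by (rule L2_eqI)
  then show ?thesis by (simp add: 2)
qed

lemma E_add: "0 < t \<Longrightarrow> E t (f + g) = E t f + E t g"
  and E_cont: "continuous_on {0<..} (\<lambda>s. E s f)"
  using E_add_and_continuous by auto

definition Av :: "(real^'n \<Rightarrow> complex) \<Rightarrow> real^'n \<Rightarrow> real \<Rightarrow> real" where
  "Av f c l = (wint (\<lambda>x. norm (f x) powr p0) (cube c l) / vol (cube c l)) powr (1 / p0)"

lemma cube_vol: "0 < l \<Longrightarrow> 0 < vol (cube (c :: real^'n) l)" "0 < l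
    \<Longrightarrow> emeasure lebesgue (cube (c :: real^'n) l) = ennreal (vol (cube c l))"
  by (simp_all add: measure_cube emeasure_cube del: emeasure_completion)

lemma Av_nonneg: "0 \<le> Av f c l"
  by (simp add: Av_def)

lemma integral_restrict:
  assumes "bounded_comp_supp f" "A \<in> sets lebesgue"
  shows "(\<integral>x. norm (f x * indicator A x) powr p0 \<partial>lebesgue) = wint (\<lambda>x. norm (f x) powr p0) A"
  unfolding wint_def set_lebesgue_integral_def
  by (intro Bochner_Integration.integral_cong) (auto simp: indicator_def)

text \<open>The localised bound of (A2) begins at j = 2, so the part of f on 3Q is handled by the
  global bound from L^p0 to L^q0. Since l <= s^(1/\<kappa>), the power of s is at most one of l, and
  averaging over Q combines the powers to l^(-n/p0), the normalisation of the average over 3Q up to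
  3^(n/p0).\<close>

lemma near_estimate:
  obtains C where "0 \<le> C" "\<And>f c l s. bounded_comp_supp f \<Longrightarrow> 0 < l \<Longrightarrow> 0 < s \<Longrightarrow> l \<le> s powr (1 / \<kappa>) \<Longrightarrow>
    avg_norm q0 (cube c l) (rep_L2 (E s (abs_L2 (\<lambda>x. f x * indicator (cube c (3 * l)) x))))
        \<le> ennreal (C * Av f c (3 * l))"
proof -
  obtain C where C: "0 \<le> C" "on_diagonal (ennreal p0) q0 C"
    using A2_exp[of "ennreal p0" q0] less_imp_le[OF p0(2)] by auto
  have recip: "recip q0 \<le> 1 / p0" "0 \<le> recip q0"
  proof -
    show "recip q0 \<le> 1 / p0"
    proof (cases q0)
      case (real r)
      then show ?thesis using p0 by (simp add: recip_ennreal ennreal_less_iff frac_le)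
    next
      case top
      then show ?thesis using p0 by (simp add: recip_infinity)
    qed
    show "0 \<le> recip q0" by (simp add: recip_def)
  qed
  show thesis
  proof (rule that[of "C * 3 powr (real CARD('n) / p0)"])
    fix f :: "real^'n \<Rightarrow> complex" and c l s assume f: "bounded_comp_supp f" and l: "0 < l" "0 < s" "l
        \<le> s powr (1 / \<kappa>)"
    let ?f = "\<lambda>x. f x * indicator (cube c (3 * l)) x"
    define I where "I = wint (\<lambda>x. norm (f x) powr p0) (cube c (3 * l))"
    have I0: "0 \<le> I" unfolding I_def by (rule wint_nonneg) simp
    have f': "bounded_comp_supp ?f" by (rule bcs_restrict[OF f]) simp
    have lp: "lp_norm (ennreal p0) lebesgue (rep_L2 (abs_L2 ?f)) \<le> ennreal (I powr (1 / p0))"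
      using lp_norm_bcs[OF f', of p0] p0(1) unfolding I_def integral_restrict[OF f cube_sets] by simp
    define \<beta> where "\<beta> = 1 / p0 - recip q0"
    have \<beta>: "0 \<le> \<beta>" using recip by (simp add: \<beta>_def)
    have s_l: "s powr (- (real CARD('n) / \<kappa>) * \<beta>) \<le> l powr (- (real CARD('n) * \<beta>))"
    proof -
      have "s powr (- (real CARD('n) / \<kappa>) * \<beta>) = (s powr (1 / \<kappa>)) powr (- (real CARD('n) * \<beta>))"
          by (simp add: powr_powr)
      also have "\<dots> \<le> l powr (- (real CARD('n) * \<beta>))" using l \<beta> by (intro powr_mono2') auto
      finally show ?thesis .
    qed
    have "lp_norm q0 lebesgue (rep_L2 (E s (abs_L2 ?f))) \<le> ennreal (C * l powr (- (real CARD('n)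
        * \<beta>))) * ennreal (I powr (1 / p0))"
    proof -
      have "lp_norm (ennreal p0) lebesgue (rep_L2 (abs_L2 ?f)) < \<infinity>" using lp by (auto intro: le_less_trans)
      from C(2)[unfolded on_diagonal_def, rule_format, OF \<open>0 < s\<close> this]
      have "lp_norm q0 lebesgue (rep_L2 (E s (abs_L2 ?f)))
          \<le> ennreal (C * s powr (- (real CARD('n) / \<kappa>) * \<beta>))
              * lp_norm (ennreal p0) lebesgue (rep_L2 (abs_L2 ?f))"
        using p0(1) by (simp add: \<beta>_def recip_ennreal)
      also have "\<dots> \<le> ennreal (C * l powr (- (real CARD('n) * \<beta>))) * ennreal (I powr (1 / p0))"
        using s_l C(1) by (intro mult_mono lp ennreal_leI mult_left_mono) auto
      finally show ?thesis .
    qed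
    then have le: "lp_norm q0 lebesgue (rep_L2 (E s (abs_L2 ?f))) \<le> ennreal (C
        * l powr (- (real CARD('n) * \<beta>)) * I powr (1 / p0))"
      using C(1) by (simp add: ennreal_mult'')
    have "avg_norm q0 (cube c l) (rep_L2 (E s (abs_L2 ?f)))
        \<le> ennreal (vol (cube c l) powr (- recip q0) * (C * l powr (- (real CARD('n) * \<beta>))
            * I powr (1 / p0)))"
      by (rule avg_norm_le_lp_norm[OF _ _ cube_vol(2,1) _ _ le]) (use l C q0_pos in auto)
    also have "vol (cube c l) powr (- recip q0) * (C * l powr (- (real CARD('n) * \<beta>))
        * I powr (1 / p0)) = C * 3 powr (real CARD('n) / p0) * Av f c (3 * l)"
    proof -
      have "vol (cube c l) powr (- recip q0) * l powr (- (real CARD('n) * \<beta>))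
          = l powr (- (real CARD('n) / p0))"
      proof -
        have "vol (cube c l) powr (- recip q0) = l powr (real CARD('n) * (- recip q0))"
          using l by (simp add: measure_cube powr_powr flip: powr_realpow)
        then show ?thesis by (simp add: \<beta>_def algebra_simps flip: powr_add)
      qed
      moreover have "Av f c (3 * l) = I powr (1 / p0) * (3 powr (- (real CARD('n) / p0))
          * l powr (- (real CARD('n) / p0)))"
      proof -
        have "vol (cube c (3 * l)) powr (1 / p0) = 3 powr (real CARD('n) / p0)
            * l powr (real CARD('n) / p0)"
          using l by (simp add: measure_cube powr_mult powr_powr flip: powr_realpow)
        then show ?thesis using I0 l unfolding Av_def I_def[symmetric]
          by (simp add: powr_divide powr_minus field_simps)
      qed
      ultimately show ?thesis by (simp add: powr_minus field_simps)
    qed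
    finally show "avg_norm q0 (cube c l) (rep_L2 (E s (abs_L2 ?f))) \<le> ennreal (C
        * 3 powr (real CARD('n) / p0) * Av f c (3 * l))" .
  qed (use C in auto)
qed

lemma annulus_sets [measurable]: "annulus c l j \<in> sets lebesgue"
  by (simp add: annulus_def)

lemma annulus_vol:
  fixes c :: "real^'n"
  assumes "0 < l" "1 \<le> j"
  shows "2 / 3 * vol (cube c (3 ^ j * l)) \<le> vol (annulus c l j)" "emeasure lebesgue (annulus c l j)
      = ennreal (vol (annulus c l j))"
proof -
  have sub: "cube c (3 ^ (j - 1) * l) \<subseteq> cube c (3 ^ j * l)"
  proof
    fix x assume x: "x \<in> cube c (3 ^ (j - 1) * l)"
    have "3 ^ (j - 1) * l \<le> 3 ^ j * l" using assms by (intro mult_right_mono power_increasing) auto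
    show "x \<in> cube c (3 ^ j * l)"
      unfolding mem_cube_iff
    proof
      fix i
      show "c $ i - 3 ^ j * l / 2 \<le> x $ i \<and> x $ i \<le> c $ i + 3 ^ j * l / 2"
        using x[unfolded mem_cube_iff, rule_format, of i] \<open>3 ^ (j - 1) * l \<le> 3 ^ j * l\<close> by linarith
    qed
  qed
  have fin: "emeasure lebesgue (cube c (3 ^ j * l)) \<noteq> \<infinity>"
    using assms by (simp add: emeasure_cube del: emeasure_completion)
  have "vol (annulus c l j) = vol (cube c (3 ^ j * l)) - vol (cube c (3 ^ (j - 1) * l))"
    unfolding annulus_def using sub fin by (intro measure_Diff) auto
  moreover have "vol (cube c (3 ^ (j - 1) * l)) \<le> vol (cube c (3 ^ j * l)) / 3"
  proof -
    have "(3::real) ^ j = 3 * 3 ^ (j - 1)" using assms(2) by (cases j) auto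
    then have "vol (cube c (3 ^ j * l)) = 3 ^ CARD('n) * vol (cube c (3 ^ (j - 1) * l))"
      using assms by (simp add: measure_cube power_mult_distrib)
    also have "\<dots> \<ge> 3 ^ 1 * vol (cube c (3 ^ (j - 1) * l))"
      by (intro mult_right_mono power_increasing) (auto simp: Suc_le_eq)
    finally show ?thesis by simp
  qed
  ultimately show "2 / 3 * vol (cube c (3 ^ j * l)) \<le> vol (annulus c l j)" by simp
  have "emeasure lebesgue (annulus c l j) \<le> emeasure lebesgue (cube c (3 ^ j * l))"
    by (intro emeasure_mono) (auto simp: annulus_def)
  then show "emeasure lebesgue (annulus c l j) = ennreal (vol (annulus c l j))"
    using fin by (intro emeasure_eq_ennreal_measure) (auto simp: top_unique simp del: emeasure_completion)
qed

text \<open>With s^(1/\<kappa>) between l and 3l the ratio r = 3^j l / s^(1/\<kappa>) is at least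
  3^(j-1). The maximum in (A2) is then r^n, and r^n (1 + r)^(-n-\<epsilon>) <= r^(-\<epsilon>)
  leaves the decay 3^(-\<epsilon> j).\<close>

lemma far_estimate:
  obtains C where "0 \<le> C" "\<And>f c l s j. bounded_comp_supp f \<Longrightarrow> 0 < l \<Longrightarrow> 0 < s \<Longrightarrow> l \<le> s powr (1 / \<kappa>)
      \<Longrightarrow> s powr (1 / \<kappa>) \<le> 3 * l \<Longrightarrow> 2 \<le> j \<Longrightarrow>
    avg_norm q0 (cube c l) (rep_L2 (E s (abs_L2 (\<lambda>x. f x * indicator (annulus c l j) x))))
        \<le> ennreal (C * (3 powr (- (\<epsilon> * real j)) * Av f c (3 ^ j * l)))"
proof -
  obtain C where C: "0 \<le> C" "off_diagonal (ennreal p0) q0 C"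
    using A2_exp[of "ennreal p0" q0] less_imp_le[OF p0(2)] by auto
  define D where "D = C * 4 powr (real CARD('n) * recip q0) * 3 powr \<epsilon>"
  have D0: "0 \<le> D" using C(1) by (simp add: D_def)
  show thesis
  proof (rule that[of "D * 2"])
    fix f :: "real^'n \<Rightarrow> complex" and c l s and j :: nat
    assume f: "bounded_comp_supp f" and l: "0 < l" "0 < s" "l \<le> s powr (1 / \<kappa>)" "s powr (1 / \<kappa>) \<le> 3
        * l" and j: "2 \<le> j"
    let ?f = "\<lambda>x. f x * indicator (annulus c l j) x"
    let ?Q = "cube c (3 ^ j * l)"
    define I where "I = wint (\<lambda>x. norm (f x) powr p0) ?Q"
    have I0: "0 \<le> I" unfolding I_def by (rule wint_nonneg) simp
    have f': "bounded_comp_supp ?f" by (rule bcs_restrict[OF f]) simp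
    have rep: "AE x in lebesgue. rep_L2 (abs_L2 ?f) x = ?f x" by (rule rep_abs_L2[OF bcs_square_int[OF f']])
    define r where "r = 3 ^ j * l / s powr (1/\<kappa>)"
    have r: "3 ^ j / 3 \<le> r" "1 \<le> r"
    proof -
      have "3 ^ j / 3 = 3 ^ j * l / (3 * l)" using l by simp
      also have "\<dots> \<le> r" unfolding r_def using l by (intro divide_left_mono) auto
      finally show "3 ^ j / 3 \<le> r" .
      moreover have "(3::real) ^ 1 \<le> 3 ^ j" using j by (intro power_increasing) auto
      ultimately show "1 \<le> r" by simp
    qed
    have vQ: "0 < vol ?Q" by (rule cube_vol) (use l in simp)
    note av = annulus_vol[OF l(1), of j c]
    have vA: "0 < vol (annulus c l j)" using av(1) j vQ by linarith
    have avg: "avg_norm (ennreal p0) (annulus c l j) (rep_L2 (abs_L2 ?f)) \<le> ennreal (2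
        * Av f c (3 ^ j * l))"
    proof (subst avg_norm_le_iff)
      have "(\<integral>\<^sup>+x\<in>annulus c l j. ennreal (norm (rep_L2 (abs_L2 ?f) x) powr p0) \<partial>lebesgue)
          = (\<integral>\<^sup>+x. ennreal (norm (?f x) powr p0) \<partial>lebesgue)"
      proof (rule nn_integral_cong_AE, use rep in eventually_elim)
        case (elim x)
        then show ?case using p0(1) by (cases "x \<in> annulus c l j") auto
      qed
      also have "\<dots> \<le> (\<integral>\<^sup>+x. ennreal (indicator ?Q x *\<^sub>R norm (f x) powr p0) \<partial>lebesgue)"
        by (intro nn_integral_mono) (auto simp: indicator_def annulus_def)
      also have "\<dots> = ennreal I"
        unfolding I_def wint_def set_lebesgue_integral_def
        using bcs_integrable[OF f, of p0] p0(1)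
        by (intro nn_integral_eq_integral integrable_mult_indicator[of ?Q, simplified]) auto
      \<comment> \<open>The factor 2 pays for replacing the annulus by the full cube: 2^p0 >= 2, and
        the annulus has at least 2/3 of the volume.\<close>
      also have "I \<le> (2 * Av f c (3 ^ j * l)) powr p0 * vol (annulus c l j)"
      proof -
        have "(2 * Av f c (3 ^ j * l)) powr p0 = 2 powr p0 * (I / vol ?Q)"
          using I0 vQ p0(1) unfolding Av_def I_def[symmetric] by (simp add: powr_mult powr_powr)
        moreover have "2 powr 1 \<le> 2 powr p0" using p0(1) by (intro powr_mono) auto
        then have "2 * (I / vol ?Q) \<le> 2 powr p0 * (I / vol ?Q)" using I0 vQ by (intro mult_right_mono) auto
        ultimately have "2 * (I / vol ?Q) * (2 / 3 * vol ?Q) \<le> (2 * Av f c (3 ^ j * l)) powr p0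
            * vol (annulus c l j)"
          using av(1) j I0 vQ by (intro mult_mono) auto
        moreover have "2 * (I / vol ?Q) * (2 / 3 * vol ?Q) = 4 / 3 * I" using vQ by simp
        ultimately show ?thesis using I0 by linarith
      qed
      finally show "(\<integral>\<^sup>+x\<in>annulus c l j. ennreal (norm (rep_L2 (abs_L2 ?f) x) powr p0) \<partial>lebesgue)
          \<le> ennreal ((2 * Av f c (3 ^ j * l)) powr p0 * vol (annulus c l j))"
        by (simp add: ennreal_leI)
    qed (use av(2) j vA p0(1) Av_nonneg in auto)
    have "avg_norm q0 (cube c l) (rep_L2 (E s (abs_L2 ?f))) \<le> ennreal (C
        * max (r powr real CARD('n)) (r powr (real CARD('n) * recip (ennreal p0)))
        * (1 + s powr (1/\<kappa>) / l) powr (real CARD('n) * recip q0)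
        * (1 + r) powr (- real CARD('n) - \<epsilon>)) * avg_norm (ennreal p0) (annulus c l j) (rep_L2 (abs_L2 ?f))"
      unfolding r_def
    proof (rule C(2)[unfolded off_diagonal_def, rule_format, OF l(2,1) j])
      show "lp_norm (ennreal p0) lebesgue (rep_L2 (abs_L2 ?f)) < \<infinity>"
        using lp_norm_bcs[OF f', of p0] p0(1) by (auto intro: le_less_trans)
      show "AE x in lebesgue. x \<notin> annulus c l j \<longrightarrow> rep_L2 (abs_L2 ?f) x = 0"
        using rep by eventually_elim simp
    qed
    also have "\<dots> \<le> ennreal (D * 3 powr (- (\<epsilon> * real j))) * ennreal (2 * Av f c (3 ^ j * l))"
    proof (rule mult_mono[OF ennreal_leI avg])
      have f1: "max (r powr real CARD('n)) (r powr (real CARD('n) * recip (ennreal p0)))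
          = r powr real CARD('n)"
      proof -
        have "real CARD('n) * recip (ennreal p0) \<le> real CARD('n) * 1"
          using p0(1) by (intro mult_left_mono) (auto simp: recip_ennreal)
        then have "r powr (real CARD('n) * recip (ennreal p0)) \<le> r powr real CARD('n)"
          using r(2) by (intro powr_mono) auto
        then show ?thesis by (rule max_absorb1)
      qed
      have f2: "(1 + s powr (1/\<kappa>) / l) powr (real CARD('n) * recip q0) \<le> 4 powr (real CARD('n) * recip q0)"
        using l by (intro powr_mono2) (auto simp: field_simps recip_def)
      have f3: "r powr real CARD('n) * (1 + r) powr (- real CARD('n) - \<epsilon>) \<le> 3 powr \<epsilon> * 3 powr (- (\<epsilon>
          * real j))"
      proof -
        have "(1 + r) powr (- real CARD('n) - \<epsilon>) \<le> r powr (- real CARD('n) - \<epsilon>)" using r(2) \<epsilon>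
            by (intro powr_mono2') auto
        then have "r powr real CARD('n) * (1 + r) powr (- real CARD('n) - \<epsilon>) \<le> r powr real CARD('n)
            * r powr (- real CARD('n) - \<epsilon>)" by (intro mult_left_mono) auto
        also have "\<dots> = r powr (- \<epsilon>)" by (simp flip: powr_add)
        also have "\<dots> \<le> (3 ^ j / 3) powr (- \<epsilon>)" using r \<epsilon> by (intro powr_mono2') auto
        also have "\<dots> = 3 powr \<epsilon> * 3 powr (- (\<epsilon> * real j))"
        proof -
          have "(3 :: real) ^ j / 3 = 3 powr (real j - 1)" by (simp add: powr_diff powr_realpow)
          then have "((3 :: real) ^ j / 3) powr (- \<epsilon>) = 3 powr ((real j - 1) * (- \<epsilon>))"
              by (simp only: powr_powr)
          also have "(real j - 1) * (- \<epsilon>) = \<epsilon> + - (\<epsilon> * real j)" by (simp add: algebra_simps)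
          finally show ?thesis by (simp only: powr_add)
        qed
        finally show ?thesis .
      qed
      have "C * (1 + s powr (1/\<kappa>) / l) powr (real CARD('n) * recip q0) * (r powr real CARD('n) * (1
          + r) powr (- real CARD('n) - \<epsilon>))
          \<le> C * 4 powr (real CARD('n) * recip q0) * (3 powr \<epsilon> * 3 powr (- (\<epsilon> * real j)))"
        by (intro mult_mono[OF mult_left_mono[OF f2 C(1)] f3]) (use C(1) in auto)
      then show "C * max (r powr real CARD('n)) (r powr (real CARD('n) * recip (ennreal p0))) * (1
          + s powr (1/\<kappa>) / l) powr (real CARD('n) * recip q0) * (1 + r) powr (- real CARD('n) - \<epsilon>)
          \<le> D * 3 powr (- (\<epsilon> * real j))"
        unfolding f1 by (simp add: D_def mult_ac)
    qed auto
    also have "\<dots> = ennreal (D * 2 * (3 powr (- (\<epsilon> * real j)) * Av f c (3 ^ j * l)))"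
      using D0 by (simp add: Av_nonneg mult_ac flip: ennreal_mult)
    finally show "avg_norm q0 (cube c l) (rep_L2 (E s (abs_L2 ?f))) \<le> ennreal (D * 2 * (3 powr (- (\<epsilon>
        * real j)) * Av f c (3 ^ j * l)))" .
  qed (use D0 in auto)
qed

end

section \<open>Domination by the bilinear form on the grids\<close>

definition test_fun :: "(real^'n \<Rightarrow> real) \<Rightarrow> bool" where
  "test_fun h \<longleftrightarrow> (\<forall>x. 0 \<le> h x) \<and> bounded_comp_supp (\<lambda>x. complex_of_real (h x))"

lemma test_fun_measurable: "test_fun h \<Longrightarrow> h \<in> borel_measurable lebesgue"
proof -
  assume "test_fun h"
  then have [measurable]: "(\<lambda>x. complex_of_real (h x)) \<in> borel_measurable lebesgue"
    by (simp add: test_fun_def bounded_comp_supp_def)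
  have "(\<lambda>x. Re (complex_of_real (h x))) \<in> borel_measurable lebesgue" by measurable
  then show ?thesis by simp
qed

lemma test_fun_integrable: "test_fun h \<Longrightarrow> 0 < p \<Longrightarrow> integrable lebesgue (\<lambda>x. h x powr p)"
  using bcs_integrable[of "\<lambda>x. complex_of_real (h x)" p] by (simp add: test_fun_def)

lemma test_fun_bounded_support: "test_fun h \<Longrightarrow> bounded {x. h x \<noteq> 0}"
  unfolding test_fun_def bounded_comp_supp_def
  by (auto dest!: compact_imp_bounded intro: bounded_subset[OF _ closure_subset])

lemma integrable_imp_set_integrable:
  fixes f :: "'a \<Rightarrow> real"
  assumes "integrable M f" "A \<in> sets M"
  shows "set_integrable M A f"
  using integrable_mult_indicator[OF assms(2,1)] by (simp add: set_integrable_def)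

lemma test_fun_sq_weight:
  assumes "test_fun h" "Q \<in> sets lebesgue"
  shows "sq_weight (\<lambda>x. h x * indicator Q x)"
proof -
  have "integrable lebesgue (\<lambda>x. indicator Q x *\<^sub>R (h x powr 2))"
    by (rule integrable_mult_indicator[OF assms(2) test_fun_integrable[OF assms(1)]]) simp
  moreover have "indicator Q x *\<^sub>R (h x powr 2) = (h x * indicator Q x)\<^sup>2" for x
    using assms(1) by (simp add: test_fun_def indicator_def)
  ultimately show ?thesis
    using assms test_fun_measurable[OF assms(1)] by (auto simp: sq_weight_def test_fun_def)
qed

lemma test_fun_sq_weight': "test_fun h \<Longrightarrow> sq_weight h"
  using test_fun_sq_weight[of h UNIV] by simp

lemma wint_cell_eq_cube:
  "w \<in> borel_measurable lebesgue \<Longrightarrow> wint w (cell b k m) = wint w (cube (cell_center b k m) (3 powi k))"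
  unfolding wint_def set_lebesgue_integral_def
  by (rule integral_cong_AE) (use AE_cell_iff_cube[of b k m]
      in \<open>auto simp: indicator_def elim: eventually_mono\<close>)

lemma vol_cell_eq_cube: "vol (cell b k m) = vol (cube (cell_center b k m) (3 powi k))"
  by (simp add: measure_cell measure_cube)

lemma sum_wint_le:
  assumes "finite S" "disjoint_family_on (\<lambda>Q. Q) S" "\<And>Q. Q \<in> S \<Longrightarrow> Q \<in> sets lebesgue" "\<And>Q. Q \<in> S \<Longrightarrow> Q \<subseteq> R"
    and w: "\<And>x. 0 \<le> w x" "set_integrable lebesgue R w"
  shows "(\<Sum>Q\<in>S. wint w Q) \<le> wint w R"
proof -
  have "(LINT x:(\<Union>Q\<in>S. Q)|lebesgue. w x) = (\<Sum>Q\<in>S. LINT x:Q|lebesgue. w x)"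
  proof (rule set_integral_finite_Union)
    show "set_integrable lebesgue Q w" if "Q \<in> S" for Q
      using assms that by (intro set_integrable_subset[OF w(2)]) auto
  qed (use assms in auto)
  moreover have "wint w (\<Union>Q\<in>S. Q) \<le> wint w R"
    using assms by (intro wint_mono) (auto intro!: sets.finite_UN)
  ultimately show ?thesis by (simp add: wint_def)
qed

lemma wint_one: "Q \<in> sets lebesgue \<Longrightarrow> wint (\<lambda>x. 1) Q = vol Q"
  by (simp add: wint_def set_lebesgue_integral_def)

text \<open>Jensen's inequality for the concave power 1/s, with the cells weighted by volume. The
  power is replaced by its tangent at the mean X over R, and both terms of the tangent are additive
  over disjoint sets.\<close>

lemma sum_vol_mean_le:
  assumes S: "finite S" "disjoint_family_on (\<lambda>Q. Q) S" "\<And>Q. Q \<in> S \<Longrightarrow> Q \<in> sets lebesgue" "\<And>Q. Q \<in> S \<Longrightarrow> Q \<subseteq> R"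
    and vol: "\<And>Q. Q \<in> S \<Longrightarrow> 0 < vol Q" "0 < vol R" "set_integrable lebesgue R (\<lambda>x. 1 :: real)"
    and w: "\<And>x. 0 \<le> w x" "set_integrable lebesgue R w" and s: "1 \<le> s"
  shows "(\<Sum>Q\<in>S. vol Q * (wint w Q / vol Q) powr (1 / s)) \<le> vol R * (wint w R / vol R) powr (1 / s)"
proof -
  have R: "R \<in> sets lebesgue" using vol(2) by (metis less_irrefl measure_notin_sets)
  have w0: "0 \<le> wint w Q" for Q by (rule wint_nonneg) (rule w)
  have wQ: "wint w Q \<le> wint w R" if "Q \<in> S" for Q using that S w by (intro wint_mono) auto
  define X where "X = wint w R / vol R"
  show ?thesis
  proof (cases "wint w R = 0")
    case True
    then have "wint w Q = 0" if "Q \<in> S" for Q using wQ[OF that] w0[of Q] by simp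
    then show ?thesis using True by simp
  next
    case False
    then have X: "0 < X" using w0[of R] vol(2) by (simp add: X_def less_le)
    have "(\<Sum>Q\<in>S. vol Q * (wint w Q / vol Q) powr (1 / s)) \<le> (\<Sum>Q\<in>S. X powr (1 / s) * ((1 / s)
        * (wint w Q / X) + (1 - 1 / s) * wint (\<lambda>x. 1) Q))"
    proof (rule sum_mono)
      fix Q assume Q: "Q \<in> S"
      let ?t = "wint w Q / vol Q / X"
      have t0: "0 \<le> ?t" using w0[of Q] vol(1)[OF Q] X by simp
      have "?t powr (1 / s) \<le> (1 / s) * ?t + (1 - 1 / s)"
      proof (cases "?t = 0")
        case False
        then have "0 < ?t" using t0 by linarith
        then have "?t powr (1 / s) * 1 powr (1 - 1 / s) \<le> (1 / s) * ?t + (1 - 1 / s) * 1"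
          using s by (intro Youngs_inequality_0) simp_all
        then show ?thesis by simp
      next
        case True
        show ?thesis unfolding True using s by simp
      qed
      then have "vol Q * X powr (1 / s) * ?t powr (1 / s) \<le> vol Q * X powr (1 / s) * ((1 / s) * ?t
          + (1 - 1 / s))"
        using vol(1)[OF Q] by (intro mult_left_mono) auto
      moreover have "(wint w Q / vol Q) powr (1 / s) = X powr (1 / s) * ?t powr (1 / s)"
        using X t0 by (simp flip: powr_mult)
      ultimately have "vol Q * (wint w Q / vol Q) powr (1 / s) \<le> vol Q * X powr (1 / s) * ((1 / s)
          * ?t + (1 - 1 / s))"
        by (simp add: mult.assoc)
      also have "\<dots> = X powr (1 / s) * ((1 / s) * (vol Q * ?t) + (1 - 1 / s) * vol Q)"
        by (simp add: algebra_simps)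
      also have "vol Q * ?t = wint w Q / X" using vol(1)[OF Q] by simp
      finally show "vol Q * (wint w Q / vol Q) powr (1 / s) \<le> X powr (1 / s) * ((1 / s)
          * (wint w Q / X) + (1 - 1 / s) * wint (\<lambda>x. 1) Q)"
        using S(3)[OF Q] by (simp add: wint_one)
    qed
    also have "\<dots> = X powr (1 / s) * ((1 / s) * ((\<Sum>Q\<in>S. wint w Q) / X) + (1 - 1 / s)
        * (\<Sum>Q\<in>S. wint (\<lambda>x. 1) Q))"
      unfolding sum_distrib_left[symmetric] sum.distrib sum_divide_distrib ..
    also have "\<dots> \<le> X powr (1 / s) * ((1 / s) * (wint w R / X) + (1 - 1 / s) * wint (\<lambda>x. 1) R)"
      using s X S w vol by (intro mult_left_mono add_mono divide_right_mono sum_wint_le) auto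
    also have "\<dots> = vol R * (wint w R / vol R) powr (1 / s)"
    proof -
      have "wint w R / X = vol R" using False vol(2) by (simp add: X_def)
      then show ?thesis by (simp add: wint_one[OF R] X_def[symmetric] algebra_simps)
    qed
    finally show ?thesis .
  qed
qed

section \<open>Localised pairings and regrouping of cells\<close>

context frac_setup
begin

text \<open>The conjugate exponent of q0, written with the reciprocal so that q0 = \<infinity> gives
  1.\<close>

definition s0 :: real where "s0 = 1 / (1 - recip q0)"

lemma s0: "1 / s0 = 1 - recip q0" "1 \<le> s0" "1 < q0"
proof -
  show q0: "1 < q0" using p0 by (metis ennreal_1 ennreal_leI le_less_trans)
  have "recip q0 < 1"
  proof (cases q0)
    case (real r)
    then have "1 < r" using q0 by (metis ennreal_1 ennreal_less_iff zero_le_one)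
    then show ?thesis using real by (simp add: recip_ennreal)
  qed (simp add: recip_infinity)
  moreover have "0 \<le> recip q0" by (simp add: recip_def)
  ultimately show "1 / s0 = 1 - recip q0" "1 \<le> s0" by (simp_all add: s0_def)
qed

definition Fav :: "(real^'n \<Rightarrow> complex) \<Rightarrow> (real^'n) set \<Rightarrow> real" where
  "Fav f R = (wint (\<lambda>x. norm (f x) powr p0) R / vol R) powr (1 / p0)"

definition Hav :: "(real^'n \<Rightarrow> real) \<Rightarrow> (real^'n) set \<Rightarrow> real" where
  "Hav h R = (wint (\<lambda>x. h x powr s0) R / vol R) powr (1 / s0)"

lemma Hav_nonneg: "0 \<le> Hav h R" and Fav_nonneg: "0 \<le> Fav f R"
  by (simp_all add: Hav_def Fav_def)

lemma wnorm_le_avg_norm: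
  assumes h: "test_fun h" and l: "0 < l" and a: "0 \<le> a" "avg_norm q0 (cube c l) (rep_L2 F) \<le> ennreal a"
  shows "wnorm (\<lambda>x. h x * indicator (cube c l) x) F \<le> vol (cube c l) * Hav h (cube c l) * a"
proof -
  have "ennreal (wnorm (\<lambda>x. h x * indicator (cube c l) x) F)
      = (\<integral>\<^sup>+x. ennreal (norm (rep_L2 F x) * (h x * indicator (cube c l) x)) \<partial>lebesgue)"
    unfolding wnorm_def
    using wnorm_integrable(1)[OF test_fun_sq_weight[OF h], of "cube c l" F] h
    by (intro nn_integral_eq_integral[symmetric]) (auto simp: test_fun_def)
  also have "\<dots> \<le> ennreal (vol (cube c l) * a * (wint (\<lambda>x. h x powr s0) (cube c l) / vol (cube c l))
      powr (1 / s0))"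
  proof (rule nn_integral_pairing_le[OF _ _ cube_vol(2,1) s0(3,1) a(1,2)])
    show "set_integrable lebesgue (cube c l) (\<lambda>x. h x powr s0)"
      using s0(2) by (intro integrable_imp_set_integrable test_fun_integrable[OF h]) auto
  qed (use l h in \<open>auto simp: test_fun_def intro: test_fun_measurable[OF h]\<close>)
  finally show ?thesis
    using l a by (subst (asm) ennreal_le_iff) (auto simp: Hav_def mult_ac)
qed

lemma cube_mono:
  fixes c :: "real^'n"
  shows "l \<le> l' \<Longrightarrow> cube c l \<subseteq> cube c l'"
proof
  fix x assume l: "l \<le> l'" and x: "x \<in> cube c l"
  show "x \<in> cube c l'"
    unfolding mem_cube_iff
  proof
    fix i show "c $ i - l' / 2 \<le> x $ i \<and> x $ i \<le> c $ i + l' / 2"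
      using x[unfolded mem_cube_iff, rule_format, of i] l by linarith
  qed
qed

text \<open>f is split into its part on 3Q and its parts on the annuli. As its support is bounded,
  finitely many pieces suffice, so additivity of the semigroup is enough and no infinite sum of
  vectors appears; the constant does not depend on their number.\<close>

lemma local_estimate:
  obtains C where "0 \<le> C" "\<And>f h c l s J. bounded_comp_supp f \<Longrightarrow> test_fun h \<Longrightarrow> 0 < l \<Longrightarrow> 0 < s \<Longrightarrow>
    l \<le> s powr (1 / \<kappa>) \<Longrightarrow> s powr (1 / \<kappa>) \<le> 3 * l \<Longrightarrow> 1 \<le> J \<Longrightarrow> {x. f x \<noteq> 0} \<subseteq> cube c (3 ^ J * l) \<Longrightarrow>
    wnorm (\<lambda>x. h x * indicator (cube c l) x) (E s (abs_L2 f))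
      \<le> C * (vol (cube c l) * Hav h (cube c l) * (\<Sum>j\<in>{1..J}. 3 powr (- (\<epsilon> * real j)) * Av f c (3 ^ j * l)))"
proof -
  obtain C1 where C1: "0 \<le> C1" "\<And>f c l s. bounded_comp_supp f \<Longrightarrow> 0 < l \<Longrightarrow> 0 < s \<Longrightarrow> l \<le> s powr (1 / \<kappa>) \<Longrightarrow>
    avg_norm q0 (cube c l) (rep_L2 (E s (abs_L2 (\<lambda>x. f x * indicator (cube c (3 * l)) x))))
        \<le> ennreal (C1 * Av f c (3 * l))"
    by (rule near_estimate) (rule that)
  obtain C2 where C2: "0 \<le> C2" "\<And>f c l s j. bounded_comp_supp f \<Longrightarrow> 0 < l \<Longrightarrow> 0 < s \<Longrightarrow> l \<le> s powr (1 / \<kappa>)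
      \<Longrightarrow> s powr (1 / \<kappa>) \<le> 3 * l \<Longrightarrow> 2 \<le> j \<Longrightarrow>
    avg_norm q0 (cube c l) (rep_L2 (E s (abs_L2 (\<lambda>x. f x * indicator (annulus c l j) x))))
        \<le> ennreal (C2 * (3 powr (- (\<epsilon> * real j)) * Av f c (3 ^ j * l)))"
    by (rule far_estimate) (rule that)
  \<comment> \<open>The factor 3^\<epsilon> undoes the decay weight attached to j = 1, which the
    near part does not carry.\<close>
  define C where "C = C1 * 3 powr \<epsilon> + C2"
  show thesis
  proof (rule that[of C])
    fix f :: "real^'n \<Rightarrow> complex" and h :: "real^'n \<Rightarrow> real" and c :: "real^'n" and l s :: real and J :: nat
    assume f: "bounded_comp_supp f" and h: "test_fun h" and l: "0 < l" "0 < s" "l \<le> s powr (1 / \<kappa>)"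
        "s powr (1 / \<kappa>) \<le> 3 * l"
      and J: "1 \<le> J" "{x. f x \<noteq> 0} \<subseteq> cube c (3 ^ J * l)"
    let ?g = "\<lambda>x. h x * indicator (cube c l) x"
    let ?V = "vol (cube c l) * Hav h (cube c l)"
    let ?T = "\<lambda>j :: nat. 3 powr (- (\<epsilon> * real j)) * Av f c (3 ^ j * l)"
    have g: "sq_weight ?g" by (rule test_fun_sq_weight[OF h]) simp
    have V0: "0 \<le> ?V" by (simp add: Hav_nonneg)
    have T0: "0 \<le> ?T j" for j by (simp add: Av_nonneg)
    have bcs: "bounded_comp_supp (\<lambda>x. f x * indicator A x)" if "A \<in> sets lebesgue" for A
      by (rule bcs_restrict[OF f that])
    have main: "wnorm ?g (E s (abs_L2 (\<lambda>x. f x * indicator (cube c (3 ^ Suc i * l)) x))) \<le> C * (?V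
        * (\<Sum>j\<in>{1..Suc i}. ?T j))" for i
    proof (induction i)
      case 0
      have "wnorm ?g (E s (abs_L2 (\<lambda>x. f x * indicator (cube c (3 * l)) x))) \<le> ?V * (C1 * Av f c (3 * l))"
        by (rule wnorm_le_avg_norm[OF h l(1) _ C1(2)[OF f l(1-3)]]) (use C1(1) Av_nonneg in auto)
      also have "C1 * Av f c (3 * l) \<le> C * ?T 1"
      proof -
        have "C1 * Av f c (3 * l) = C1 * 3 powr \<epsilon> * ?T 1" by (simp add: powr_minus)
        also have "\<dots> \<le> C * ?T 1" unfolding C_def using C2(1) T0[of 1] by (intro mult_right_mono) auto
        finally show ?thesis .
      qed
      then have "?V * (C1 * Av f c (3 * l)) \<le> ?V * (C * ?T 1)" using V0 by (rule mult_left_mono)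
      finally show ?case by (simp add: mult_ac)
    next
      case (Suc i)
      let ?A = "cube c (3 ^ Suc i * l)" and ?B = "annulus c l (Suc (Suc i))"
      have AB: "indicator (cube c (3 ^ Suc (Suc i) * l)) x = (indicator ?A x
          + indicator ?B x :: complex)" for x
        using cube_mono[of "3 ^ Suc i * l" "3 ^ Suc (Suc i) * l" c] l(1)
        by (auto simp: indicator_def annulus_def)
      have "abs_L2 (\<lambda>x. f x * indicator (cube c (3 ^ Suc (Suc i) * l)) x)
        = abs_L2 (\<lambda>x. f x * indicator ?A x) + abs_L2 (\<lambda>x. f x * indicator ?B x)"
        unfolding AB distrib_left by (rule abs_L2_add[symmetric]) (intro bcs_square_int bcs; simp)+
      then have "wnorm ?g (E s (abs_L2 (\<lambda>x. f x * indicator (cube c (3 ^ Suc (Suc i) * l)) x)))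
        \<le> wnorm ?g (E s (abs_L2 (\<lambda>x. f x * indicator ?A x))) + wnorm ?g (E s (abs_L2 (\<lambda>x. f x
            * indicator ?B x)))"
        using wnorm_add[OF g] E_add[OF l(2)] by simp
      also have "wnorm ?g (E s (abs_L2 (\<lambda>x. f x * indicator ?B x))) \<le> ?V * (C2 * ?T (Suc (Suc i)))"
        by (rule wnorm_le_avg_norm[OF h l(1) _ C2(2)[OF f l]]) (use C2(1) Av_nonneg in auto)
      also have "\<dots> \<le> ?V * (C * ?T (Suc (Suc i)))"
        by (rule mult_left_mono[OF mult_right_mono[OF _ T0] V0]) (use C1(1) in \<open>simp add: C_def\<close>)
      finally show ?case using Suc.IH by (simp add: algebra_simps)
    qed
    have eq: "(\<lambda>x. f x * indicator (cube c (3 ^ J * l)) x) = f"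
    proof
      show "f x * indicator (cube c (3 ^ J * l)) x = f x" for x
        using J(2) by (cases "f x = 0") auto
    qed
    have "Suc (J - 1) = J" using J(1) by simp
    then show "wnorm ?g (E s (abs_L2 f)) \<le> C * (?V * (\<Sum>j\<in>{1..J}. ?T j))"
      using main[of "J - 1"] unfolding eq by (simp only: eq)
  qed (use C1 C2 in \<open>simp add: C_def\<close>)
qed

text \<open>The cube \<open>3\<^sup>j Q\<close> lies in a cell of comparable size of one of the shifted grids. The small
  cells in a given large one are disjoint, so they are absorbed by Jensen's inequality.\<close>
lemma regroup:
  fixes I :: "(int \<times> ('n \<Rightarrow> int)) set"
  assumes f: "bounded_comp_supp f" and h: "test_fun h" and I: "finite I" and \<eta>: "0 < \<eta>"
    and W: "\<And>(b :: 'n set) \<Q>. finite \<Q> \<Longrightarrow> \<Q> \<subseteq> grid b \<Longrightarrow> (\<Sum>R\<in>\<Q>. vol R powr (1 + \<eta>) * (Fav f R * Hav h R)) \<le> W"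
  shows "(\<Sum>(k, m)\<in>I. vol (cell {} k m) powr (1 + \<eta>) * Hav h (cell {} k m)
      * Av f (cell_center {} k m) (3 ^ j * 3 powi k))
    \<le> 3 powr (real CARD('n) / p0) * (real CARD('n set) * W)"
proof -
  let ?Q = "\<lambda>i :: int \<times> ('n \<Rightarrow> int). cell {} (fst i) (snd i)"
  let ?c = "\<lambda>i :: int \<times> ('n \<Rightarrow> int). cell_center {} (fst i) (snd i)"
  \<comment> \<open>One generation above 3^j Q: its side is a third of that of the cell, hence less
    than half of it, as the covering by shifted cells requires.\<close>
  let ?k = "\<lambda>i :: int \<times> ('n \<Rightarrow> int). fst i + int j + 1"
  have "\<exists>b m'. cube (?c i) (3 ^ j * 3 powi fst i) \<subseteq> cell b (?k i) m'" for i
  proof (rule cube_subset_cell)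
    show "3 ^ j * 3 powi fst i < 3 powi ?k i / (2 :: real)"
      by (simp add: power_int_add)
  qed simp
  then obtain bb mm where sub: "\<And>i. cube (?c i) (3 ^ j * 3 powi fst i) \<subseteq> cell (bb i) (?k i) (mm i)" by metis
  define R where "R i = cell (bb i) (?k i) (mm i)" for i
  have QR: "?Q i \<subseteq> R i" for i
  proof -
    have "?Q i \<subseteq> cube (?c i) (3 powi fst i)" by (rule cell_subset_cube)
    also have "\<dots> \<subseteq> cube (?c i) (3 ^ j * 3 powi fst i)" by (rule cube_mono) simp
    finally show ?thesis using sub[of i] by (simp add: R_def)
  qed
  have volR: "vol (R i) = 3 ^ CARD('n) * vol (cube (?c i) (3 ^ j * 3 powi fst i))" for i
    by (simp add: R_def measure_cell measure_cube power_int_add power_mult_distrib)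
  have Rpos: "0 < vol (R i)" for i by (simp add: R_def vol_cell_pos)
  have int_f: "set_integrable lebesgue A (\<lambda>x. norm (f x) powr p0)" if "A \<in> sets lebesgue" for A
    using that p0(1) by (intro integrable_imp_set_integrable bcs_integrable[OF f]) auto
  have int_h: "set_integrable lebesgue A (\<lambda>x. h x powr s0)" if "A \<in> sets lebesgue" for A
    using that s0(2) by (intro integrable_imp_set_integrable test_fun_integrable[OF h]) auto
  have Av: "Av f (?c i) (3 ^ j * 3 powi fst i) \<le> 3 powr (real CARD('n) / p0) * Fav f (R i)" for i
  proof -
    let ?cu = "cube (?c i) (3 ^ j * 3 powi fst i)"
    have pos: "0 < vol ?cu" by (rule cube_vol) simp
    have "wint (\<lambda>x. norm (f x) powr p0) ?cu \<le> wint (\<lambda>x. norm (f x) powr p0) (R i)"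
      using sub[of i] by (intro wint_mono int_f) (auto simp: R_def)
    then have "wint (\<lambda>x. norm (f x) powr p0) ?cu / vol ?cu \<le> 3 ^ CARD('n)
        * (wint (\<lambda>x. norm (f x) powr p0) (R i) / vol (R i))"
      using pos by (simp add: volR divide_right_mono)
    then have "Av f (?c i) (3 ^ j * 3 powi fst i) \<le> (3 ^ CARD('n)
        * (wint (\<lambda>x. norm (f x) powr p0) (R i) / vol (R i))) powr (1 / p0)"
      unfolding Av_def using p0(1) wint_nonneg[of "\<lambda>x. norm (f x) powr p0" ?cu] pos
      by (intro powr_mono2) auto
    also have "\<dots> = 3 powr (real CARD('n) / p0) * Fav f (R i)"
      unfolding Fav_def using wint_nonneg[of "\<lambda>x. norm (f x) powr p0" "R i"]
      by (subst powr_mult) (auto simp: powr_powr simp flip: powr_realpow)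
    finally show ?thesis .
  qed
  define t where "t S = vol S powr (1 + \<eta>) * (Fav f S * Hav h S)" for S
  \<comment> \<open>The grid is recorded together with the large cell, because the bound W holds for
    one grid at a time.\<close>
  define \<rho> where "\<rho> i = (bb i, R i)" for i
  have fin: "finite {S. (b, S) \<in> \<rho> ` I}" for b
  proof (rule finite_subset)
    show "{S. (b, S) \<in> \<rho> ` I} \<subseteq> snd ` (\<rho> ` I)" by (metis image_eqI mem_Collect_eq snd_conv subsetI)
  qed (use I in simp)
  have "(\<Sum>(k, m)\<in>I. vol (cell {} k m) powr (1 + \<eta>) * Hav h (cell {} k m)
      * Av f (cell_center {} k m) (3 ^ j * 3 powi k))
      = (\<Sum>i\<in>I. vol (?Q i) powr (1 + \<eta>) * Hav h (?Q i) * Av f (?c i) (3 ^ j * 3 powi fst i))"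
    by (simp add: case_prod_unfold)
  also have "\<dots> \<le> (\<Sum>i\<in>I. vol (R i) powr \<eta> * (vol (?Q i) * Hav h (?Q i))
      * (3 powr (real CARD('n) / p0) * Fav f (R i)))"
  proof (rule sum_mono)
    fix i
    have volQ: "0 < vol (?Q i)" by (rule vol_cell_pos)
    have "vol (?Q i) \<le> vol (R i)"
      using QR[of i] emeasure_cell[of "bb i" "?k i" "mm i"]
      by (intro measure_mono_fmeasurable) (auto simp: R_def fmeasurable_def simp del: emeasure_completion)
    \<comment> \<open>Only the excess power \<eta> is enlarged to the large cell. One full power of
      the small volume is kept as the weight in Jensen's inequality.\<close>
    then have "vol (?Q i) powr (1 + \<eta>) \<le> vol (R i) powr \<eta> * vol (?Q i)"
      using volQ \<eta> by (simp add: powr_add mult_right_mono powr_mono2 mult.commute)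
    then have "vol (?Q i) powr (1 + \<eta>) * Hav h (?Q i) * Av f (?c i) (3 ^ j * 3 powi fst i)
      \<le> (vol (R i) powr \<eta> * vol (?Q i)) * Hav h (?Q i) * (3 powr (real CARD('n) / p0) * Fav f (R i))"
      using Av[of i] volQ by (intro mult_mono) (auto simp: Hav_nonneg Av_nonneg Fav_nonneg)
    then show "vol (?Q i) powr (1 + \<eta>) * Hav h (?Q i) * Av f (?c i) (3 ^ j * 3 powi fst i)
      \<le> vol (R i) powr \<eta> * (vol (?Q i) * Hav h (?Q i)) * (3 powr (real CARD('n) / p0) * Fav f (R i))"
      by (simp add: mult.assoc)
  qed
  also have "\<dots> = (\<Sum>y\<in>\<rho> ` I. \<Sum>i\<in>{i\<in>I. \<rho> i = y}. vol (R i) powr \<eta> * (vol (?Q i) * Hav h (?Q i))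
      * (3 powr (real CARD('n) / p0) * Fav f (R i)))"
    by (rule sum.image_gen[OF I])
  also have "\<dots> \<le> (\<Sum>y\<in>\<rho> ` I. 3 powr (real CARD('n) / p0) * t (snd y))"
  proof (rule sum_mono)
    fix y assume "y \<in> \<rho> ` I"
    then obtain i0 where i0: "i0 \<in> I" "y = \<rho> i0" by blast
    define Y where "Y = {i\<in>I. \<rho> i = y}"
    have RY: "R i = snd y" if "i \<in> Y" for i using that by (auto simp: Y_def \<rho>_def)
    \<comment> \<open>A cell determines its own generation, since its volume does. So all small
      cells assigned to one large cell have equal size, and distinct ones are disjoint.\<close>
    have kY: "fst i = fst i0" if "i \<in> Y" for i
    proof -
      have eq: "cell (bb i) (?k i) (mm i) = cell (bb i) (?k i0) (mm i0)"
        using that i0 by (auto simp: Y_def \<rho>_def R_def)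
      then have "?k i \<le> ?k i0" "?k i0 \<le> ?k i" by (metis cell_subset_imp_le order_refl)+
      then show ?thesis by simp
    qed
    have inj: "inj_on ?Q Y"
    proof (rule inj_onI)
      fix i i' assume *: "i \<in> Y" "i' \<in> Y" "?Q i = ?Q i'"
      obtain x where "x \<in> ?Q i" using cell_nonempty by blast
      then have "x \<in> cell {} (fst i0) (snd i)" "x \<in> cell {} (fst i0) (snd i')"
        using * kY by auto
      then have "snd i = snd i'" by (rule cell_eq_of_mem)
      then show "i = i'" using kY * by (simp add: prod_eq_iff)
    qed
    have disj: "disjoint_family_on (\<lambda>Q. Q) (?Q ` Y)"
      unfolding disjoint_family_on_def
    proof (intro ballI impI)
      fix Q Q' assume "Q \<in> ?Q ` Y" "Q' \<in> ?Q ` Y" "Q \<noteq> Q'"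
      then obtain i i' where "i \<in> Y" "i' \<in> Y" "Q = ?Q i" "Q' = ?Q i'" by blast
      with \<open>Q \<noteq> Q'\<close> show "Q \<inter> Q' = {}" using kY by (auto intro!: cell_disjoint)
    qed
    have "(\<Sum>i\<in>Y. vol (?Q i) * Hav h (?Q i)) = (\<Sum>Q\<in>?Q ` Y. vol Q * Hav h Q)"
      by (simp add: sum.reindex[OF inj])
    also have "\<dots> \<le> vol (snd y) * Hav h (snd y)"
      unfolding Hav_def
    proof (rule sum_vol_mean_le[OF _ disj])
      show "finite (?Q ` Y)" using I by (simp add: Y_def)
      show "Q \<subseteq> snd y" if "Q \<in> ?Q ` Y" for Q using that QR RY by fastforce
      have yR: "snd y = R i0" by (simp add: i0 \<rho>_def)
      show "0 < vol (snd y)" by (simp add: yR Rpos)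
      show "set_integrable lebesgue (snd y) (\<lambda>x. 1 :: real)"
        unfolding yR R_def set_integrable_def using emeasure_cell[of "bb i0" "?k i0" "mm i0"]
        by (auto simp: integrable_indicator_iff simp del: emeasure_completion)
      show "set_integrable lebesgue (snd y) (\<lambda>x. h x powr s0)" unfolding yR R_def by (rule int_h) simp
    qed (use s0(2) vol_cell_pos in auto)
    finally have *: "(\<Sum>i\<in>Y. vol (?Q i) * Hav h (?Q i)) \<le> vol (snd y) * Hav h (snd y)" .
    have "(\<Sum>i\<in>Y. vol (R i) powr \<eta> * (vol (?Q i) * Hav h (?Q i)) * (3 powr (real CARD('n) / p0)
        * Fav f (R i)))
      = (\<Sum>i\<in>Y. (vol (snd y) powr \<eta> * (3 powr (real CARD('n) / p0) * Fav f (snd y))) * (vol (?Q i)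
          * Hav h (?Q i)))"
      by (rule sum.cong[OF refl]) (simp add: RY mult_ac)
    also have "\<dots> = (vol (snd y) powr \<eta> * (3 powr (real CARD('n) / p0) * Fav f (snd y)))
        * (\<Sum>i\<in>Y. vol (?Q i) * Hav h (?Q i))"
      by (rule sum_distrib_left[symmetric])
    also have "\<dots> \<le> (vol (snd y) powr \<eta> * (3 powr (real CARD('n) / p0) * Fav f (snd y)))
        * (vol (snd y) * Hav h (snd y))"
      by (intro mult_left_mono * mult_nonneg_nonneg) (auto simp: Fav_nonneg)
    also have "\<dots> = 3 powr (real CARD('n) / p0) * t (snd y)"
    proof -
      have "0 < vol (snd y)" by (simp add: i0 \<rho>_def Rpos)
      then show ?thesis by (simp add: t_def powr_add mult_ac)
    qed
    finally show "(\<Sum>i\<in>{i\<in>I. \<rho> i = y}. vol (R i) powr \<eta> * (vol (?Q i) * Hav h (?Q i))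
        * (3 powr (real CARD('n) / p0) * Fav f (R i)))
      \<le> 3 powr (real CARD('n) / p0) * t (snd y)" by (simp add: Y_def)
  qed
  also have "\<dots> = 3 powr (real CARD('n) / p0) * (\<Sum>y\<in>\<rho> ` I. t (snd y))" by (simp add: sum_distrib_left)
  also have "(\<Sum>y\<in>\<rho> ` I. t (snd y)) = (\<Sum>y\<in>(SIGMA b:UNIV. {S. (b, S) \<in> \<rho> ` I}). t (snd y))"
    by (rule sum.cong) auto
  also have "\<dots> = (\<Sum>b\<in>UNIV. \<Sum>S\<in>{S. (b, S) \<in> \<rho> ` I}. t S)"
  proof (subst sum.Sigma)
    show "\<forall>b\<in>UNIV. finite {S. (b, S) \<in> \<rho> ` I}" using fin by blast
  qed (auto simp: case_prod_unfold)
  also have "\<dots> \<le> (\<Sum>b\<in>(UNIV :: 'n set set). W)"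
  proof (rule sum_mono)
    fix b :: "'n set"
    show "(\<Sum>S\<in>{S. (b, S) \<in> \<rho> ` I}. t S) \<le> W"
      unfolding t_def
    proof (rule W)
      show "finite {S. (b, S) \<in> \<rho> ` I}" by (rule fin)
      show "{S. (b, S) \<in> \<rho> ` I} \<subseteq> grid b" by (auto simp: \<rho>_def R_def grid_def)
    qed
  qed
  also have "\<dots> = real CARD('n set) * W" by simp
  finally show ?thesis by (simp add: mult_left_mono)
qed

end

section \<open>Splitting the time integral by scales\<close>

context frac_setup
begin

lemma cont_frac: "continuous_on {0<..} (\<lambda>s. s powr (a - 1) *\<^sub>R E s F)"
  by (intro continuous_on_scaleR E_cont continuous_on_powr') (auto intro!: continuous_intros)

lemma frac_integrable: "0 < x \<Longrightarrow> (\<lambda>s. s powr (a - 1) *\<^sub>R E s F) integrable_on {x..y}"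
  by (intro integrable_continuous_real continuous_on_subset[OF cont_frac]) auto

lemma frac_integral_combine:
  "0 < x \<Longrightarrow> x \<le> y \<Longrightarrow> y \<le> z \<Longrightarrow> integral {x..z} (\<lambda>s. s powr (a - 1) *\<^sub>R E s F)
    = integral {x..y} (\<lambda>s. s powr (a - 1) *\<^sub>R E s F) + integral {y..z} (\<lambda>s. s powr (a - 1) *\<^sub>R E s F)"
  by (rule Henstock_Kurzweil_Integration.integral_combine[symmetric]) (auto intro: frac_integrable)

lemma wnorm_integral_chain:
  assumes g: "sq_weight g" and x: "0 < x 0" "\<And>i. x i \<le> x (Suc i)"
  shows "wnorm g (integral {x 0..x m} (\<lambda>s. s powr (a - 1) *\<^sub>R E s F))
    \<le> (\<Sum>i<m. wnorm g (integral {x i..x (Suc i)} (\<lambda>s. s powr (a - 1) *\<^sub>R E s F)))"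
proof (induction m)
  case (Suc m)
  have mono: "x 0 \<le> x m" using x(2) lift_Suc_mono_le[of x] by auto
  show ?case
    unfolding frac_integral_combine[OF x(1) mono x(2)]
    using wnorm_add[OF g] Suc.IH by (force intro: order_trans)
qed (simp add: wnorm_zero)

lemma exists_large_cube:
  fixes c :: "real^'n"
  assumes "bounded S" "0 < l"
  shows "\<exists>J. \<forall>J'\<ge>J. S \<subseteq> cube c (3 ^ J' * l)"
proof -
  obtain B where B: "\<And>x. x \<in> S \<Longrightarrow> norm x \<le> B" using assms by (auto simp: bounded_iff)
  obtain J where J: "2 * (B + norm c) / l < 3 ^ J" using real_arch_pow[of 3] by auto
  have "S \<subseteq> cube c (3 ^ J' * l)" if "J \<le> J'" for J'
  proof
    fix x assume x: "x \<in> S"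
    have "2 * (B + norm c) / l < 3 ^ J'"
      by (rule less_le_trans[OF J]) (use that in \<open>auto intro: power_increasing\<close>)
    then have le: "B + norm c \<le> 3 ^ J' * l / 2" using assms(2) by (simp add: field_simps)
    show "x \<in> cube c (3 ^ J' * l)"
      unfolding mem_cube_iff
    proof
      fix i
      have "\<bar>x $ i\<bar> \<le> B" "\<bar>c $ i\<bar> \<le> norm c"
        using B[OF x] component_le_norm_cart[of x i] component_le_norm_cart[of c i] by linarith+
      then show "c $ i - 3 ^ J' * l / 2 \<le> x $ i \<and> x $ i \<le> c $ i + 3 ^ J' * l / 2" using le by linarith
    qed
  qed
  then show ?thesis by blast
qed

text \<open>Finitely many cells of a generation meet the bounded support of h. Closed cubes overlap
  on faces, which an upper bound tolerates.\<close>

lemma wnorm_le_sum_cells: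
  assumes h: "test_fun h"
  shows "wnorm h F \<le> (\<Sum>m\<in>{m. cell {} k m \<inter> {x. h x \<noteq> 0} \<noteq> {}}.
      wnorm (\<lambda>x. h x * indicator (cube (cell_center {} k m) (3 powi k)) x) F)"
proof -
  let ?M = "{m. cell {} k m \<inter> {x. h x \<noteq> 0} \<noteq> {}}"
  let ?Q = "\<lambda>m. cube (cell_center {} k m) (3 powi k)"
  have fin: "finite ?M" by (rule finite_cells_in_bounded[OF test_fun_bounded_support[OF h]])
  have int: "integrable lebesgue (\<lambda>x. norm (rep_L2 F x) * (h x * indicator (?Q m) x))" for m
    by (rule wnorm_integrable(1)[OF test_fun_sq_weight[OF h]]) simp
  have h0: "0 \<le> h x" for x using h by (simp add: test_fun_def)
  have "wnorm h F \<le> (\<integral>x. (\<Sum>m\<in>?M. norm (rep_L2 F x) * (h x * indicator (?Q m) x)) \<partial>lebesgue)"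
    unfolding wnorm_def
  proof (rule integral_mono[OF wnorm_integrable(1)[OF test_fun_sq_weight'[OF h]]])
    fix x
    show "norm (rep_L2 F x) * h x \<le> (\<Sum>m\<in>?M. norm (rep_L2 F x) * (h x * indicator (?Q m) x))"
    proof (cases "h x = 0")
      case False
      obtain m where m: "x \<in> cell {} k m" using cell_cases by blast
      then have "m \<in> ?M" using False by blast
      moreover have "x \<in> ?Q m" using m cell_subset_cube by blast
      then have "norm (rep_L2 F x) * h x = norm (rep_L2 F x) * (h x * indicator (?Q m) x)" by simp
      moreover have "norm (rep_L2 F x) * (h x * indicator (?Q m) x) \<le> (\<Sum>m\<in>?M. norm (rep_L2 F x)
          * (h x * indicator (?Q m) x))"
        if "m \<in> ?M"
        by (rule member_le_sum[OF that _ fin]) (use h0 in simp)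
      ultimately show ?thesis by (simp only:)
    qed simp
  qed (use int in auto)
  also have "\<dots> = (\<Sum>m\<in>?M. wnorm (\<lambda>x. h x * indicator (?Q m) x) F)"
    unfolding wnorm_def by (rule Bochner_Integration.integral_sum) (rule int)
  finally show ?thesis .
qed

lemma sum_geometric_powr_le:
  assumes "0 < e"
  shows "(\<Sum>j\<in>{1..J}. 3 powr (- (e * real j))) \<le> 1 / (1 - 3 powr (- e))"
proof -
  have lt: "3 powr (- e) < (1 :: real)" using assms powr_less_mono[of "- e" 0 3] by simp
  have eq: "3 powr (- (e * real j)) = (3 powr (- e)) ^ j" for j
    by (simp add: powr_powr flip: powr_realpow)
  have "(\<Sum>j\<in>{1..J}. 3 powr (- (e * real j))) \<le> (\<Sum>j. (3 powr (- e)) ^ j)"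
    unfolding eq using lt by (intro sum_le_suminf summable_geometric) auto
  also have "\<dots> = 1 / (1 - 3 powr (- e))" using lt by (subst suminf_geometric) auto
  finally show ?thesis .
qed

lemma three_powi: "3 powi k = (3 :: real) powr real_of_int k"
  by (simp add: powr_real_of_int')

text \<open>Times are matched to cells of generation k with s^(1/\<kappa>) between 3^k and 3^(k+1).
  Integration in ds/s over such a block costs a constant, and s^a becomes |Q|^\<eta> because
  \<kappa> a = n \<eta>. Nothing depends on the truncation N.\<close>

lemma dominate:
  assumes \<eta>: "0 < \<eta>" and a: "a = real CARD('n) * \<eta> / \<kappa>"
  shows "\<exists>C\<ge>0. \<forall>f h W N. bounded_comp_supp f \<longrightarrow> test_fun h \<longrightarrow>
    (\<forall>(b :: 'n set) \<Q>. finite \<Q> \<longrightarrow> \<Q> \<subseteq> grid b \<longrightarrow> (\<Sum>R\<in>\<Q>. vol R powr (1 + \<eta>) * (Fav f R * Hav h R)) \<le> W) \<longrightarrow>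
    wnorm h (integral {3 powr (- (\<kappa> * real N))..3 powr (\<kappa>
        * real N)} (\<lambda>s. s powr (a - 1) *\<^sub>R E s (abs_L2 f))) \<le> C * W"
proof -
  obtain C where C: "0 \<le> C" "\<And>f h c l s J. bounded_comp_supp f \<Longrightarrow> test_fun h \<Longrightarrow> 0 < l \<Longrightarrow> 0 < s \<Longrightarrow>
    l \<le> s powr (1 / \<kappa>) \<Longrightarrow> s powr (1 / \<kappa>) \<le> 3 * l \<Longrightarrow> 1 \<le> J \<Longrightarrow> {x. f x \<noteq> 0} \<subseteq> cube c (3 ^ J * l) \<Longrightarrow>
    wnorm (\<lambda>x. h x * indicator (cube c l) x) (E s (abs_L2 f))
      \<le> C * (vol (cube c l) * Hav h (cube c l) * (\<Sum>j\<in>{1..J}. 3 powr (- (\<epsilon> * real j)) * Av f c (3 ^ j * l)))"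
    by (rule local_estimate) (rule that)
  have a0: "0 < a" "\<kappa> * a = real CARD('n) * \<eta>" using \<eta> \<kappa> a by auto
  define D where "D = 3 powr \<kappa> * 3 powr (\<kappa> * a) * C"
  define D' where "D' = 3 powr (real CARD('n) / p0) * real CARD('n set) / (1 - 3 powr (- \<epsilon>))"
  have D0: "0 \<le> D" "0 \<le> D'"
    using C(1) \<epsilon> powr_less_mono[of "- \<epsilon>" 0 3] by (auto simp: D_def D'_def)
  show ?thesis
  proof (intro exI[of _ "D * D'"] conjI allI impI)
    fix f :: "real^'n \<Rightarrow> complex" and h :: "real^'n \<Rightarrow> real" and W :: real and N :: nat
    assume f: "bounded_comp_supp f" and h: "test_fun h"
      and "\<forall>(b :: 'n set) \<Q>. finite \<Q> \<longrightarrow> \<Q> \<subseteq> grid b \<longrightarrow> (\<Sum>R\<in>\<Q>. vol R powr (1 + \<eta>) * (Fav f R * Hav h R)) \<le> W"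
    then have W: "\<And>(b :: 'n set) \<Q>. finite \<Q> \<Longrightarrow> \<Q> \<subseteq> grid b \<Longrightarrow> (\<Sum>R\<in>\<Q>. vol R powr (1 + \<eta>) * (Fav f R
        * Hav h R)) \<le> W"
      by blast
    let ?F = "abs_L2 f"
    let ?G = "\<lambda>s. s powr (a - 1) *\<^sub>R E s ?F"
    have W0: "0 \<le> W" using W[of "{}"] by simp
    define M where "M k = {m. cell {} k m \<inter> {x. h x \<noteq> 0} \<noteq> {}}" for k
    have finM: "finite (M k)" for k unfolding M_def by (rule finite_cells_in_bounded[OF
        test_fun_bounded_support[OF h]])
    define k where "k i = int i - int N" for i
    define x where "x i = 3 powr (\<kappa> * real_of_int (k i))" for i
    have x: "0 < x i" "x i \<le> x (Suc i)" for i
      unfolding x_def k_def using \<kappa> by (auto intro!: powr_mono mult_left_mono)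
    define I where "I = (SIGMA l:k ` {..<2 * N}. M l)"
    have finI: "finite I" unfolding I_def using finM by auto
    have "bounded {x. f x \<noteq> 0}"
      using f unfolding bounded_comp_supp_def by (auto dest!: compact_imp_bounded intro:
          bounded_subset[OF _ closure_subset])
    then have "\<forall>i. \<exists>J. \<forall>J'\<ge>J. {x. f x \<noteq> 0} \<subseteq> cube (cell_center {} (fst i) (snd i)) (3 ^ J'
        * 3 powi (fst i))"
      by (intro allI exists_large_cube) auto
    then obtain Jf where Jf: "\<And>i J'. Jf i \<le> J' \<Longrightarrow> {x. f x \<noteq> 0} \<subseteq> cube (cell_center {} (fst i) (snd
        i)) (3 ^ J' * 3 powi (fst i))"
      by metis
    \<comment> \<open>One number of annuli for all the cells in question: the sum dominates each
      summand, and the successor ensures 1 <= J.\<close>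
    define J where "J = Suc (\<Sum>i\<in>I. Jf i)"
    have J: "{x. f x \<noteq> 0} \<subseteq> cube (cell_center {} l m) (3 ^ J * 3 powi l)" if "(l, m) \<in> I" for l m
    proof -
      have "Jf (l, m) \<le> J" unfolding J_def using finI that by (intro le_SucI member_le_sum) auto
      then show ?thesis using Jf[of "(l, m)" J] by simp
    qed
    let ?t = "\<lambda>j l m. vol (cell {} l m) powr (1 + \<eta>) * Hav h (cell {} l m)
        * Av f (cell_center {} l m) (3 ^ j * 3 powi l)"
    have piece: "wnorm h (integral {x i..x (Suc i)} ?G) \<le> D * (\<Sum>m\<in>M (k i). \<Sum>j\<in>{1..J}. 3 powr (- (\<epsilon>
        * real j)) * ?t j (k i) m)"
      if i: "i < 2 * N" for i
    proof -
      let ?l = "3 powi (k i) :: real"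
      let ?Q = "\<lambda>m. cube (cell_center {} (k i) m) ?l"
      define \<Theta> where "\<Theta> = (\<Sum>m\<in>M (k i). C * (vol (?Q m) * Hav h (?Q m) * (\<Sum>j\<in>{1..J}. 3 powr (- (\<epsilon>
          * real j)) * Av f (cell_center {} (k i) m) (3 ^ j * ?l))))"
      have \<Theta>0: "0 \<le> \<Theta>" unfolding \<Theta>_def using C(1)
        by (intro sum_nonneg mult_nonneg_nonneg) (auto simp: Hav_nonneg Av_nonneg)
      have E_le: "wnorm h (E s ?F) \<le> \<Theta>" if s: "x i \<le> s" "s \<le> x (Suc i)" for s
      proof -
        have s0: "0 < s" using s x(1)[of i] by linarith
        have "x i powr (1 / \<kappa>) \<le> s powr (1 / \<kappa>)" "s powr (1 / \<kappa>) \<le> x (Suc i) powr (1 / \<kappa>)"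
          using s x(1)[of i] s0 \<kappa> by (auto intro!: powr_mono2)
        moreover have "x i powr (1 / \<kappa>) = ?l" "x (Suc i) powr (1 / \<kappa>) = 3 * ?l"
        proof -
          show "x i powr (1 / \<kappa>) = ?l" using \<kappa> by (simp add: x_def powr_powr three_powi)
          have "x (Suc i) powr (1 / \<kappa>) = 3 powi (k i + 1)"
            using \<kappa> by (simp add: x_def powr_powr three_powi k_def algebra_simps)
          then show "x (Suc i) powr (1 / \<kappa>) = 3 * ?l" by (simp add: power_int_add)
        qed
        ultimately have sl: "?l \<le> s powr (1 / \<kappa>)" "s powr (1 / \<kappa>) \<le> 3 * ?l" by simp_all
        have "wnorm h (E s ?F) \<le> (\<Sum>m\<in>M (k i). wnorm (\<lambda>x. h x * indicator (?Q m) x) (E s ?F))"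
          unfolding M_def by (rule wnorm_le_sum_cells[OF h])
        also have "\<dots> \<le> \<Theta>"
          unfolding \<Theta>_def
        proof (rule sum_mono)
          fix m assume m: "m \<in> M (k i)"
          show "wnorm (\<lambda>x. h x * indicator (?Q m) x) (E s ?F)
            \<le> C * (vol (?Q m) * Hav h (?Q m) * (\<Sum>j\<in>{1..J}. 3 powr (- (\<epsilon> * real j))
                * Av f (cell_center {} (k i) m) (3 ^ j * ?l)))"
          proof (rule C(2)[OF f h _ s0 sl])
            have "(k i, m) \<in> I" using i m by (auto simp: I_def)
            then show "{x. f x \<noteq> 0} \<subseteq> cube (cell_center {} (k i) m) (3 ^ J * ?l)" by (rule J)
          qed (auto simp: J_def)
        qed
        finally show ?thesis .
      qed
      \<comment> \<open>s^(a-1) is written as s^a / s and bounded at opposite ends of the block,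
        which works for either sign of a - 1. The length of the block cancels 1/x(i) up to
        3^\<kappa>.\<close>
      define \<phi> where "\<phi> = x (Suc i) powr a / x i * \<Theta>"
      have "wnorm h (integral {x i..x (Suc i)} ?G) \<le> integral {x i..x (Suc i)} (\<lambda>s. \<phi>)"
      proof (rule wnorm_integral_le[OF test_fun_sq_weight'[OF h]])
        show "continuous_on {x i..x (Suc i)} ?G"
          by (rule continuous_on_subset[OF cont_frac]) (use x(1)[of i] in auto)
        fix s assume s: "x i \<le> s" "s \<le> x (Suc i)"
        have s0: "0 < s" using s x(1)[of i] by linarith
        have "s powr (a - 1) = s powr a / s" using s0 by (simp add: powr_diff)
        also have "\<dots> \<le> x (Suc i) powr a / x i"
          using s s0 x(1)[of i] a0(1) by (intro frac_le powr_mono2) auto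
        finally have "s powr (a - 1) * wnorm h (E s ?F) \<le> \<phi>"
          unfolding \<phi>_def using E_le[OF s] \<Theta>0 x(1)[of i] wnorm_nonneg[OF test_fun_sq_weight'[OF h]]
          by (intro mult_mono) auto
        then show "wnorm h (s powr (a - 1) *\<^sub>R E s ?F) \<le> \<phi>"
          by (simp add: wnorm_scaleR[OF test_fun_sq_weight'[OF h]])
      qed auto
      also have "\<dots> = (x (Suc i) - x i) * \<phi>" using x(2)[of i] by simp
      also have "\<dots> \<le> x (Suc i) * \<phi>"
        using x(1)[of i] \<Theta>0 by (intro mult_right_mono) (auto simp: \<phi>_def)
      also have "\<dots> = 3 powr \<kappa> * 3 powr (\<kappa> * a) * (?l powr (\<kappa> * a)) * \<Theta>"
      proof -
        have xs: "x (Suc i) = 3 powr \<kappa> * x i"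
          by (simp add: x_def k_def algebra_simps flip: powr_add)
        have "x i powr a = ?l powr (\<kappa> * a)"
          by (simp add: x_def three_powi powr_powr mult_ac)
        moreover have "x (Suc i) powr a = 3 powr (\<kappa> * a) * x i powr a"
          using x(1)[of i] by (simp add: xs powr_mult powr_powr)
        ultimately have "x (Suc i) powr a = 3 powr (\<kappa> * a) * ?l powr (\<kappa> * a)" by simp
        then show ?thesis unfolding \<phi>_def using x(1)[of i] xs by (simp add: field_simps)
      qed
      also have "?l powr (\<kappa> * a) * \<Theta> = C * (\<Sum>m\<in>M (k i). \<Sum>j\<in>{1..J}. 3 powr (- (\<epsilon> * real j)) * ?t j (k i) m)"
      proof -
        have "?l powr (\<kappa> * a) * (C * (vol (?Q m) * Hav h (?Q m) * (\<Sum>j\<in>{1..J}. 3 powr (- (\<epsilon>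
            * real j)) * Av f (cell_center {} (k i) m) (3 ^ j * ?l))))
          = C * (\<Sum>j\<in>{1..J}. 3 powr (- (\<epsilon> * real j)) * ?t j (k i) m)" for m
        proof -
          have "?l powr (\<kappa> * a) = vol (cell {} (k i) m) powr \<eta>"
            unfolding a0(2) measure_cell by (simp add: powr_powr flip: powr_realpow)
          moreover have "vol (?Q m) = vol (cell {} (k i) m)" "Hav h (?Q m) = Hav h (cell {} (k i) m)"
            using wint_cell_eq_cube[OF borel_measurable_integrable[OF test_fun_integrable[OF h, of
                s0]], of "{}" "k i" m] s0(2)
            by (simp_all add: vol_cell_eq_cube Hav_def)
          moreover have "vol (cell {} (k i) m) powr (1 + \<eta>) = vol (cell {} (k i) m)
              * vol (cell {} (k i) m) powr \<eta>"
            using vol_cell_pos[of "{}" "k i" m] by (simp add: powr_add)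
          ultimately show ?thesis by (simp add: sum_distrib_left mult_ac)
        qed
        then show ?thesis unfolding \<Theta>_def by (simp add: sum_distrib_left)
      qed
      then have "3 powr \<kappa> * 3 powr (\<kappa> * a) * (?l powr (\<kappa> * a)) * \<Theta>
          = D * (\<Sum>m\<in>M (k i). \<Sum>j\<in>{1..J}. 3 powr (- (\<epsilon> * real j)) * ?t j (k i) m)"
        by (simp add: D_def mult.assoc)
      finally show ?thesis .
    qed
    have "wnorm h (integral {x 0..x (2 * N)} ?G) \<le> (\<Sum>i<2 * N. wnorm h (integral {x i..x (Suc i)} ?G))"
      by (rule wnorm_integral_chain[where x = x, OF test_fun_sq_weight'[OF h] x])
    also have "\<dots> \<le> (\<Sum>i<2 * N. D * (\<Sum>m\<in>M (k i). \<Sum>j\<in>{1..J}. 3 powr (- (\<epsilon> * real j)) * ?t j (k i) m))"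
      by (rule sum_mono) (use piece in auto)
    also have "\<dots> = D * (\<Sum>l\<in>k ` {..<2 * N}. \<Sum>m\<in>M l. \<Sum>j\<in>{1..J}. 3 powr (- (\<epsilon> * real j)) * ?t j l m)"
      by (subst sum.reindex) (auto simp: sum_distrib_left inj_on_def k_def)
    also have "(\<Sum>l\<in>k ` {..<2 * N}. \<Sum>m\<in>M l. \<Sum>j\<in>{1..J}. 3 powr (- (\<epsilon> * real j)) * ?t j l m)
      = (\<Sum>(l, m)\<in>I. \<Sum>j\<in>{1..J}. 3 powr (- (\<epsilon> * real j)) * ?t j l m)"
      unfolding I_def using finM by (subst sum.Sigma) auto
    \<comment> \<open>With the annuli outermost, \<open>regroup\<close> bounds the inner sum
      uniformly in j, and the weights 3^(-\<epsilon> j) sum to a constant independent of J.\<close>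
    also have "\<dots> = (\<Sum>j\<in>{1..J}. \<Sum>(l, m)\<in>I. 3 powr (- (\<epsilon> * real j)) * ?t j l m)"
      unfolding case_prod_unfold by (rule sum.swap)
    also have "\<dots> = (\<Sum>j\<in>{1..J}. 3 powr (- (\<epsilon> * real j)) * (\<Sum>(l, m)\<in>I. ?t j l m))"
      by (simp add: sum_distrib_left case_prod_unfold)
    also have "\<dots> \<le> (\<Sum>j\<in>{1..J}. 3 powr (- (\<epsilon> * real j)) * (3 powr (real CARD('n) / p0)
        * (real CARD('n set) * W)))"
      by (intro sum_mono mult_left_mono regroup[OF f h finI \<eta> W]) auto
    also have "\<dots> = (\<Sum>j\<in>{1..J}. 3 powr (- (\<epsilon> * real j))) * (3 powr (real CARD('n) / p0)
        * (real CARD('n set) * W))"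
      by (simp add: sum_distrib_right)
    also have "\<dots> \<le> 1 / (1 - 3 powr (- \<epsilon>)) * (3 powr (real CARD('n) / p0) * (real CARD('n set) * W))"
      by (intro mult_right_mono sum_geometric_powr_le \<epsilon>) (use W0 in auto)
    also have "\<dots> = D' * W" by (simp add: D'_def)
    finally have "wnorm h (integral {x 0..x (2 * N)} ?G) \<le> D * D' * W"
      using D0(1) by (simp add: mult_left_mono mult.assoc)
    moreover have "x 0 = 3 powr (- (\<kappa> * real N))" "x (2 * N) = 3 powr (\<kappa> * real N)"
      by (simp_all add: x_def k_def)
    ultimately show "wnorm h (integral {3 powr (- (\<kappa> * real N))..3 powr (\<kappa> * real N)} ?G) \<le> D * D'
        * W" by simp
  qed (use D0 in auto)
qed

end

section \<open>Existence of the fractional power\<close>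

lemma integral_powr_interval:
  assumes "0 < x" "x \<le> y" "b \<noteq> 0"
  shows "integral {x..y} (\<lambda>s. s powr (b - 1)) = (y powr b - x powr b) / (b :: real)"
proof -
  have "((\<lambda>s. s powr (b - 1)) has_integral (y powr b / b - x powr b / b)) {x..y}"
  proof (rule fundamental_theorem_of_calculus[OF assms(2)])
    fix s assume "s \<in> {x..y}"
    then have "0 < s" using assms by auto
    then have "((\<lambda>s. s powr b / b) has_real_derivative (b * s powr (b - 1)) / b) (at s within {x..y})"
      by (intro DERIV_cdivide has_field_derivative_at_within[OF has_real_derivative_powr])
    then show "((\<lambda>s. s powr b / b) has_vector_derivative s powr (b - 1)) (at s within {x..y})"
      using assms(3) by (simp add: has_real_derivative_iff_has_vector_derivative)
  qed
  then show ?thesis by (simp add: integral_unique diff_divide_distrib)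
qed

lemma continuous_on_powr_interval: "0 < x \<Longrightarrow> continuous_on {x..y} (\<lambda>s. s powr (b :: real))"
  by (intro continuous_on_powr' continuous_intros) auto

lemma wnorm_cube_le:
  fixes F :: "'n::finite L2"
  assumes q: "1 < q" and l: "0 < l" and c: "0 \<le> c" "lp_norm (ennreal q) lebesgue (rep_L2 F) \<le> ennreal c"
  shows "wnorm (indicator (cube 0 l)) F \<le> vol (cube (0 :: real^'n) l) powr (1 - 1 / q) * c"
proof -
  let ?Q = "cube (0 :: real^'n) l"
  have vQ: "0 < vol ?Q" "emeasure lebesgue ?Q = ennreal (vol ?Q)"
    using l by (simp_all add: measure_cube emeasure_cube del: emeasure_completion)
  have "avg_norm (ennreal q) ?Q (rep_L2 F) \<le> ennreal (vol ?Q powr (- recip (ennreal q)) * c)"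
    by (rule avg_norm_le_lp_norm[OF _ _ vQ(2,1) _ c]) (use q in auto)
  then have avg: "avg_norm (ennreal q) ?Q (rep_L2 F) \<le> ennreal (vol ?Q powr (- (1 / q)) * c)"
    using q by (simp add: recip_ennreal)
  have int: "set_integrable lebesgue ?Q (\<lambda>x. 1 powr (1 / (1 - 1 / q)) :: real)"
    using vQ(2) by (auto simp: set_integrable_def integrable_indicator_iff simp del: emeasure_completion)
  have "ennreal (wnorm (indicator ?Q) F) = (\<integral>\<^sup>+x. ennreal (norm (rep_L2 F x) * (1
      * indicator ?Q x)) \<partial>lebesgue)"
    unfolding wnorm_def mult_1
    by (rule nn_integral_eq_integral[symmetric, OF wnorm_integrable(1)[OF sq_weight_indicator]])
      (use vQ(2) in \<open>auto simp del: emeasure_completion\<close>)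
  also have "\<dots> \<le> ennreal (vol ?Q * (vol ?Q powr (- (1 / q)) * c)
      * (wint (\<lambda>x. 1 powr (1 / (1 - 1 / q))) ?Q / vol ?Q) powr (1 / (1 / (1 - 1 / q))))"
    by (rule nn_integral_pairing_le[OF _ _ vQ(2,1) _ _ _ avg _ _ int]) (use q c
        in \<open>auto simp: recip_ennreal\<close>)
  finally have "wnorm (indicator ?Q) F \<le> vol ?Q * (vol ?Q powr (- (1 / q)) * c)"
    using vQ(1) c by (simp add: wint_one ennreal_le_iff)
  also have "\<dots> = vol ?Q powr (1 - 1 / q) * c"
    using vQ(1) by (simp add: powr_diff powr_minus field_simps)
  finally show ?thesis .
qed

lemma compact_subset_cube:
  fixes K :: "(real^'n) set"
  assumes "bounded K"
  shows "\<exists>l>0. K \<subseteq> cube 0 l"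
proof -
  obtain B where B: "\<And>x. x \<in> K \<Longrightarrow> norm x \<le> B" using assms by (auto simp: bounded_iff)
  have "K \<subseteq> cube 0 (2 * \<bar>B\<bar> + 1)"
  proof
    fix x assume x: "x \<in> K"
    show "x \<in> cube 0 (2 * \<bar>B\<bar> + 1)"
      unfolding mem_cube_iff
    proof
      fix i
      define r where "r = \<bar>B\<bar>"
      have "\<bar>x $ i\<bar> \<le> r" using B[OF x] component_le_norm_cart[of x i] by (simp add: r_def)
      then have "- r \<le> x $ i" "x $ i \<le> r" by linarith+
      then show "0 $ i - (2 * \<bar>B\<bar> + 1) / 2 \<le> x $ i \<and> x $ i \<le> 0 $ i + (2 * \<bar>B\<bar> + 1) / 2"
        by (simp add: field_simps flip: r_def)
    qed
  qed
  then show ?thesis by (intro exI[of _ "2 * \<bar>B\<bar> + 1"]) auto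
qed

lemma nn_integral_diff_cube:
  fixes F G :: "'n::finite L2"
  assumes "0 < l"
  shows "(\<integral>\<^sup>+x\<in>cube 0 l. ennreal (norm (rep_L2 F x - rep_L2 G x)) \<partial>lebesgue)
      = ennreal (wnorm (indicator (cube 0 l)) (F - G))"
proof -
  have "(\<integral>\<^sup>+x\<in>cube 0 l. ennreal (norm (rep_L2 F x - rep_L2 G x)) \<partial>lebesgue)
    = (\<integral>\<^sup>+x\<in>cube 0 l. ennreal (norm (rep_L2 (F - G) x)) \<partial>lebesgue)"
    by (intro nn_integral_cong_AE eventually_mono[OF rep_diff[of F G]]) simp
  also have "\<dots> = ennreal (wnorm (indicator (cube 0 l)) (F - G))"
    using assms by (intro wnorm_indicator) (auto simp: emeasure_cube simp del: emeasure_completion)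
  finally show ?thesis .
qed

lemma is_neg_power_unique:
  fixes L :: "'n::finite graph"
  assumes "is_neg_power L a F g1" "is_neg_power L a F g2"
  shows "AE x in lebesgue. g1 x = g2 x"
proof -
  have meas [measurable]: "g1 \<in> borel_measurable lebesgue" "g2 \<in> borel_measurable lebesgue"
    using assms by (auto simp: is_neg_power_def)
  have "AE x in lebesgue. x \<in> cball 0 (real j) \<longrightarrow> g1 x = g2 x" for j :: nat
  proof -
    let ?K = "cball 0 (real j) :: (real^'n) set"
    have K [measurable]: "?K \<in> sets lebesgue" by simp
    let ?H = "\<lambda>\<delta> R. rep_L2 ((1 / Gamma a) *\<^sub>R integral {\<delta>..R} (\<lambda>s. s powr (a - 1) *\<^sub>R exp_neg L s F))"
    let ?F = "at_right (0 :: real) \<times>\<^sub>F (at_top :: real filter)"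
    have "((\<lambda>z. (case z of (\<delta>, R) \<Rightarrow> \<integral>\<^sup>+x\<in>?K. ennreal (norm (?H \<delta> R x - g1 x)) \<partial>lebesgue)
        + (case z of (\<delta>, R) \<Rightarrow> \<integral>\<^sup>+x\<in>?K. ennreal (norm (?H \<delta> R x - g2 x)) \<partial>lebesgue)) \<longlongrightarrow> 0 + 0) ?F"
      using assms unfolding is_neg_power_def by (intro tendsto_add) auto
    then have lim: "((\<lambda>z. (case z of (\<delta>, R) \<Rightarrow> \<integral>\<^sup>+x\<in>?K. ennreal (norm (?H \<delta> R x - g1 x)) \<partial>lebesgue)
        + (case z of (\<delta>, R) \<Rightarrow> \<integral>\<^sup>+x\<in>?K. ennreal (norm (?H \<delta> R x - g2 x)) \<partial>lebesgue)) \<longlongrightarrow> 0) ?F" by simp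
    have "(\<integral>\<^sup>+x\<in>?K. ennreal (norm (g1 x - g2 x)) \<partial>lebesgue) \<le> 0"
    proof (rule tendsto_lowerbound[OF lim])
      have "(\<integral>\<^sup>+x\<in>?K. ennreal (norm (g1 x - g2 x)) \<partial>lebesgue)
        \<le> (\<integral>\<^sup>+x\<in>?K. ennreal (norm (?H \<delta> R x - g1 x)) \<partial>lebesgue)
            + (\<integral>\<^sup>+x\<in>?K. ennreal (norm (?H \<delta> R x - g2 x)) \<partial>lebesgue)" for \<delta> R
      proof -
        have "(\<integral>\<^sup>+x\<in>?K. ennreal (norm (g1 x - g2 x)) \<partial>lebesgue)
          \<le> (\<integral>\<^sup>+x. ennreal (norm (?H \<delta> R x - g1 x)) * indicator ?K x
              + ennreal (norm (?H \<delta> R x - g2 x)) * indicator ?K x \<partial>lebesgue)"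
        proof (rule nn_integral_mono)
          fix x
          have "norm (g1 x - g2 x) \<le> norm (?H \<delta> R x - g1 x) + norm (?H \<delta> R x - g2 x)"
            using norm_triangle_ineq4[of "?H \<delta> R x - g2 x" "?H \<delta> R x - g1 x"] by (simp add: add.commute)
          then show "ennreal (norm (g1 x - g2 x)) * indicator ?K x
            \<le> ennreal (norm (?H \<delta> R x - g1 x)) * indicator ?K x + ennreal (norm (?H \<delta> R x - g2 x))
                * indicator ?K x"
            by (auto simp: indicator_def simp flip: ennreal_plus intro!: ennreal_leI)
        qed
        also have "\<dots> = (\<integral>\<^sup>+x\<in>?K. ennreal (norm (?H \<delta> R x - g1 x)) \<partial>lebesgue)
            + (\<integral>\<^sup>+x\<in>?K. ennreal (norm (?H \<delta> R x - g2 x)) \<partial>lebesgue)"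
          by (rule nn_integral_add) measurable
        finally show ?thesis .
      qed
      then show "eventually (\<lambda>z. (\<integral>\<^sup>+x\<in>?K. ennreal (norm (g1 x - g2 x)) \<partial>lebesgue)
        \<le> (case z of (\<delta>, R) \<Rightarrow> \<integral>\<^sup>+x\<in>?K. ennreal (norm (?H \<delta> R x - g1 x)) \<partial>lebesgue)
        + (case z of (\<delta>, R) \<Rightarrow> \<integral>\<^sup>+x\<in>?K. ennreal (norm (?H \<delta> R x - g2 x)) \<partial>lebesgue)) ?F"
        by (intro always_eventually) auto
    qed (simp add: prod_filter_eq_bot)
    then have "(\<integral>\<^sup>+x. ennreal (norm (g1 x - g2 x)) * indicator ?K x \<partial>lebesgue) = 0" by simp
    then have "AE x in lebesgue. ennreal (norm (g1 x - g2 x)) * indicator ?K x = 0"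
      by (subst (asm) nn_integral_0_iff_AE) measurable
    then show ?thesis by eventually_elim (auto simp: indicator_def split: if_splits)
  qed
  then have "AE x in lebesgue. \<forall>j::nat. x \<in> cball 0 (real j) \<longrightarrow> g1 x = g2 x"
    by (subst AE_all_countable) blast
  then show ?thesis
  proof eventually_elim
    case (elim x)
    obtain j :: nat where "norm x \<le> real j" using real_arch_simple by blast
    then show ?case using elim by auto
  qed
qed

section \<open>Truncated integrals and their limit\<close>

context frac_setup
begin

definition trunc :: "real \<Rightarrow> 'n L2 \<Rightarrow> real \<Rightarrow> real \<Rightarrow> 'n L2" where
  "trunc a F x y = (1 / Gamma a) *\<^sub>R integral {x..y} (\<lambda>s. s powr (a - 1) *\<^sub>R E s F)"

text \<open>Boundedness on L^q serves small times, smoothing from L^p0 to L^q serves large ones;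
  Hoelder on the cube passes from L^q to L^1.\<close>

lemma E_cube_bounds:
  assumes q: "p0 < q" "ennreal q < q0" and f: "bounded_comp_supp f" and l: "0 < l"
  obtains A where "0 \<le> A" "\<And>s. 0 < s \<Longrightarrow> wnorm (indicator (cube 0 l)) (E s (abs_L2 f)) \<le> A"
    "\<And>s. 0 < s \<Longrightarrow> wnorm (indicator (cube 0 l)) (E s (abs_L2 f)) \<le> A * s powr (- (real CARD('n) / \<kappa>
        * (1 / p0 - 1 / q)))"
proof -
  have q1: "1 < q" using p0 q by simp
  obtain C1 where C1: "0 \<le> C1" "on_diagonal (ennreal q) (ennreal q) C1"
    using A2_exp[of "ennreal q" "ennreal q"] q p0(1) by (auto intro: less_imp_le ennreal_leI)
  obtain C2 where C2: "0 \<le> C2" "on_diagonal (ennreal p0) (ennreal q) C2"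
    using A2_exp[of "ennreal p0" "ennreal q"] q p0(1) by (auto intro: less_imp_le ennreal_leI)
  define n1 where "n1 = (\<integral>x. norm (f x) powr q \<partial>lebesgue) powr (1 / q)"
  define n2 where "n2 = (\<integral>x. norm (f x) powr p0 \<partial>lebesgue) powr (1 / p0)"
  define V where "V = vol (cube (0 :: real^'n) l) powr (1 - 1 / q)"
  define \<gamma> where "\<gamma> = real CARD('n) / \<kappa> * (1 / p0 - 1 / q)"
  have n1: "lp_norm (ennreal q) lebesgue (rep_L2 (abs_L2 f)) \<le> ennreal n1"
    unfolding n1_def by (rule lp_norm_bcs[OF f]) (use q1 in simp)
  have n2: "lp_norm (ennreal p0) lebesgue (rep_L2 (abs_L2 f)) \<le> ennreal n2"
    unfolding n2_def by (rule lp_norm_bcs[OF f]) (use p0 in simp)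
  have b1: "wnorm (indicator (cube 0 l)) (E s (abs_L2 f)) \<le> V * (C1 * n1)" if s: "0 < s" for s
    unfolding V_def
  proof (rule wnorm_cube_le[OF q1 l])
    have "lp_norm (ennreal q) lebesgue (rep_L2 (E s (abs_L2 f))) \<le> ennreal (C1
        * s powr (- (real CARD('n) / \<kappa>) * (recip (ennreal q) - recip (ennreal q))))
        * lp_norm (ennreal q) lebesgue (rep_L2 (abs_L2 f))"
      by (rule C1(2)[unfolded on_diagonal_def, rule_format, OF s]) (use n1 in \<open>auto intro: le_less_trans\<close>)
    also have "\<dots> \<le> ennreal C1 * ennreal n1" using s n1 by (intro mult_mono) auto
    finally show "lp_norm (ennreal q) lebesgue (rep_L2 (E s (abs_L2 f))) \<le> ennreal (C1 * n1)"
      using C1(1) by (simp add: ennreal_mult'' n1_def)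
  qed (use C1(1) in \<open>simp add: n1_def\<close>)
  have b2: "wnorm (indicator (cube 0 l)) (E s (abs_L2 f)) \<le> V * (C2 * s powr (- \<gamma>) * n2)" if s:
      "0 < s" for s
    unfolding V_def
  proof (rule wnorm_cube_le[OF q1 l])
    have "lp_norm (ennreal q) lebesgue (rep_L2 (E s (abs_L2 f))) \<le> ennreal (C2
        * s powr (- (real CARD('n) / \<kappa>) * (recip (ennreal p0) - recip (ennreal q))))
        * lp_norm (ennreal p0) lebesgue (rep_L2 (abs_L2 f))"
      by (rule C2(2)[unfolded on_diagonal_def, rule_format, OF s]) (use n2 in \<open>auto intro: le_less_trans\<close>)
    also have "- (real CARD('n) / \<kappa>) * (recip (ennreal p0) - recip (ennreal q)) = - \<gamma>"
      using p0 q1 by (simp add: recip_ennreal \<gamma>_def)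
    also have "ennreal (C2 * s powr (- \<gamma>)) * lp_norm (ennreal p0) lebesgue (rep_L2 (abs_L2 f))
        \<le> ennreal (C2 * s powr (- \<gamma>)) * ennreal n2"
      using n2 by (intro mult_left_mono) auto
    finally show "lp_norm (ennreal q) lebesgue (rep_L2 (E s (abs_L2 f))) \<le> ennreal (C2 * s powr (- \<gamma>) * n2)"
      using C2(1) by (simp add: ennreal_mult'' n2_def)
  qed (use C2(1) in \<open>simp add: n2_def\<close>)
  define A where "A = V * (C1 * n1) + V * (C2 * n2)"
  have nn: "0 \<le> V * (C1 * n1)" "0 \<le> V * (C2 * n2)" using C1(1) C2(1) by (auto simp: V_def n1_def n2_def)
  show thesis
  proof (rule that[of A])
    fix s :: real assume s: "0 < s"
    show "wnorm (indicator (cube 0 l)) (E s (abs_L2 f)) \<le> A" using b1[OF s] nn by (simp add: A_def)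
    have "V * (C2 * s powr (- \<gamma>) * n2) = V * (C2 * n2) * s powr (- \<gamma>)" by simp
    also have "\<dots> \<le> A * s powr (- \<gamma>)" using nn by (intro mult_right_mono) (auto simp: A_def)
    finally show "wnorm (indicator (cube 0 l)) (E s (abs_L2 f)) \<le> A * s powr (- (real CARD('n) / \<kappa>
        * (1 / p0 - 1 / q)))"
      using b2[OF s] by (simp add: \<gamma>_def)
  qed (use nn in \<open>simp add: A_def\<close>)
qed

text \<open>The part near 0 is at most a multiple of the integral of s^(a-1), finite since a > 0;
  the part near infinity is at most one of s^(a-\<gamma>-1), finite since a < \<gamma>.\<close>

lemma trunc_tail:
  assumes q: "p0 < q" "ennreal q < q0" and f: "bounded_comp_supp f" and l: "0 < l"
    and a: "0 < a" "a < \<gamma>" and \<gamma>: "\<gamma> = real CARD('n) / \<kappa> * (1 / p0 - 1 / q)"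
  obtains B where "0 \<le> B" "\<And>x x' y y'. 0 < x' \<Longrightarrow> x' \<le> x \<Longrightarrow> x \<le> y \<Longrightarrow> y \<le> y' \<Longrightarrow>
    wnorm (indicator (cube 0 l)) (trunc a (abs_L2 f) x y - trunc a (abs_L2 f) x' y') \<le> B * (x powr a
        + y powr (a - \<gamma>))"
proof -
  let ?g = "indicator (cube (0 :: real^'n) l) :: real^'n \<Rightarrow> real"
  let ?F = "abs_L2 f"
  have g: "sq_weight ?g"
    using l by (intro sq_weight_indicator) (auto simp: emeasure_cube simp del: emeasure_completion)
  obtain A where A: "0 \<le> A" "\<And>s. 0 < s \<Longrightarrow> wnorm ?g (E s ?F) \<le> A" "\<And>s. 0 < s \<Longrightarrow> wnorm ?g (E s ?F) \<le> A
      * s powr (- \<gamma>)"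
    by (rule E_cube_bounds[OF q f l, folded \<gamma>]) (rule that)
  have Ga: "0 < Gamma a" using a by simp
  have near: "wnorm ?g (trunc a ?F x y) \<le> A / (a * Gamma a) * y powr a" if xy: "0 < x" "x \<le> y" for x y
  proof -
    have "wnorm ?g (integral {x..y} (\<lambda>s. s powr (a - 1) *\<^sub>R E s ?F)) \<le> integral {x..y} (\<lambda>s. A
        * s powr (a - 1))"
    proof (rule wnorm_integral_le[OF g])
      show "continuous_on {x..y} (\<lambda>s. s powr (a - 1) *\<^sub>R E s ?F)"
        by (rule continuous_on_subset[OF cont_frac]) (use xy in auto)
      show "continuous_on {x..y} (\<lambda>s. A * s powr (a - 1))"
        by (intro continuous_on_mult continuous_on_const continuous_on_powr_interval xy)
      fix s assume "x \<le> s" "s \<le> y"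
      then have "0 < s" using xy by simp
      then show "wnorm ?g (s powr (a - 1) *\<^sub>R E s ?F) \<le> A * s powr (a - 1)"
        using A(2)[of s] by (simp add: wnorm_scaleR[OF g] mult.commute mult_right_mono)
    qed
    also have "\<dots> = A * ((y powr a - x powr a) / a)"
      using xy a by (simp add: integral_powr_interval)
    also have "\<dots> \<le> A * (y powr a / a)" using A(1) a by (intro mult_left_mono divide_right_mono) auto
    finally show ?thesis using Ga by (simp add: trunc_def wnorm_scaleR[OF g] field_simps)
  qed
  have far: "wnorm ?g (trunc a ?F x y) \<le> A / ((\<gamma> - a) * Gamma a) * x powr (a - \<gamma>)" if xy: "0 < x" "x
      \<le> y" for x y
  proof -
    have "wnorm ?g (integral {x..y} (\<lambda>s. s powr (a - 1) *\<^sub>R E s ?F)) \<le> integral {x..y} (\<lambda>s. A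
        * s powr ((a - \<gamma>) - 1))"
    proof (rule wnorm_integral_le[OF g])
      show "continuous_on {x..y} (\<lambda>s. s powr (a - 1) *\<^sub>R E s ?F)"
        by (rule continuous_on_subset[OF cont_frac]) (use xy in auto)
      show "continuous_on {x..y} (\<lambda>s. A * s powr ((a - \<gamma>) - 1))"
        by (intro continuous_on_mult continuous_on_const continuous_on_powr_interval xy)
      fix s assume "x \<le> s" "s \<le> y"
      then have s: "0 < s" using xy by simp
      have "wnorm ?g (s powr (a - 1) *\<^sub>R E s ?F) = s powr (a - 1) * wnorm ?g (E s ?F)"
        by (simp add: wnorm_scaleR[OF g])
      also have "\<dots> \<le> s powr (a - 1) * (A * s powr (- \<gamma>))" using A(3)[OF s] by (intro mult_left_mono) auto
      also have "\<dots> = A * (s powr (a - 1) * s powr (- \<gamma>))" by simp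
      also have "s powr (a - 1) * s powr (- \<gamma>) = s powr ((a - \<gamma>) - 1)"
          by (simp add: algebra_simps flip: powr_add)
      finally show "wnorm ?g (s powr (a - 1) *\<^sub>R E s ?F) \<le> A * s powr ((a - \<gamma>) - 1)" .
    qed
    also have "\<dots> = A * ((x powr (a - \<gamma>) - y powr (a - \<gamma>)) / (\<gamma> - a))"
    proof -
      have "integral {x..y} (\<lambda>s. s powr ((a - \<gamma>) - 1)) = (y powr (a - \<gamma>) - x powr (a - \<gamma>)) / (a - \<gamma>)"
        using a by (intro integral_powr_interval xy) simp
      also have "\<dots> = (x powr (a - \<gamma>) - y powr (a - \<gamma>)) / (\<gamma> - a)"
        by (metis minus_diff_eq minus_divide_divide)
      finally show ?thesis by simp
    qed
    also have "\<dots> \<le> A * (x powr (a - \<gamma>) / (\<gamma> - a))" using A(1) a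
        by (intro mult_left_mono divide_right_mono) auto
    finally have "1 / Gamma a * wnorm ?g (integral {x..y} (\<lambda>s. s powr (a - 1) *\<^sub>R E s ?F))
        \<le> 1 / Gamma a * (A * (x powr (a - \<gamma>) / (\<gamma> - a)))"
      using Ga by (intro mult_left_mono) auto
    then show ?thesis using Ga by (simp add: trunc_def wnorm_scaleR[OF g] mult_ac)
  qed
  define B where "B = A / (a * Gamma a) + A / ((\<gamma> - a) * Gamma a)"
  have nn: "0 \<le> A / (a * Gamma a)" "0 \<le> A / ((\<gamma> - a) * Gamma a)" using A(1) a Ga by auto
  show thesis
  proof (rule that[of B])
    fix x x' y y' :: real assume *: "0 < x'" "x' \<le> x" "x \<le> y" "y \<le> y'"
    have "trunc a ?F x' y' = trunc a ?F x' x + trunc a ?F x y + trunc a ?F y y'"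
      unfolding trunc_def using * frac_integral_combine[of x' x y' a ?F] frac_integral_combine[of x
          y y' a ?F]
      by (simp add: scaleR_add_right)
    then have "trunc a ?F x y - trunc a ?F x' y' = (-1) *\<^sub>R (trunc a ?F x' x + trunc a ?F y y')" by simp
    then have "wnorm ?g (trunc a ?F x y - trunc a ?F x' y') = wnorm ?g (trunc a ?F x' x + trunc a ?F y y')"
      by (simp only: wnorm_scaleR[OF g])
    also have "\<dots> \<le> wnorm ?g (trunc a ?F x' x) + wnorm ?g (trunc a ?F y y')" by (rule wnorm_add[OF g])
    also have "\<dots> \<le> A / (a * Gamma a) * x powr a + A / ((\<gamma> - a) * Gamma a) * y powr (a - \<gamma>)"
      using * by (intro add_mono near far) auto
    also have "\<dots> \<le> B * x powr a + B * y powr (a - \<gamma>)"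
      using nn by (intro add_mono mult_right_mono) (auto simp: B_def)
    finally show "wnorm ?g (trunc a ?F x y - trunc a ?F x' y') \<le> B * (x powr a + y powr (a - \<gamma>))"
      by (simp add: algebra_simps)
  qed (use nn in \<open>simp add: B_def\<close>)
qed

text \<open>At the truncation points 3^(-\<kappa> N) and 3^(\<kappa> N) the increments decay
  geometrically, so a pointwise limit g exists. Fatou's lemma turns the tail bound into local L^1
  convergence for arbitrary truncations. Pointwise convergence is kept in the conclusion for a later
  use of Fatou's lemma.\<close>

lemma neg_power_exists:
  assumes q: "p0 < q" "ennreal q < q0" and f: "bounded_comp_supp f"
    and a: "0 < a" "a < real CARD('n) / \<kappa> * (1 / p0 - 1 / q)"
  obtains g where "g \<in> borel_measurable lebesgue" "is_neg_power L a (abs_L2 f) g"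
    "AE x in lebesgue. (\<lambda>N. rep_L2 (trunc a (abs_L2 f) (3 powr (- (\<kappa> * real N))) (3 powr (\<kappa>
        * real N))) x) \<longlonglongrightarrow> g x"
proof -
  define \<gamma> where "\<gamma> = real CARD('n) / \<kappa> * (1 / p0 - 1 / q)"
  have a': "0 < a" "a < \<gamma>" using a by (simp_all add: \<gamma>_def)
  let ?F = "abs_L2 f"
  define X Y where "X N = 3 powr (- (\<kappa> * real N))" and "Y N = 3 powr (\<kappa> * real N)" for N
  define H where "H N = trunc a ?F (X N) (Y N)" for N
  have XY: "0 < X N" "X N \<le> 1" "1 \<le> Y N" for N
    unfolding X_def Y_def using \<kappa> powr_mono[of "- (\<kappa> * real N)" 0 3] powr_mono[of 0 "\<kappa> * real N" 3] by auto
  have XY_mono: "X N' \<le> X N" "Y N \<le> Y N'" if "N \<le> N'" for N N'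
    unfolding X_def Y_def using \<kappa> that by (auto intro!: powr_mono mult_left_mono)
  have cb: "\<exists>B\<ge>0. \<forall>x x' y y'. 0 < x' \<longrightarrow> x' \<le> x \<longrightarrow> x \<le> y \<longrightarrow> y \<le> y' \<longrightarrow>
    wnorm (indicator (cube 0 l)) (trunc a ?F x y - trunc a ?F x' y') \<le> B * (x powr a
        + y powr (a - \<gamma>))" if l: "0 < l" for l
    by (rule trunc_tail[OF q f l a' \<gamma>_def]) blast
  obtain g where g: "g \<in> borel_measurable lebesgue" "AE x in lebesgue. (\<lambda>N. rep_L2 (H N) x) \<longlonglongrightarrow> g x"
  proof (rule AE_convergent_of_summable[of "\<lambda>N. rep_L2 (H N)"])
    fix j :: nat
    obtain l where l: "0 < l" "cball 0 (real j) \<subseteq> cube (0 :: real^'n) l"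
        using compact_subset_cube[of "cball 0 (real j)"] by auto
    obtain B where B: "0 \<le> B" "\<And>x x' y y'. 0 < x' \<Longrightarrow> x' \<le> x \<Longrightarrow> x \<le> y \<Longrightarrow> y \<le> y' \<Longrightarrow>
      wnorm (indicator (cube 0 l)) (trunc a ?F x y - trunc a ?F x' y') \<le> B * (x powr a + y powr (a - \<gamma>))"
      using cb[OF l(1)] by blast
    define \<rho>1 \<rho>2 where "\<rho>1 = 3 powr (- (\<kappa> * a))" and "\<rho>2 = 3 powr (- (\<kappa> * (\<gamma> - a)))"
    have \<rho>: "0 \<le> \<rho>1" "\<rho>1 < 1" "0 \<le> \<rho>2" "\<rho>2 < 1"
      unfolding \<rho>1_def \<rho>2_def using \<kappa> a' powr_less_mono[of "- (\<kappa> * a)" 0 3] powr_less_mono[of "- (\<kappa>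
          * (\<gamma> - a))" 0 3] by auto
    have "(\<integral>\<^sup>+x\<in>cball 0 (real j). ennreal (norm (rep_L2 (H (Suc N)) x - rep_L2 (H N) x)) \<partial>lebesgue)
        \<le> ennreal (B * (\<rho>1 ^ N + \<rho>2 ^ N))" for N
    proof -
      have "(\<integral>\<^sup>+x\<in>cball 0 (real j). ennreal (norm (rep_L2 (H (Suc N)) x - rep_L2 (H N) x)) \<partial>lebesgue)
        \<le> (\<integral>\<^sup>+x\<in>cube 0 l. ennreal (norm (rep_L2 (H N) x - rep_L2 (H (Suc N)) x)) \<partial>lebesgue)"
        using l(2) by (intro nn_integral_mono) (auto simp: indicator_def norm_minus_commute)
      also have "\<dots> = ennreal (wnorm (indicator (cube 0 l)) (H N - H (Suc N)))"
        by (rule nn_integral_diff_cube[OF l(1)])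
      also have "\<dots> \<le> ennreal (B * (X N powr a + Y N powr (a - \<gamma>)))"
        unfolding H_def using XY[of N] XY[of "Suc N"] XY_mono[of N "Suc N"] by (intro ennreal_leI B(2)) auto
      also have "X N powr a = \<rho>1 ^ N" by (simp add: X_def \<rho>1_def powr_powr mult_ac flip: powr_realpow)
      also have "Y N powr (a - \<gamma>) = \<rho>2 ^ N" by (simp add: Y_def \<rho>2_def powr_powr algebra_simps flip:
          powr_realpow)
      finally show ?thesis .
    qed
    then have "(\<Sum>N. \<integral>\<^sup>+x\<in>cball 0 (real j). ennreal (norm (rep_L2 (H (Suc N)) x - rep_L2 (H N) x)) \<partial>lebesgue)
      \<le> (\<Sum>N. ennreal (B * (\<rho>1 ^ N + \<rho>2 ^ N)))" by (intro suminf_le) auto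
    also have "\<dots> = ennreal (\<Sum>N. B * (\<rho>1 ^ N + \<rho>2 ^ N))"
      using \<rho> B(1) by (intro suminf_ennreal2 summable_mult summable_add summable_geometric) auto
    finally show "(\<Sum>N. \<integral>\<^sup>+x\<in>cball 0 (real j). ennreal (norm (rep_L2 (H (Suc N)) x - rep_L2 (H N) x))
        \<partial>lebesgue) < \<infinity>"
      by (simp add: le_less_trans)
  qed (auto intro: that)
  have "is_neg_power L a ?F g"
    unfolding is_neg_power_def
  proof (intro conjI allI impI g(1))
    fix K :: "(real^'n) set" assume "compact K"
    then obtain l where l: "0 < l" "K \<subseteq> cube 0 l" using compact_subset_cube[of K]
        compact_imp_bounded by auto
    obtain B where B: "0 \<le> B" "\<And>x x' y y'. 0 < x' \<Longrightarrow> x' \<le> x \<Longrightarrow> x \<le> y \<Longrightarrow> y \<le> y' \<Longrightarrow>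
      wnorm (indicator (cube 0 l)) (trunc a ?F x y - trunc a ?F x' y') \<le> B * (x powr a + y powr (a - \<gamma>))"
      using cb[OF l(1)] by blast
    let ?Fi = "at_right (0 :: real) \<times>\<^sub>F (at_top :: real filter)"
    have le: "(\<integral>\<^sup>+x\<in>K. ennreal (norm (rep_L2 (trunc a ?F \<delta> R) x - g x)) \<partial>lebesgue) \<le> ennreal (B
        * (\<delta> powr a + R powr (a - \<gamma>)))"
      if \<delta>R: "0 < \<delta>" "\<delta> \<le> R" for \<delta> R
    proof -
      have "(\<integral>\<^sup>+x\<in>K. ennreal (norm (rep_L2 (trunc a ?F \<delta> R) x - g x)) \<partial>lebesgue)
        \<le> (\<integral>\<^sup>+x. liminf (\<lambda>N. ennreal (norm (rep_L2 (trunc a ?F \<delta> R) x - rep_L2 (H N) x))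
            * indicator (cube 0 l) x) \<partial>lebesgue)"
      proof (rule nn_integral_mono_AE, use g(2) in eventually_elim)
        case (elim x)
        have "(\<lambda>N. ennreal (norm (rep_L2 (trunc a ?F \<delta> R) x - rep_L2 (H N) x)))
            \<longlonglongrightarrow> ennreal (norm (rep_L2 (trunc a ?F \<delta> R) x - g x))"
          using elim by (intro tendsto_ennrealI tendsto_intros)
        then have *: "liminf (\<lambda>N. ennreal (norm (rep_L2 (trunc a ?F \<delta> R) x - rep_L2 (H N) x)))
            = ennreal (norm (rep_L2 (trunc a ?F \<delta> R) x - g x))"
          by (metis lim_imp_Liminf trivial_limit_sequentially)
        show ?case using l(2) by (cases "x \<in> cube 0 l") (auto simp: * indicator_def)
      qed
      also have "\<dots> \<le> liminf (\<lambda>N. \<integral>\<^sup>+x\<in>cube 0 l. ennreal (norm (rep_L2 (trunc a ?F \<delta> R) x - rep_L2 (H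
          N) x)) \<partial>lebesgue)"
        by (intro nn_integral_liminf) measurable
      also have "\<dots> \<le> liminf (\<lambda>N. ennreal (B * (\<delta> powr a + R powr (a - \<gamma>))))"
      proof (rule Liminf_mono)
        have Xlim: "X \<longlonglongrightarrow> 0"
        proof -
          have "X = (\<lambda>N. (3 powr (- \<kappa>)) ^ N)" by (auto simp: X_def powr_powr simp flip: powr_realpow)
          then show ?thesis using \<kappa> powr_less_mono[of "- \<kappa>" 0 3] by (simp add: LIMSEQ_realpow_zero)
        qed
        have XYinv: "Y N = 1 / X N" for N by (simp add: X_def Y_def powr_minus divide_inverse)
        have "eventually (\<lambda>N. X N < \<delta>) sequentially" "eventually (\<lambda>N. X N < 1 / R) sequentially"
          using order_tendstoD(2)[OF Xlim] \<delta>R by auto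
        then show "eventually (\<lambda>N. (\<integral>\<^sup>+x\<in>cube 0 l. ennreal (norm (rep_L2 (trunc a ?F \<delta> R) x - rep_L2
            (H N) x)) \<partial>lebesgue)
            \<le> ennreal (B * (\<delta> powr a + R powr (a - \<gamma>)))) sequentially"
        proof eventually_elim
          case (elim N)
          have "R \<le> Y N" using elim(2) XY(1)[of N] \<delta>R unfolding XYinv by (simp add: field_simps)
          then show ?case
            unfolding nn_integral_diff_cube[OF l(1)] H_def using elim(1) XY(1)[of N] \<delta>R
            by (intro ennreal_leI B(2)) auto
        qed
      qed
      finally show ?thesis by (simp add: Liminf_const)
    qed
    have lim: "((\<lambda>z. ennreal (B * (fst z powr a + snd z powr (a - \<gamma>)))) \<longlongrightarrow> ennreal (B * (0 powr a + 0))) ?Fi"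
    proof (intro tendsto_ennrealI tendsto_mult tendsto_const tendsto_add)
      have "eventually (\<lambda>\<delta>. 0 \<le> \<delta>) (at_right (0 :: real))"
          by (simp add: eventually_at_right_less eventually_mono[OF eventually_at_right_less])
      then have "((\<lambda>\<delta>. \<delta> powr a) \<longlongrightarrow> 0 powr a) (at_right 0)"
        using a'(1) by (intro tendsto_powr' tendsto_ident_at tendsto_const) auto
      then show "((\<lambda>z. fst z powr a) \<longlongrightarrow> 0 powr a) ?Fi"
        by (rule filterlim_compose[OF _ filterlim_fst])
      have "((\<lambda>R :: real. R powr (a - \<gamma>)) \<longlongrightarrow> 0) at_top"
        using a'(2) by (intro tendsto_neg_powr filterlim_ident) auto
      then show "((\<lambda>z. snd z powr (a - \<gamma>)) \<longlongrightarrow> 0) ?Fi"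
        by (rule filterlim_compose[OF _ filterlim_snd])
    qed
    have "((\<lambda>z. \<integral>\<^sup>+x\<in>K. ennreal (norm (rep_L2 (trunc a ?F (fst z) (snd z)) x - g x)) \<partial>lebesgue) \<longlongrightarrow> 0) ?Fi"
    proof (rule tendsto_sandwich[OF _ _ tendsto_const])
      show "((\<lambda>z. ennreal (B * (fst z powr a + snd z powr (a - \<gamma>)))) \<longlongrightarrow> 0) ?Fi" using lim by simp
      have "eventually (\<lambda>z. (0 < fst z \<and> fst z < 1) \<and> 1 \<le> snd z) ?Fi"
        by (rule eventually_prodI) (auto simp: eventually_ge_at_top intro: eventually_mono[OF
            eventually_at_right_real[of 0 1]])
      then show "eventually (\<lambda>z. (\<integral>\<^sup>+x\<in>K. ennreal (norm (rep_L2 (trunc a ?F (fst z) (snd z)) x - g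
          x)) \<partial>lebesgue)
        \<le> ennreal (B * (fst z powr a + snd z powr (a - \<gamma>)))) ?Fi"
        by eventually_elim (intro le, auto)
    qed (auto intro!: always_eventually)
    then show "((\<lambda>(\<delta>, R). \<integral>\<^sup>+x\<in>K. ennreal (norm (rep_L2 ((1 / Gamma a) *\<^sub>R integral {\<delta>..R} (\<lambda>s. s
        powr (a - 1) *\<^sub>R E s ?F)) x - g x)) \<partial>lebesgue) \<longlongrightarrow> 0) ?Fi"
      by (simp add: trunc_def case_prod_unfold)
  qed
  then show thesis using that g unfolding H_def X_def Y_def by blast
qed

end

section \<open>The weighted estimate\<close>

lemma mean_finite:
  fixes w :: "real^'n \<Rightarrow> real"
  assumes w: "w \<in> borel_measurable lebesgue" "\<And>x. 0 \<le> w x" and l: "0 < l" and fin: "mean w (cube c l) < \<infinity>"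
  shows "set_integrable lebesgue (cube c l) w" "mean w (cube c l)
      = ennreal (wint w (cube c l) / vol (cube c l))"
proof -
  let ?Q = "cube c l"
  have Q: "0 < vol ?Q" "emeasure lebesgue ?Q = ennreal (vol ?Q)"
    using l by (simp_all add: measure_cube emeasure_cube del: emeasure_completion)
  have mean: "mean w ?Q = (\<integral>\<^sup>+x\<in>?Q. ennreal (w x) \<partial>lebesgue) / ennreal (vol ?Q)"
    unfolding mean_def using w by (subst nn_integral_uniform_measure) (auto simp: Q(2) simp del:
        emeasure_completion)
  have eq: "(\<integral>\<^sup>+x. ennreal (indicator ?Q x *\<^sub>R w x) \<partial>lebesgue) = (\<integral>\<^sup>+x\<in>?Q. ennreal (w x) \<partial>lebesgue)"
    by (intro nn_integral_cong) (auto simp: indicator_def)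
  have "(\<integral>\<^sup>+x\<in>?Q. ennreal (w x) \<partial>lebesgue) < \<infinity>"
    using fin Q(1) unfolding mean by (cases "(\<integral>\<^sup>+x\<in>?Q. ennreal (w x) \<partial>lebesgue)") (auto simp:
        ennreal_top_divide)
  then have "integrable lebesgue (\<lambda>x. indicator ?Q x *\<^sub>R w x)"
    using w by (intro integrableI_nonneg) (auto simp: eq[simplified])
  then show "set_integrable lebesgue ?Q w" by (simp add: set_integrable_def)
  then have "(\<integral>\<^sup>+x\<in>?Q. ennreal (w x) \<partial>lebesgue) = ennreal (wint w ?Q)"
    unfolding eq[symmetric] wint_def set_lebesgue_integral_def set_integrable_def
    using w by (intro nn_integral_eq_integral) auto
  then show "mean w ?Q = ennreal (wint w ?Q / vol ?Q)"
    unfolding mean using Q(1) wint_nonneg[of w ?Q] w by (simp add: divide_ennreal)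
qed

lemma mean_weight:
  assumes \<omega>: "weight \<omega>" and l: "0 < l"
  obtains m where "0 < m" "mean \<omega> (cube c l) = ennreal m"
proof -
  let ?Q = "cube c l"
  have w: "\<omega> \<in> borel_measurable lebesgue" "\<And>x. 0 \<le> \<omega> x" "AE x in lebesgue. 0 < \<omega> x"
    using \<omega> by (auto simp: weight_def)
  have Q: "0 < vol ?Q" "emeasure lebesgue ?Q = ennreal (vol ?Q)"
    using l by (simp_all add: measure_cube emeasure_cube del: emeasure_completion)
  have int: "set_integrable lebesgue ?Q \<omega>" using \<omega> by (simp add: weight_def cube_def)
  have "(\<integral>\<^sup>+x\<in>?Q. ennreal (\<omega> x) \<partial>lebesgue) = (\<integral>\<^sup>+x. ennreal (indicator ?Q x *\<^sub>R \<omega> x) \<partial>lebesgue)"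
    by (intro nn_integral_cong) (auto simp: indicator_def)
  also have "\<dots> = ennreal (wint \<omega> ?Q)"
    unfolding wint_def set_lebesgue_integral_def using int[unfolded set_integrable_def] w
    by (intro nn_integral_eq_integral) auto
  finally have "mean \<omega> ?Q = ennreal (wint \<omega> ?Q) / ennreal (vol ?Q)"
    unfolding mean_def using w by (subst nn_integral_uniform_measure) (auto simp: Q(2) simp del:
        emeasure_completion)
  then have mean: "mean \<omega> ?Q = ennreal (wint \<omega> ?Q / vol ?Q)"
    using Q(1) wint_nonneg[of \<omega> ?Q] w by (simp add: divide_ennreal)
  have "wint \<omega> ?Q \<noteq> 0"
  proof
    assume "wint \<omega> ?Q = 0"
    then have "AE x in lebesgue. indicator ?Q x *\<^sub>R \<omega> x = 0"
      unfolding wint_def set_lebesgue_integral_def using int[unfolded set_integrable_def] w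
      by (subst (asm) integral_nonneg_eq_0_iff_AE) auto
    with w(3) have "AE x in lebesgue. x \<notin> ?Q" by eventually_elim (auto simp: indicator_def)
    then have "emeasure lebesgue ?Q = 0" by (subst (asm) AE_iff_measurable[OF _ refl]) auto
    then show False using Q by simp
  qed
  then have "0 < wint \<omega> ?Q / vol ?Q" using Q(1) wint_nonneg[of \<omega> ?Q] w by (simp add: less_le)
  then show thesis using mean that by blast
qed

text \<open>In the product of the two constants over one cube the mean of \<omega> cancels and the
  bound for the pair remains. The index t = 1 + 1/r1 is the one whose dual weight is \<omega>^(-r1),
  with outer exponent 1/r1.\<close>

lemma weight_pair_of_consts:
  fixes \<omega> :: "real^'n::finite \<Rightarrow> real"
  assumes \<omega>: "weight \<omega>" and r: "0 < r1" "0 < r2" and t: "t = 1 + 1 / r1"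
    and A: "A_const t \<omega> < \<infinity>" and RH: "RH_const r2 \<omega> < \<infinity>"
  shows "weight_pair b (\<lambda>x. \<omega> x powr (- r1)) (\<lambda>x. \<omega> x powr r2) r1 r2 (enn2real (A_const t \<omega>
      * RH_const r2 \<omega>))"
proof -
  let ?v = "\<lambda>x. \<omega> x powr (- r1)" and ?u = "\<lambda>x. \<omega> x powr r2"
  have w: "\<omega> \<in> borel_measurable lebesgue" "AE x in lebesgue. 0 < \<omega> x" using \<omega> by (auto simp: weight_def)
  have meas: "?v \<in> borel_measurable lebesgue" "?u \<in> borel_measurable lebesgue" using w(1) by auto
  have exps: "1 - conj_exp t = - r1" "t - 1 = 1 / r1" using r by (simp_all add: t conj_exp_def field_simps)
  have cube: "set_integrable lebesgue (cube c l) ?v \<and> set_integrable lebesgue (cube c l) ?u \<and>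
      (wint ?v (cube c l) / vol (cube c l)) powr (1 / r1)
          * (wint ?u (cube c l) / vol (cube c l)) powr (1 / r2)
      \<le> enn2real (A_const t \<omega> * RH_const r2 \<omega>)" if l: "0 < l" for c l
  proof -
    let ?Q = "cube c l"
    obtain m where m: "0 < m" "mean \<omega> ?Q = ennreal m" using mean_weight[OF \<omega> l] .
    have "(case (c, l) of (c, l) \<Rightarrow> mean \<omega> (cube c l) * mean (\<lambda>x. \<omega> x powr (1 - conj_exp t)) (cube c
        l) epowr (t - 1)) \<le> A_const t \<omega>"
      unfolding A_const_def by (rule SUP_upper) (use l in auto)
    then have leA: "ennreal m * mean ?v ?Q epowr (1 / r1) \<le> A_const t \<omega>" by (simp add: exps m(2))
    have "(case (c, l) of (c, l) \<Rightarrow> mean (\<lambda>x. \<omega> x powr r2) (cube c l) epowr (1 / r2) / mean \<omega> (cube c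
        l)) \<le> RH_const r2 \<omega>"
      unfolding RH_const_def by (rule SUP_upper) (use l in auto)
    then have leRH: "mean ?u ?Q epowr (1 / r2) / ennreal m \<le> RH_const r2 \<omega>" by (simp add: m(2))
    \<comment> \<open>An infinite mean times the positive number m would make the weight constant
      infinite. This is how local integrability of both members of the pair is obtained.\<close>
    have fin_v: "mean ?v ?Q < \<infinity>"
    proof (rule ccontr)
      assume "\<not> mean ?v ?Q < \<infinity>"
      then have "mean ?v ?Q epowr (1 / r1) = \<infinity>" by (simp add: epowr_def less_top)
      then have "ennreal m * mean ?v ?Q epowr (1 / r1) = \<infinity>" using m(1) by (simp add: ennreal_mult_top)
      then show False using leA A by (simp add: top_unique)
    qed
    have fin_u: "mean ?u ?Q < \<infinity>"
    proof (rule ccontr)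
      assume "\<not> mean ?u ?Q < \<infinity>"
      then have "mean ?u ?Q epowr (1 / r2) = \<infinity>" by (simp add: epowr_def less_top)
      then have "mean ?u ?Q epowr (1 / r2) / ennreal m = \<infinity>" by (simp add: ennreal_top_divide)
      then show False using leRH RH by (simp add: top_unique)
    qed
    note mv = mean_finite[OF meas(1) _ l fin_v] and mu = mean_finite[OF meas(2) _ l fin_u]
    define x where "x = (wint ?v ?Q / vol ?Q) powr (1 / r1)"
    define y where "y = (wint ?u ?Q / vol ?Q) powr (1 / r2)"
    have nn: "0 \<le> wint ?v ?Q / vol ?Q" "0 \<le> wint ?u ?Q / vol ?Q"
        by (auto intro!: divide_nonneg_nonneg wint_nonneg)
    have xe: "mean ?v ?Q epowr (1 / r1) = ennreal x" using mv(2) nn by (simp add: epowr_def x_def)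
    have ye: "mean ?u ?Q epowr (1 / r2) = ennreal y" using mu(2) nn by (simp add: epowr_def y_def)
    have "ennreal (x * y) = (ennreal m * ennreal x) * (ennreal y / ennreal m)"
      using m(1) by (simp add: divide_ennreal x_def y_def flip: ennreal_mult)
    also have "\<dots> \<le> A_const t \<omega> * RH_const r2 \<omega>"
      using leA leRH by (intro mult_mono) (auto simp: xe ye)
    finally have "enn2real (ennreal (x * y)) \<le> enn2real (A_const t \<omega> * RH_const r2 \<omega>)"
      using A RH by (intro enn2real_mono) (auto simp: ennreal_mult_less_top)
    then have "x * y \<le> enn2real (A_const t \<omega> * RH_const r2 \<omega>)" by (simp add: x_def y_def)
    then show ?thesis using mv(1) mu(1) by (simp add: x_def y_def)
  qed
  show ?thesis
  proof
    fix k m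
    let ?c = "cell_center b k m"
    note cu = cube[of "3 powi k" ?c]
    have l: "0 < (3 :: real) powi k" by simp
    show "set_integrable lebesgue (cell b k m) ?v" "set_integrable lebesgue (cell b k m) ?u"
      using cu[OF l] cell_subset_cube[of b k m] by (auto intro: set_integrable_subset)
    show "(wint ?v (cell b k m) / vol (cell b k m)) powr (1 / r1)
        * (wint ?u (cell b k m) / vol (cell b k m)) powr (1 / r2)
      \<le> enn2real (A_const t \<omega> * RH_const r2 \<omega>)"
      using cu[OF l] unfolding wint_cell_eq_cube[OF meas(1)] wint_cell_eq_cube[OF meas(2)]
          vol_cell_eq_cube by blast
  next
    show "AE x in lebesgue. ?v x powr (1 / r1) * ?u x powr (1 / r2) = 1"
      using w(2) by eventually_elim (use r in \<open>simp add: powr_powr flip: powr_add\<close>)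
  qed (use r in auto)
qed

section \<open>Duality and conclusion\<close>

text \<open>The test function |g|^(q-1) \<omega>^q is extremal: its pairing with g and its dual norm
  to the power q' are both the quantity X to be bounded, so X <= B X^(1/q'). Truncation makes X
  finite, which permits the division; Fatou's lemma removes the truncation.\<close>

lemma nn_integral_powr_le_by_duality:
  fixes g :: "real^'n \<Rightarrow> complex"
  assumes g: "g \<in> borel_measurable lebesgue" and \<omega>: "weight \<omega>" and q: "1 < q" "1 / q + 1 / q' = 1"
      and B: "0 \<le> B"
    and dual: "\<And>h. test_fun h \<Longrightarrow> integrable lebesgue (\<lambda>x. h x powr q' * \<omega> x powr (- q')) \<Longrightarrow>
      (\<integral>\<^sup>+x. ennreal (norm (g x) * h x) \<partial>lebesgue) \<le> ennreal (B * (\<integral>x. h x powr q'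
          * \<omega> x powr (- q') \<partial>lebesgue) powr (1 / q'))"
  shows "(\<integral>\<^sup>+x. ennreal (norm (g x) powr q * \<omega> x powr q) \<partial>lebesgue) \<le> ennreal (B powr q)"
proof -
  have w [measurable]: "\<omega> \<in> borel_measurable lebesgue" and w0: "\<And>x. 0 \<le> \<omega> x" and wpos: "AE x
      in lebesgue. 0 < \<omega> x"
    using \<omega> by (auto simp: weight_def)
  note g[measurable]
  have q': "1 < q'" using conjugate_gt_1[OF q] .
  have e: "(q - 1) * q' = q" "q * q' - q' = q"
  proof -
    have "1 / q = 1 - 1 / q'" using q(2) by simp
    then have "q' = q * q' - q" using q q' by (simp add: field_simps)
    then show "(q - 1) * q' = q" "q * q' - q' = q" by (simp_all add: algebra_simps)
  qed
  \<comment> \<open>The ball and the two upper bounds make the test function admissible; 0 <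
    \<omega> x allows \<omega>^(q q') and \<omega>^(-q') to be combined.\<close>
  define S where "S N = {x \<in> cball 0 (real N). norm (g x) \<le> real N \<and> 0 < \<omega> x \<and> \<omega> x \<le> real N}" for N :: nat
  have S_sets [measurable]: "S N \<in> sets lebesgue" for N
  proof -
    have [measurable]: "cball 0 (real N) \<in> sets (lebesgue :: (real^'n) measure)" by simp
    have "S N = cball 0 (real N) \<inter> {x \<in> space lebesgue. norm (g x) \<le> real N \<and> 0 < \<omega> x \<and> \<omega> x \<le> real N}"
      by (auto simp: S_def)
    also have "\<dots> \<in> sets lebesgue" by measurable
    finally show ?thesis .
  qed
  define h where "h N x = norm (g x) powr (q - 1) * \<omega> x powr q * indicator (S N) x" for N x
  define k where "k N x = norm (g x) powr q * \<omega> x powr q * indicator (S N) x" for N x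
  have gh: "norm (g x) * h N x = k N x" for N x
  proof -
    have "norm (g x) * norm (g x) powr (q - 1) = norm (g x) powr q"
      using q by (cases "g x = 0") (auto simp: powr_diff)
    then show ?thesis by (simp add: h_def k_def mult.assoc[symmetric])
  qed
  have hw: "h N x powr q' * \<omega> x powr (- q') = k N x" for N x
  proof (cases "x \<in> S N")
    case True
    then have "0 < \<omega> x" by (simp add: S_def)
    have "h N x powr q' * \<omega> x powr (- q') = norm (g x) powr ((q - 1) * q') * (\<omega> x powr (q * q')
        * \<omega> x powr (- q'))"
      using True w0 by (simp add: h_def powr_mult powr_powr)
    also have "\<omega> x powr (q * q') * \<omega> x powr (- q') = \<omega> x powr (q * q' - q')" by (simp flip: powr_add)
    finally show ?thesis using True by (simp add: e k_def)
  qed (simp add: h_def k_def)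
  have cb: "emeasure lebesgue (cball (0 :: real^'n) (real N)) < \<infinity>" for N by (rule emeasure_cball_finite)
  have k_int: "integrable lebesgue (k N)" for N
  proof (rule Bochner_Integration.integrable_bound)
    show "integrable lebesgue (\<lambda>x. real N powr q * real N powr q
        * indicator (cball (0 :: real^'n) (real N)) x)"
      using cb[of N] by (intro integrable_mult_right) (auto simp: integrable_indicator_iff simp del:
          emeasure_completion)
    show "k N \<in> borel_measurable lebesgue" unfolding k_def by measurable
    show "AE x in lebesgue. norm (k N x) \<le> norm (real N powr q * real N powr q
        * indicator (cball (0 :: real^'n) (real N)) x)"
    proof (rule AE_I2)
      fix x
      show "norm (k N x) \<le> norm (real N powr q * real N powr q
          * indicator (cball (0 :: real^'n) (real N)) x)"
      proof (cases "x \<in> S N")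
        case True
        then have "norm (g x) powr q * \<omega> x powr q \<le> real N powr q * real N powr q"
          using q w0 by (intro mult_mono powr_mono2) (auto simp: S_def)
        then show ?thesis using True by (simp add: k_def S_def)
      qed (simp add: k_def)
    qed
  qed
  have h_test: "test_fun (h N)" for N
    unfolding test_fun_def bounded_comp_supp_def
  proof (intro conjI allI)
    show "0 \<le> h N x" for x by (simp add: h_def)
    show "(\<lambda>x. complex_of_real (h N x)) \<in> borel_measurable lebesgue" unfolding h_def by measurable
    have "norm (complex_of_real (h N x)) \<le> real N powr (q - 1) * real N powr q" for x
    proof (cases "x \<in> S N")
      case True
      then have "norm (g x) powr (q - 1) * \<omega> x powr q \<le> real N powr (q - 1) * real N powr q"
        using q w0 by (intro mult_mono powr_mono2) (auto simp: S_def)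
      then show ?thesis using True by (simp add: h_def norm_mult)
    qed (simp add: h_def)
    then show "bounded (range (\<lambda>x. complex_of_real (h N x)))" by (auto simp: bounded_iff)
    have "bounded {x. complex_of_real (h N x) \<noteq> 0}"
      by (rule bounded_subset[OF bounded_cball[of 0 "real N"]]) (auto simp: h_def S_def indicator_def)
    then show "compact (closure {x. complex_of_real (h N x) \<noteq> 0})"
      by (simp add: compact_eq_bounded_closed bounded_closure)
  qed
  have le: "(\<integral>\<^sup>+x. ennreal (k N x) \<partial>lebesgue) \<le> ennreal (B powr q)" for N
  proof -
    define X where "X = (\<integral>x. k N x \<partial>lebesgue)"
    have X0: "0 \<le> X" unfolding X_def by (simp add: k_def)
    have nnX: "(\<integral>\<^sup>+x. ennreal (k N x) \<partial>lebesgue) = ennreal X"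
      unfolding X_def by (rule nn_integral_eq_integral[OF k_int]) (simp add: k_def)
    have "ennreal X \<le> ennreal (B * X powr (1 / q'))"
      using dual[OF h_test[of N]] k_int[of N] unfolding gh hw nnX by (simp add: X_def)
    then have le: "X \<le> B * X powr (1 / q')" using B by (simp add: ennreal_le_iff)
    have "X \<le> B powr q"
    proof (cases "X = 0")
      case False
      then have "X powr (1 / q) = X / X powr (1 / q')"
        using X0 q(2) by (simp add: eq_diff_eq[symmetric] powr_diff)
      also have "\<dots> \<le> B" using le False X0 by (simp add: divide_le_eq)
      finally have "(X powr (1 / q)) powr q \<le> B powr q" using q by (intro powr_mono2) auto
      then show ?thesis using q X0 by (simp add: powr_powr)
    qed simp
    then show ?thesis using nnX by (simp add: ennreal_leI)
  qed
  have "(\<integral>\<^sup>+x. ennreal (norm (g x) powr q * \<omega> x powr q) \<partial>lebesgue)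
      \<le> (\<integral>\<^sup>+x. liminf (\<lambda>N. ennreal (k N x)) \<partial>lebesgue)"
  proof (rule nn_integral_mono_AE, use wpos in eventually_elim)
    case (elim x)
    obtain N0 :: nat where N0: "max (norm x) (max (norm (g x)) (\<omega> x)) \<le> real N0"
        using real_arch_simple by blast
    have "eventually (\<lambda>N. ennreal (norm (g x) powr q * \<omega> x powr q) \<le> ennreal (k N x)) sequentially"
      using eventually_ge_at_top[of N0]
    proof eventually_elim
      case (elim N)
      then have "x \<in> S N" using N0 \<open>0 < \<omega> x\<close> by (auto simp: S_def)
      then show ?case by (simp add: k_def)
    qed
    then show ?case by (rule Liminf_bounded)
  qed
  also have "\<dots> \<le> liminf (\<lambda>N. \<integral>\<^sup>+x. ennreal (k N x) \<partial>lebesgue)"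
    using k_int by (intro nn_integral_liminf) auto
  also have "\<dots> \<le> liminf (\<lambda>N. ennreal (B powr q))"
    by (intro Liminf_mono always_eventually allI le)
  finally show ?thesis by (simp add: Liminf_const)
qed

theorem corollary1p4:
  fixes L :: "'n::finite graph" and p0 p q \<epsilon> \<kappa> \<alpha> :: real and q0 :: ennreal
  assumes "1 \<le> p0" and "ennreal p0 < q0" and "0 < \<epsilon>" and "0 < \<kappa>"
    and "condA1 L" and "condA2 L p0 q0 \<epsilon> \<kappa>"
    and "p0 < p" and "p < q" and "ennreal q < q0"
    and "\<alpha> = real CARD('n) * (1 / p - 1 / q)"
  shows "\<exists>C::real. \<forall>\<omega>. weight \<omega> \<longrightarrow>
           A_const (1 + 1 / p0 - 1 / p) \<omega> < \<infinity> \<longrightarrow> RH_const (RH_exponent q q0) \<omega> < \<infinity> \<longrightarrow>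
           (\<forall>f. bounded_comp_supp f \<longrightarrow>
              (\<exists>g. is_neg_power L (\<alpha> / \<kappa>) (abs_L2 f) g) \<and>
              (\<forall>g. is_neg_power L (\<alpha> / \<kappa>) (abs_L2 f) g \<longrightarrow>
                weighted_norm q (\<lambda>x. \<omega> x powr q) g
                \<le> ennreal C
                   * (A_const (1 + 1 / p0 - 1 / p) \<omega> * RH_const (RH_exponent q q0) \<omega>)
                       epowr (1 + max (p0 * p / (p - p0) * (1 / q))
                                      (dual_exponent q q0 * (1 / conj_exp p)))
                   * weighted_norm p (\<lambda>x. \<omega> x powr p) f))"
proof -
  interpret frac_setup L p0 \<epsilon> \<kappa> q0
    by unfold_locales (use assms in \<open>auto simp: condA1_def\<close>)
  define r1 where "r1 = p0 * p / (p - p0)"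
  define r2 where "r2 = dual_exponent q q0"
  define p' where "p' = conj_exp p"
  define q' where "q' = conj_exp q"
  define \<eta> where "\<eta> = 1 / p - 1 / q"
  define a where "a = \<alpha> / \<kappa>"
  define e where "e = 1 + max (r1 / q) (r2 / p')"
  have pq: "0 < p0" "p0 < p" "1 < p" "p < q" "1 < q" using assms by auto
  have conj: "1 / p + 1 / p' = 1" "1 / q + 1 / q' = 1"
    using pq by (simp_all add: p'_def q'_def conj_exp_def field_simps)
  have q': "1 < q'" by (rule conjugate_gt_1[OF pq(5) conj(2)])
  have r1: "0 < r1" "1 / p0 = 1 / p + 1 / r1" "1 + 1 / p0 - 1 / p = 1 + 1 / r1"
    using pq by (simp_all add: r1_def field_simps)
  have r2: "0 < r2" "1 / r2 = 1 / q - recip q0" "RH_exponent q q0 = r2"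
  proof -
    have "0 < r2 \<and> 1 / r2 = 1 / q - recip q0 \<and> RH_exponent q q0 = r2"
    proof (cases q0)
      case (real r)
      then have "q < r" using assms(9) pq by (simp add: ennreal_less_iff)
      then show ?thesis using real pq
        by (simp add: r2_def dual_exponent_def RH_exponent_def conj_exp_def recip_ennreal field_simps)
    next
      case top
      then show ?thesis using pq by (simp add: r2_def dual_exponent_def RH_exponent_def recip_infinity)
    qed
    then show "0 < r2" "1 / r2 = 1 / q - recip q0" "RH_exponent q q0 = r2" by auto
  qed
  have s0': "0 < s0" "1 / s0 = 1 / q' + 1 / r2" using s0 conj(2) r2(2) by auto
  have \<eta>: "0 < \<eta>" "1 / p + 1 / q' = 1 + \<eta>"
    using pq conj(2) unfolding \<eta>_def by (simp add: field_simps, linarith)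
  have a: "a = real CARD('n) * \<eta> / \<kappa>" "0 < a" "a < real CARD('n) / \<kappa> * (1 / p0 - 1 / q)"
  proof -
    show 1: "a = real CARD('n) * \<eta> / \<kappa>" by (simp add: a_def assms(10) \<eta>_def)
    show "0 < a" using 1 \<eta>(1) \<kappa> by simp
    \<comment> \<open>Since p0 < p, the decay rate at large times is strictly larger than a, as
      convergence at infinity demands.\<close>
    have "\<eta> < 1 / p0 - 1 / q" using pq unfolding \<eta>_def by (simp add: frac_less2)
    then have "real CARD('n) / \<kappa> * \<eta> < real CARD('n) / \<kappa> * (1 / p0 - 1 / q)"
      using \<kappa> by (intro mult_strict_left_mono) auto
    then show "a < real CARD('n) / \<kappa> * (1 / p0 - 1 / q)" using 1 by simp
  qed
  have q_range: "p0 < q" "ennreal q < q0" using pq assms(9) by auto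
  obtain C1 where C1: "0 \<le> C1" "\<And>(b :: 'n set) v u K F wF H wH \<Q>. weight_pair b v u r1 r2 K \<Longrightarrow>
      integrable lebesgue F \<Longrightarrow> (\<forall>x. 0 \<le> F x) \<Longrightarrow> integrable lebesgue wF \<Longrightarrow> (\<forall>x. 0 \<le> wF x) \<Longrightarrow>
      (AE x in lebesgue. F x = wF x powr (p0 / p) * v x powr (1 - p0 / p)) \<Longrightarrow>
      integrable lebesgue H \<Longrightarrow> (\<forall>x. 0 \<le> H x) \<Longrightarrow> integrable lebesgue wH \<Longrightarrow> (\<forall>x. 0 \<le> wH x) \<Longrightarrow>
      (AE x in lebesgue. H x = wH x powr (s0 / q') * u x powr (1 - s0 / q')) \<Longrightarrow>
      finite \<Q> \<Longrightarrow> \<Q> \<subseteq> grid b \<Longrightarrow>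
      (\<Sum>Q\<in>\<Q>. vol Q powr (1 / p + 1 / q') * ((wint F Q / vol Q) powr (1 / p0)
          * (wint H Q / vol Q) powr (1 / s0)))
      \<le> C1 * (K powr e * ((\<integral>x. wF x \<partial>lebesgue) powr (1 / p) * (\<integral>x. wH x \<partial>lebesgue) powr (1 / q')))"
    using bilinear_grid[OF pq(1-4) conj s0'(1) r1(2) s0'(2)] unfolding e_def[symmetric]
        by (elim exE conjE) (rule that, blast+)
  obtain C2 where C2: "0 \<le> C2" "\<And>f h W N. bounded_comp_supp f \<Longrightarrow> test_fun h \<Longrightarrow>
    \<forall>(b :: 'n set) \<Q>. finite \<Q> \<longrightarrow> \<Q> \<subseteq> grid b \<longrightarrow> (\<Sum>R\<in>\<Q>. vol R powr (1 + \<eta>) * (Fav f R * Hav h R)) \<le> W \<Longrightarrow>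
    wnorm h (integral {3 powr (- (\<kappa> * real N))..3 powr (\<kappa>
        * real N)} (\<lambda>s. s powr (a - 1) *\<^sub>R E s (abs_L2 f))) \<le> C2 * W"
    using dominate[OF \<eta>(1) a(1)] by blast
  have Ga: "0 < Gamma a" using a(2) by simp
  \<comment> \<open>Both constants were obtained before any weight or function is fixed, so C0
    depends on L and the exponents only.\<close>
  define C0 where "C0 = 1 / Gamma a * (C2 * C1)"
  have C0: "0 \<le> C0" using Ga C1(1) C2(1) by (simp add: C0_def)
  have main: "(\<exists>g. is_neg_power L a (abs_L2 f) g) \<and> (\<forall>g. is_neg_power L a (abs_L2 f) g \<longrightarrow>
      weighted_norm q (\<lambda>x. \<omega> x powr q) g \<le> ennreal (C0 + 1) * (A_const (1 + 1 / r1) \<omega>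
          * RH_const r2 \<omega>) epowr e * weighted_norm p (\<lambda>x. \<omega> x powr p) f)"
    if \<omega>: "weight \<omega>" and A: "A_const (1 + 1 / r1) \<omega> < \<infinity>" and RH: "RH_const r2 \<omega> < \<infinity>" and f:
        "bounded_comp_supp f"
    for \<omega> f
  proof -
    let ?T = "\<lambda>N :: nat. trunc a (abs_L2 f) (3 powr (- (\<kappa> * real N))) (3 powr (\<kappa> * real N))"
    obtain g where g: "g \<in> borel_measurable lebesgue" "is_neg_power L a (abs_L2 f) g"
      "AE x in lebesgue. (\<lambda>N. rep_L2 (?T N) x) \<longlonglongrightarrow> g x"
      by (rule neg_power_exists[OF q_range f a(2,3)])
    define K where "K = enn2real (A_const (1 + 1 / r1) \<omega> * RH_const r2 \<omega>)"
    have AR: "A_const (1 + 1 / r1) \<omega> * RH_const r2 \<omega> = ennreal K"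
      unfolding K_def using A RH by (simp add: ennreal_mult_less_top)
    have wp: "weight_pair b (\<lambda>x. \<omega> x powr (- r1)) (\<lambda>x. \<omega> x powr r2) r1 r2 K" for b :: "'n set"
      unfolding K_def by (rule weight_pair_of_consts[OF \<omega> r1(1) r2(1) refl A RH])
    have K1: "1 \<le> K" by (rule weight_pair.K_ge_1[OF wp])
    have w: "\<omega> \<in> borel_measurable lebesgue" "\<And>x. 0 \<le> \<omega> x" "AE x in lebesgue. 0 < \<omega> x" using \<omega>
        by (auto simp: weight_def)
    have fm: "f \<in> borel_measurable lebesgue" using f by (simp add: bounded_comp_supp_def)
    have norm_eq: "weighted_norm s (\<lambda>x. \<omega> x powr s) k = (\<integral>\<^sup>+x. ennreal (norm (k x) powr s
        * \<omega> x powr s) \<partial>lebesgue) epowr (1 / s)"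
      if "1 < s" "k \<in> borel_measurable lebesgue" for s k
      using that w(1) by (simp add: weighted_norm_def lp_norm_def nn_integral_density mult.commute
          flip: ennreal_mult')
    define wF where "wF x = norm (f x) powr p * \<omega> x powr p" for x
    have bound: "weighted_norm q (\<lambda>x. \<omega> x powr q) g \<le> ennreal (C0 + 1) * ennreal K epowr e
        * weighted_norm p (\<lambda>x. \<omega> x powr p) f"
    proof (cases "(\<integral>\<^sup>+x. ennreal (wF x) \<partial>lebesgue) = \<infinity>")
      case True
      then have "weighted_norm p (\<lambda>x. \<omega> x powr p) f = \<infinity>" using norm_eq[OF pq(3) fm]
          by (simp add: wF_def epowr_def)
      \<comment> \<open>C0 may vanish, and 0 times \<infinity> is 0. The final constant is therefore
        C0 + 1, which keeps the right-hand side infinite when the norm of f is.\<close>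
      moreover have "ennreal (C0 + 1) * ennreal K epowr e \<noteq> 0" using C0 K1 by (simp add: epowr_def)
      ultimately show ?thesis by (simp add: ennreal_mult_top)
    next
      case False
      have "wF \<in> borel_measurable lebesgue" unfolding wF_def[abs_def] using w(1) fm by measurable
      then have wF: "integrable lebesgue wF" "\<And>x. 0 \<le> wF x"
        using False by (auto simp: less_top intro!: integrableI_nonneg) (simp_all add: wF_def)
      define X where "X = (\<integral>x. wF x \<partial>lebesgue)"
      have X0: "0 \<le> X" using wF by (simp add: X_def)
      have nnX: "(\<integral>\<^sup>+x. ennreal (wF x) \<partial>lebesgue) = ennreal X" unfolding X_def using wF
          by (intro nn_integral_eq_integral) auto
      define B where "B = C0 * (K powr e * X powr (1 / p))"
      have B0: "0 \<le> B" using C0 by (simp add: B_def)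
      have "(\<integral>\<^sup>+x. ennreal (norm (g x) powr q * \<omega> x powr q) \<partial>lebesgue) \<le> ennreal (B powr q)"
      proof (rule nn_integral_powr_le_by_duality[OF g(1) \<omega> pq(5) conj(2) B0])
        fix h assume h: "test_fun h" and wH: "integrable lebesgue (\<lambda>x. h x powr q' * \<omega> x powr (- q'))"
        define Y where "Y = (\<integral>x. h x powr q' * \<omega> x powr (- q') \<partial>lebesgue)"
        have h0: "0 \<le> h x" for x using h by (simp add: test_fun_def)
        define W where "W = C1 * (K powr e * (X powr (1 / p) * Y powr (1 / q')))"
        have W: "(\<Sum>R\<in>\<Q>. vol R powr (1 + \<eta>) * (Fav f R * Hav h R)) \<le> W" if "finite \<Q>" "\<Q> \<subseteq> grid b" for b \<Q>
          unfolding Fav_def Hav_def W_def X_def Y_def \<eta>(2)[symmetric]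
        proof (rule C1(2)[OF wp])
          show "integrable lebesgue (\<lambda>x. norm (f x) powr p0)" by (rule bcs_integrable[OF f pq(1)])
          show "integrable lebesgue (\<lambda>x. h x powr s0)" by (rule test_fun_integrable[OF h s0'(1)])
          \<comment> \<open>Balance of the powers of \<omega> in the factorisation of |f|^p0 through
            |f|^p \<omega>^p and v, the form that Doob's estimate takes; \<open>x2\<close> is its
            counterpart for h and u.\<close>
          have x1: "p0 + - r1 * (1 - p0 / p) = 0" using pq by (simp add: r1_def field_simps)
          have x2: "- s0 + r2 * (1 - s0 / q') = 0"
          proof -
            have "1 - s0 / q' = s0 * (1 / s0 - 1 / q')" using s0'(1) by (simp add: field_simps)
            also have "\<dots> = s0 / r2" using s0'(2) by simp
            finally show ?thesis using r2(1) by simp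
          qed
          show "AE x in lebesgue. norm (f x) powr p0 = wF x powr (p0 / p)
              * (\<omega> x powr (- r1)) powr (1 - p0 / p)"
            using w(3)
          proof eventually_elim
            case (elim x)
            have "wF x powr (p0 / p) * (\<omega> x powr (- r1)) powr (1 - p0 / p)
              = norm (f x) powr p0 * (\<omega> x powr p0 * \<omega> x powr (- r1 * (1 - p0 / p)))"
              using pq w(2) by (simp add: wF_def powr_mult powr_powr)
            also have "\<omega> x powr p0 * \<omega> x powr (- r1 * (1 - p0 / p)) = 1"
              using elim x1 by (simp flip: powr_add)
            finally show ?case by simp
          qed
          show "AE x in lebesgue. h x powr s0 = (h x powr q' * \<omega> x powr (- q')) powr (s0 / q')
              * (\<omega> x powr r2) powr (1 - s0 / q')"
            using w(3)
          proof eventually_elim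
            case (elim x)
            have "(h x powr q' * \<omega> x powr (- q')) powr (s0 / q') * (\<omega> x powr r2) powr (1 - s0 / q')
              = h x powr s0 * (\<omega> x powr (- s0) * \<omega> x powr (r2 * (1 - s0 / q')))"
              using q' w(2) h0 by (simp add: powr_mult powr_powr)
            also have "\<omega> x powr (- s0) * \<omega> x powr (r2 * (1 - s0 / q')) = 1"
              using elim x2 by (simp flip: powr_add)
            finally show ?case by simp
          qed
        qed (use wF wH that in auto)
        have wn: "wnorm h (?T N) \<le> B * Y powr (1 / q')" for N
        proof -
          have "wnorm h (?T N)
            = 1 / Gamma a * wnorm h (integral {3 powr (- (\<kappa> * real N))..3 powr (\<kappa>
                * real N)} (\<lambda>s. s powr (a - 1) *\<^sub>R E s (abs_L2 f)))"
            using Ga by (simp add: trunc_def wnorm_scaleR[OF test_fun_sq_weight'[OF h]])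
          also have "\<dots> \<le> 1 / Gamma a * (C2 * W)" using Ga W by (intro mult_left_mono C2(2)[OF f h]) auto
          also have "\<dots> = B * Y powr (1 / q')" by (simp add: W_def B_def C0_def)
          finally show ?thesis .
        qed
        \<comment> \<open>The bound on truncations is uniform in N, so Fatou's lemma along the
          pointwise convergent sequence passes it to g.\<close>
        have "(\<integral>\<^sup>+x. ennreal (norm (g x) * h x) \<partial>lebesgue)
          = (\<integral>\<^sup>+x. liminf (\<lambda>N. ennreal (norm (rep_L2 (?T N) x) * h x)) \<partial>lebesgue)"
        proof (rule nn_integral_cong_AE, use g(3) in eventually_elim)
          case (elim x)
          have "(\<lambda>N. ennreal (norm (rep_L2 (?T N) x) * h x))
            \<longlonglongrightarrow> ennreal (norm (g x) * h x)"
            by (intro tendsto_ennrealI tendsto_mult tendsto_norm elim tendsto_const)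
          then show ?case by (rule lim_imp_Liminf[OF trivial_limit_sequentially, symmetric])
        qed
        also have "\<dots> \<le> liminf (\<lambda>N. \<integral>\<^sup>+x. ennreal (norm (rep_L2 (?T N) x) * h x) \<partial>lebesgue)"
          using test_fun_measurable[OF h] by (intro nn_integral_liminf) measurable
        also have "\<dots> \<le> liminf (\<lambda>N. ennreal (B * Y powr (1 / q')))"
        proof (intro Liminf_mono always_eventually allI)
          fix N
          have "(\<integral>\<^sup>+x. ennreal (norm (rep_L2 (?T N) x) * h x) \<partial>lebesgue)
            = ennreal (wnorm h (?T N))"
            unfolding wnorm_def
            by (rule nn_integral_eq_integral[OF wnorm_integrable(1)[OF test_fun_sq_weight'[OF h]]])
                (use h0 in auto)
          also have "\<dots> \<le> ennreal (B * Y powr (1 / q'))" by (intro ennreal_leI wn)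
          finally show "(\<integral>\<^sup>+x. ennreal (norm (rep_L2 (?T N) x) * h x) \<partial>lebesgue)
            \<le> ennreal (B * Y powr (1 / q'))" .
        qed
        finally show "(\<integral>\<^sup>+x. ennreal (norm (g x) * h x) \<partial>lebesgue) \<le> ennreal (B * (\<integral>x. h x powr q'
            * \<omega> x powr (- q') \<partial>lebesgue) powr (1 / q'))"
          by (simp add: Liminf_const Y_def)
      qed
      then have "weighted_norm q (\<lambda>x. \<omega> x powr q) g \<le> ennreal B"
        unfolding norm_eq[OF pq(5) g(1)] using pq B0 by (subst epowr_le_iff) auto
      also have "\<dots> \<le> ennreal ((C0 + 1) * (K powr e * X powr (1 / p)))"
        unfolding B_def by (intro ennreal_leI mult_right_mono) auto
      also have "\<dots> = ennreal (C0 + 1) * ennreal K epowr e * weighted_norm p (\<lambda>x. \<omega> x powr p) f"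
        unfolding norm_eq[OF pq(3) fm] using nnX X0 C0 K1
            by (simp add: wF_def epowr_def ennreal_mult mult.assoc)
      finally show ?thesis .
    qed
    show ?thesis
    proof (intro conjI allI impI)
      show "\<exists>g. is_neg_power L a (abs_L2 f) g" using g(2) by blast
      \<comment> \<open>An arbitrary version k of the fractional power agrees almost everywhere with
        the constructed g, so its weighted norm is the same.\<close>
      fix k assume k: "is_neg_power L a (abs_L2 f) k"
      have km: "k \<in> borel_measurable lebesgue" using k by (simp add: is_neg_power_def)
      have "(\<integral>\<^sup>+x. ennreal (norm (k x) powr q * \<omega> x powr q) \<partial>lebesgue)
          = (\<integral>\<^sup>+x. ennreal (norm (g x) powr q * \<omega> x powr q) \<partial>lebesgue)"
        by (intro nn_integral_cong_AE eventually_mono[OF is_neg_power_unique[OF k g(2)]]) simp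
      then have "weighted_norm q (\<lambda>x. \<omega> x powr q) k = weighted_norm q (\<lambda>x. \<omega> x powr q) g"
        by (simp add: norm_eq[OF pq(5) km] norm_eq[OF pq(5) g(1)])
      then show "weighted_norm q (\<lambda>x. \<omega> x powr q) k
        \<le> ennreal (C0 + 1) * (A_const (1 + 1 / r1) \<omega> * RH_const r2 \<omega>) epowr e
            * weighted_norm p (\<lambda>x. \<omega> x powr p) f"
        using bound by (simp add: AR)
    qed
  qed
  have e_eq: "1 + max (p0 * p / (p - p0) * (1 / q)) (dual_exponent q q0 * (1 / conj_exp p)) = e"
    by (simp add: e_def r1_def r2_def p'_def)
  show ?thesis
    unfolding r1(3) r2(3) e_eq a_def[symmetric] using main by (intro exI[of _ "C0 + 1"]) blast
qed

end
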